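(* There exists $\overline{V}>0$ such that for every $0<V\le\overline{V}$ we have $F_s(V)=V$. As a consequence, for every $0<V<\overline{V}$ there exists no minimizer of the problem defining $F_s(V)$, i.e. there is no $(u,h)\in\mathcal{A}_V$ with $E_V(u,h)+S_V(h)=F_s(V)$.
   Context: For a nonnegative $h\in H^1(\mathbb{R})$ (identified with its continuous representative), let $\Omega_h:=\{(x,y)\in\mathbb{R}^2: 0<y<h(x)\}$. For $V>0$, let $\mathcal{A}_V$ be the set of pairs $(u,h)$ with $h\in H^1(\mathbb{R})$, $h\ge 0$, $u\in H^1(\Omega_h)$ real-valued, $\int_{\mathbb{R}}h\,dx=V$, and $u(x,0)=x$ (in the sense of traces) for $x\in\operatorname{supp}h$. Set $$E_V(u,h):=\int_{\Omega_h}|\nabla u|^2\,dx\,dy,\qquad S_V(h):=\int_{\mathbb{R}}h'^2\,dx,\qquad F_s(V):=\inf\{E_V(u,h)+S_V(h): (u,h)\in\mathcal{A}_V\}.$$ *)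

theory Defs
  imports "HOL-Analysis.Analysis"
begin

definition gradient :: "('a::euclidean_space \<Rightarrow> real) \<Rightarrow> 'a \<Rightarrow> 'a" where
  "gradient f x = (\<Sum>b\<in>Basis. frechet_derivative f (at x) b *\<^sub>R b)"

text \<open>A function is of class \<open>C\<^sup>k\<close> iff it is differentiable and all its directional derivatives are
  of class \<open>C\<^bsup>k-1\<^esup>\<close>.\<close>

primrec Ck :: "nat \<Rightarrow> ('a::euclidean_space \<Rightarrow> real) \<Rightarrow> bool" where
  "Ck 0 f \<longleftrightarrow> continuous_on UNIV f"
| "Ck (Suc k) f \<longleftrightarrow>
     (\<forall>x. f differentiable (at x)) \<and> (\<forall>v. Ck k (\<lambda>x. frechet_derivative f (at x) v))"

definition smooth :: "('a::euclidean_space \<Rightarrow> real) \<Rightarrow> bool" where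
  "smooth f \<longleftrightarrow> (\<forall>k. Ck k f)"

definition supp :: "('a::euclidean_space \<Rightarrow> real) \<Rightarrow> 'a set" where
  "supp f = closure {x. f x \<noteq> 0}"

definition test_function :: "'a::euclidean_space set \<Rightarrow> ('a \<Rightarrow> real) \<Rightarrow> bool" where
  "test_function \<Omega> \<phi> \<longleftrightarrow> smooth \<phi> \<and> compact (supp \<phi>) \<and> supp \<phi> \<subseteq> \<Omega>"

definition loc_integrable :: "'a::euclidean_space set \<Rightarrow> ('a \<Rightarrow> 'b::euclidean_space) \<Rightarrow> bool" where
  "loc_integrable \<Omega> f \<longleftrightarrow> (\<forall>K. compact K \<longrightarrow> K \<subseteq> \<Omega> \<longrightarrow> set_integrable lebesgue K f)"

definition L2 :: "'a::euclidean_space set \<Rightarrow> ('a \<Rightarrow> 'b::euclidean_space) \<Rightarrow> bool" where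
  "L2 \<Omega> f \<longleftrightarrow> set_borel_measurable lebesgue \<Omega> f \<and> set_integrable lebesgue \<Omega> (\<lambda>x. (norm (f x))\<^sup>2)"

text \<open>Sobolev functions on an open set \<open>\<Omega>\<close> are represented by total functions of which only the
  values on \<open>\<Omega>\<close>, up to null sets, are relevant. On the real line the weak gradient is the weak
  derivative, as the only basis vector is \<open>1\<close>.\<close>

definition has_weak_gradient ::
    "'a::euclidean_space set \<Rightarrow> ('a \<Rightarrow> real) \<Rightarrow> ('a \<Rightarrow> 'a) \<Rightarrow> bool" where
  "has_weak_gradient \<Omega> u g \<longleftrightarrow> loc_integrable \<Omega> u \<and> loc_integrable \<Omega> g \<and>
     (\<forall>\<phi>. test_function \<Omega> \<phi> \<longrightarrow>
        (LINT x:\<Omega>|lebesgue. u x *\<^sub>R gradient \<phi> x) = - (LINT x:\<Omega>|lebesgue. \<phi> x *\<^sub>R g x))"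

text \<open>The weak gradient is unique up to null sets, so the choice does not affect integrals.\<close>

definition weak_gradient :: "'a::euclidean_space set \<Rightarrow> ('a \<Rightarrow> real) \<Rightarrow> 'a \<Rightarrow> 'a" where
  "weak_gradient \<Omega> u = (SOME g. has_weak_gradient \<Omega> u g)"

definition H1 :: "'a::euclidean_space set \<Rightarrow> ('a \<Rightarrow> real) set" where
  "H1 \<Omega> = {u. L2 \<Omega> u \<and> (\<exists>g. has_weak_gradient \<Omega> u g \<and> L2 \<Omega> g)}"

definition subgraph :: "(real \<Rightarrow> real) \<Rightarrow> (real \<times> real) set" where
  "subgraph h = {(x, y). 0 < y \<and> y < h x}"

text \<open>The trace operator on the base \<open>(a,b) \<times> {0}\<close> of the rectangle \<open>(a,b) \<times> (0,d)\<close> is the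
  continuous extension of the restriction map, from functions smooth up to the boundary to \<open>H\<^sup>1\<close>:
  \<open>\<tau>\<close> is the trace of \<open>u\<close> if \<open>\<phi>\<^sub>n \<rightarrow> u\<close> in \<open>H\<^sup>1\<close> of the rectangle and \<open>\<phi>\<^sub>n(\<cdot>,0) \<rightarrow> \<tau>\<close> in \<open>L\<^sup>2(a,b)\<close> for
  some smooth \<open>\<phi>\<^sub>n\<close>.\<close>

definition rectangle_trace ::
    "real \<Rightarrow> real \<Rightarrow> real \<Rightarrow> (real \<times> real \<Rightarrow> real) \<Rightarrow> (real \<Rightarrow> real) \<Rightarrow> bool" where
  "rectangle_trace a b d u \<tau> \<longleftrightarrow>
     (let Q = {a<..<b} \<times> {0<..<d} in
      u \<in> H1 Q \<and> L2 {a<..<b} \<tau> \<and>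
      (\<exists>\<phi> :: nat \<Rightarrow> real \<times> real \<Rightarrow> real.
         (\<forall>n. smooth (\<phi> n)) \<and>
         (\<lambda>n. LINT z:Q|lebesgue. (\<phi> n z - u z)\<^sup>2) \<longlonglongrightarrow> 0 \<and>
         (\<lambda>n. LINT z:Q|lebesgue. (norm (gradient (\<phi> n) z - weak_gradient Q u z))\<^sup>2) \<longlonglongrightarrow> 0 \<and>
         (\<lambda>n. LINT x:{a<..<b}|lebesgue. (\<phi> n (x, 0) - \<tau> x)\<^sup>2) \<longlonglongrightarrow> 0))"

text \<open>Traces on the line \<open>y = 0\<close> are taken locally, since \<open>subgraph h\<close> need not be a Lipschitz domain.
  As \<open>h\<close> is continuous, every point of \<open>{h > 0}\<close> lies in the base of an admissible rectangle, so
  \<open>\<tau>\<close> is determined almost everywhere on \<open>{h > 0}\<close>. Where \<open>h = 0\<close> there is no part of the domain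
  above the line, hence no trace, and \<open>\<tau>\<close> is arbitrary.\<close>

definition bottom_trace ::
    "(real \<Rightarrow> real) \<Rightarrow> (real \<times> real \<Rightarrow> real) \<Rightarrow> (real \<Rightarrow> real) \<Rightarrow> bool" where
  "bottom_trace h u \<tau> \<longleftrightarrow>
     (\<forall>a b d. a < b \<longrightarrow> 0 < d \<longrightarrow> {a<..<b} \<times> {0<..<d} \<subseteq> subgraph h \<longrightarrow> rectangle_trace a b d u \<tau>)"

definition admissible :: "real \<Rightarrow> ((real \<times> real \<Rightarrow> real) \<times> (real \<Rightarrow> real)) set" where
  "admissible V = {(u, h).
     h \<in> H1 UNIV \<and> continuous_on UNIV h \<and> (\<forall>x. 0 \<le> h x) \<and>
     u \<in> H1 (subgraph h) \<and>
     has_bochner_integral lebesgue h V \<and>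
     (\<exists>\<tau>. bottom_trace h u \<tau> \<and> (AE x in lebesgue. x \<in> supp h \<longrightarrow> \<tau> x = x))}"

definition elastic_energy :: "(real \<times> real \<Rightarrow> real) \<Rightarrow> (real \<Rightarrow> real) \<Rightarrow> real" where
  "elastic_energy u h =
     (LINT z:subgraph h|lebesgue. (norm (weak_gradient (subgraph h) u z))\<^sup>2)"

definition surface_energy :: "(real \<Rightarrow> real) \<Rightarrow> real" where
  "surface_energy h = (LINT x|lebesgue. (weak_gradient UNIV h x)\<^sup>2)"

definition min_energy :: "real \<Rightarrow> real" where
  "min_energy V = Inf {elastic_energy u h + surface_energy h | u h. (u, h) \<in> admissible V}"

end

theory Submission
  imports Defs
begin

text \<open>The infimum equals \<open>V\<close> because flat profiles come arbitrarily close to the energy \<open>V\<close>, while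
  the elastic energy is bounded below by duality.

  For the upper bound take \<open>u(x,y) = x\<close>: then \<open>|\<nabla>u| = 1\<close>, so the elastic energy is the area \<open>V\<close> of
  the subgraph, and spreading the volume over a long interval makes the surface energy
  arbitrarily small (\<open>energy_near_volume\<close>).

  For the lower bound, write \<open>S\<close> for the surface energy of \<open>h\<close>. The field \<open>p = (1, h'(x))\<close> is
  divergence free and tangent to the graph of \<open>h\<close>, so by the divergence theorem the integral of
  \<open>p \<bullet> \<nabla>u\<close> over the subgraph depends only on the values of \<open>u\<close> on the bottom; as these are
  \<open>u(x,0) = x\<close>, it equals \<open>V\<close>. The integral of \<open>|p|\<^sup>2\<close> is \<open>V + \<integral> h h'\<^sup>2 \<le> V + (sup h) S\<close>, and
  \<open>|\<nabla>u|\<^sup>2 \<ge> 2 p \<bullet> \<nabla>u - |p|\<^sup>2\<close> gives an elastic energy of at least \<open>V - (sup h) S\<close>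
  (\<open>elastic_energy_lower_bound\<close>). If \<open>S > V\<close>, the total energy exceeds \<open>V\<close> trivially. Otherwise
  \<open>h \<le> V + sqrt S \<le> V + sqrt V\<close> (\<open>height_le\<close>), which is smaller than \<open>1\<close> for small \<open>V\<close>, and the total
  energy is at least \<open>V + (1 - sup h) S\<close>. This is strictly larger than \<open>V\<close>, as \<open>S = 0\<close> would force
  the integrable function \<open>h\<close> to be constant (\<open>energy_gt_volume\<close>). Hence the infimum is \<open>V\<close> and is
  not attained.

  The divergence theorem is not available directly: \<open>h'\<close> is only square integrable, the subgraph
  may have cusps, and the boundary values of \<open>u\<close> are given by traces on rectangles with base on the
  line \<open>y = 0\<close>. Therefore \<open>p\<close> is replaced by the rotated gradient \<open>(- \<Psi>\<^sub>y, \<Psi>\<^sub>x)\<close> of a stream function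
  \<open>\<Psi>(x,y) = G(k(x) - y)\<close>, where \<open>k \<le> h\<close> is continuously differentiable with compact support and \<open>G\<close>
  is a smoothed positive part. Multiplying \<open>\<Psi>\<close> by the members of a partition of unity in \<open>x\<close>
  localises it to strips so narrow that the support of each piece lies in a rectangle
  contained in the subgraph. There the function \<open>u\<close> is approximated by smooth functions, for which the
  computation is elementary (\<open>rectangle_divergence_free_trace\<close>, \<open>strip_flux\<close>), and the pieces add
  up (\<open>elastic_energy_ge\<close>). As \<open>k\<close> one takes averages of \<open>max 0 (h - \<delta>)\<close> over short intervals;
  averaging does not increase the Dirichlet integral (\<open>elastic_energy_ge_truncated\<close>).

  Weak gradients are chosen by a description operator, so all of this also needs their
  uniqueness up to null sets (\<open>has_weak_gradient_unique\<close>), and with it a supply of smooth functions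
  with compact support.\<close>

section \<open>Smooth bump functions\<close>

lemma Ck_SucI:
  assumes "\<And>x. (f has_derivative D x) (at x)" and "\<And>v. Ck k (\<lambda>x. D x v)"
  shows "Ck (Suc k) f"
proof -
  have "frechet_derivative f (at x) = D x" for x
    using frechet_derivative_at[OF assms(1)] by simp
  then show ?thesis
    using assms by (auto simp: differentiable_def)
qed

lemma Ck_Suc_has_derivative:
  assumes "Ck (Suc k) f"
  shows "(f has_derivative frechet_derivative f (at x)) (at x)"
  using assms by (auto simp: frechet_derivative_works)

lemma Ck_Suc_imp_continuous: "Ck (Suc k) f \<Longrightarrow> continuous_on S f"
  by (auto intro!: continuous_at_imp_continuous_on differentiable_imp_continuous_within)

lemma Ck_imp_continuous: "Ck k f \<Longrightarrow> continuous_on S f"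
  by (cases k) (auto intro: continuous_on_subset Ck_Suc_imp_continuous simp del: Ck.simps(2))

lemma Ck_SucD: "Ck (Suc k) f \<Longrightarrow> Ck k f"
proof (induction k arbitrary: f)
  case 0
  then show ?case using Ck_Suc_imp_continuous[of 0 f UNIV] by (simp del: Ck.simps(2))
next
  case (Suc k)
  then show ?case by simp
qed

lemma Ck_const: "Ck k (\<lambda>x. c)"
proof (induction k arbitrary: c)
  case (Suc k)
  show ?case by (rule Ck_SucI[where D="\<lambda>x v. 0"]) (auto intro: Suc)
qed simp

lemma Ck_add: "Ck k f \<Longrightarrow> Ck k g \<Longrightarrow> Ck k (\<lambda>x. f x + g x)"
proof (induction k arbitrary: f g)
  case (Suc k)
  show ?case
  proof (rule Ck_SucI)
    show "((\<lambda>x. f x + g x) has_derivative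
        (\<lambda>v. frechet_derivative f (at x) v + frechet_derivative g (at x) v)) (at x)" for x
      by (rule has_derivative_add[OF Suc.prems[THEN Ck_Suc_has_derivative]])
    show "Ck k (\<lambda>x. frechet_derivative f (at x) v + frechet_derivative g (at x) v)" for v
      by (intro Suc.IH) (use Suc.prems in auto)
  qed
qed (auto intro: continuous_on_add continuous_on_mult)

lemma Ck_mult: "Ck k f \<Longrightarrow> Ck k g \<Longrightarrow> Ck k (\<lambda>x. f x * g x)"
proof (induction k arbitrary: f g)
  case (Suc k)
  show ?case
  proof (rule Ck_SucI)
    show "((\<lambda>x. f x * g x) has_derivative
        (\<lambda>v. f x * frechet_derivative g (at x) v + frechet_derivative f (at x) v * g x)) (at x)" for x
      by (rule has_derivative_mult[OF Suc.prems[THEN Ck_Suc_has_derivative]])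
    show "Ck k (\<lambda>x. f x * frechet_derivative g (at x) v + frechet_derivative f (at x) v * g x)" for v
      by (intro Ck_add Suc.IH Suc.prems[THEN Ck_SucD]) (use Suc.prems in auto)
  qed
qed (auto intro: continuous_on_add continuous_on_mult)

lemma Ck_prod: "finite I \<Longrightarrow> (\<And>i. i \<in> I \<Longrightarrow> Ck k (f i)) \<Longrightarrow> Ck k (\<lambda>x. \<Prod>i\<in>I. f i x)"
  by (induction I rule: finite_induct) (auto intro: Ck_const Ck_mult)

lemma Ck_affine:
  assumes "bounded_linear L"
  shows "Ck k (\<lambda>x. L x + c)"
proof (cases k)
  case 0
  then show ?thesis
    using continuous_on_add[OF linear_continuous_on[OF assms] continuous_on_const] by simp
next
  case (Suc j)
  show ?thesis
    unfolding Suc by (rule Ck_SucI[where D="\<lambda>x. L"])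
      (use has_derivative_add[OF bounded_linear_imp_has_derivative[OF assms] has_derivative_const]
        in \<open>auto intro: Ck_const\<close>)
qed

lemma Ck_compose_affine:
  fixes f :: "real \<Rightarrow> real"
  assumes "bounded_linear L"
  shows "Ck k f \<Longrightarrow> Ck k (\<lambda>x. f (L x + c))"
proof (induction k arbitrary: f)
  case 0
  have "continuous_on UNIV (\<lambda>x. L x + c)"
    using Ck_affine[OF assms, of 0 c] by simp
  with 0 show ?case
    using continuous_on_compose2[of UNIV f UNIV "\<lambda>x. L x + c"] by simp
next
  case (Suc k)
  show ?case
  proof (rule Ck_SucI)
    show "((\<lambda>x. f (L x + c)) has_derivative (\<lambda>v. L v * frechet_derivative f (at (L x + c)) 1)) (at x)" for x
    proof -
      have f: "(f has_derivative frechet_derivative f (at (L x + c))) (at (L x + c))"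
        using Suc.prems by (rule Ck_Suc_has_derivative)
      have L: "((\<lambda>x. L x + c) has_derivative L) (at x)"
        using has_derivative_add[OF bounded_linear_imp_has_derivative[OF assms] has_derivative_const] by simp
      have "((\<lambda>x. f (L x + c)) has_derivative (\<lambda>v. frechet_derivative f (at (L x + c)) (L v))) (at x)"
        by (rule has_derivative_compose[where f="\<lambda>x. L x + c" and g=f, OF L]) (rule f)
      moreover have "frechet_derivative f (at (L x + c)) (L v) = L v * frechet_derivative f (at (L x + c)) 1" for v
        using linear_cmul[OF has_derivative_linear[OF f], of "L v" 1] by simp
      ultimately show ?thesis by (simp only:)
    qed
    have "Ck k (\<lambda>t. frechet_derivative f (at t) 1)"
      using Suc.prems by simp
    then show "Ck k (\<lambda>x. L v * frechet_derivative f (at (L x + c)) 1)" for v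
      by (intro Ck_mult Ck_const Suc.IH)
  qed
qed

text \<open>The functions \<open>t \<mapsto> P(1/t) exp(-1/t)\<close>, extended by \<open>0\<close> to \<open>t \<le> 0\<close>, form a class that is closed
  under differentiation. Hence each of them is smooth, and no formula for the higher derivatives of
  \<open>exp(-1/t)\<close> is needed.\<close>

definition exp_cutoff :: "real poly \<Rightarrow> real \<Rightarrow> real" where
  "exp_cutoff p t = (if t > 0 then poly p (1 / t) * exp (- 1 / t) else 0)"

lemma exp_cutoff_tendsto_0: "(exp_cutoff p \<longlongrightarrow> 0) (at 0)"
proof -
  have 1: "((\<lambda>u. poly p u / exp u) \<longlongrightarrow> 0) at_top" for p :: "real poly"
  proof -
    have "((\<lambda>u. \<Sum>i\<le>degree p. coeff p i * (u ^ i / exp u)) \<longlongrightarrow> (\<Sum>i\<le>degree p. coeff p i * 0)) at_top"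
      by (intro tendsto_sum tendsto_mult tendsto_const tendsto_power_div_exp_0)
    then show ?thesis
      by (simp add: poly_altdef sum_divide_distrib)
  qed
  have "((\<lambda>t. poly p (inverse t) / exp (inverse t)) \<longlongrightarrow> 0) (at_right 0)"
    by (rule filterlim_compose[OF 1 filterlim_inverse_at_top_right])
  then have r: "(exp_cutoff p \<longlongrightarrow> 0) (at_right 0)"
    by (rule Lim_transform_eventually)
      (auto simp: eventually_at_right_field exp_cutoff_def exp_minus field_simps intro!: exI[of _ 1])
  have "(exp_cutoff p \<longlongrightarrow> 0) (at_left 0)"
    by (rule Lim_transform_eventually[where f="\<lambda>_. 0"])
      (auto simp: eventually_at_left_field exp_cutoff_def intro!: exI[of _ "-1"])
  with r show ?thesis
    by (simp add: filterlim_at_split)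
qed

lemma exp_cutoff_DERIV:
  "(exp_cutoff p has_real_derivative exp_cutoff (monom 1 2 * (p - pderiv p)) t) (at t)"
proof (cases t "0::real" rule: linorder_cases)
  case less
  have "((\<lambda>_. 0) has_real_derivative 0) (at t)" by simp
  then have "(exp_cutoff p has_real_derivative 0) (at t)"
    by (rule has_field_derivative_transform_within_open[of _ _ _ "{..<0}"])
      (use less in \<open>auto simp: exp_cutoff_def\<close>)
  then show ?thesis using less by (simp add: exp_cutoff_def)
next
  case equal
  have "((\<lambda>y. exp_cutoff p y / y) \<longlongrightarrow> 0) (at 0)"
  proof (rule Lim_transform_eventually[OF exp_cutoff_tendsto_0[of "pCons 0 p"]])
    show "\<forall>\<^sub>F x in at 0. exp_cutoff (pCons 0 p) x = exp_cutoff p x / x"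
      by (auto simp: eventually_at_filter exp_cutoff_def)
  qed
  then show ?thesis
    unfolding equal has_field_derivative_iff by (simp add: exp_cutoff_def)
next
  case greater
  have "((\<lambda>t. poly p (1 / t) * exp (- 1 / t)) has_real_derivative
      exp_cutoff (monom 1 2 * (p - pderiv p)) t) (at t)"
    using greater
    by (auto intro!: derivative_eq_intros DERIV_chain2[OF poly_DERIV] simp: exp_cutoff_def poly_monom field_simps power2_eq_square)
  then show ?thesis
    by (rule has_field_derivative_transform_within_open[of _ _ _ "{0<..}"])
      (use greater in \<open>auto simp: exp_cutoff_def\<close>)
qed

lemma exp_cutoff_smult: "exp_cutoff (smult c p) t = c * exp_cutoff p t"
  by (simp add: exp_cutoff_def)

lemma Ck_exp_cutoff: "Ck k (exp_cutoff p)"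
proof (induction k arbitrary: p)
  case 0
  show ?case
    using exp_cutoff_DERIV[of p] by (auto intro!: continuous_at_imp_continuous_on DERIV_isCont)
next
  case (Suc k)
  let ?q = "monom 1 2 * (p - pderiv p)"
  show ?case
  proof (rule Ck_SucI)
    show "(exp_cutoff p has_derivative (\<lambda>v. exp_cutoff ?q x * v)) (at x)" for x
      using exp_cutoff_DERIV[of p x] unfolding has_field_derivative_def .
    show "Ck k (\<lambda>x. exp_cutoff ?q x * v)" for v
      using Suc[of "smult v ?q"] by (simp add: exp_cutoff_smult[abs_def] mult.commute)
  qed
qed

definition flat_step :: "real \<Rightarrow> real" where
  "flat_step = exp_cutoff 1"

lemma flat_step_eq: "flat_step t = (if t > 0 then exp (- 1 / t) else 0)"
  by (simp add: flat_step_def exp_cutoff_def)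

lemma flat_step_bounds: "0 \<le> flat_step t" "flat_step t \<le> 1"
  by (auto simp: flat_step_eq)

lemma flat_step_tendsto: "(\<lambda>n. flat_step (real n * t)) \<longlonglongrightarrow> (if t > 0 then 1 else 0)"
proof (cases "t > 0")
  case True
  have "(\<lambda>n. - (1 / t) * (1 / real n)) \<longlonglongrightarrow> - (1 / t) * 0"
    by (intro tendsto_intros lim_1_over_n)
  then have "(\<lambda>n. exp (- (1 / t) * (1 / real n))) \<longlonglongrightarrow> exp (- (1 / t) * 0)"
    by (rule tendsto_exp)
  then have "(\<lambda>n. exp (- (1 / t) * (1 / real n))) \<longlonglongrightarrow> 1" by simp
  then have "(\<lambda>n. flat_step (real n * t)) \<longlonglongrightarrow> 1"
    by (rule Lim_transform_eventually)
      (use True in \<open>auto simp: flat_step_eq field_simps intro!: eventually_sequentiallyI[of 1]\<close>)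
  then show ?thesis using True by simp
next
  case False
  then have "\<not> 0 < real n * t" for n by (simp add: zero_less_mult_iff)
  then show ?thesis using False by (simp add: flat_step_eq)
qed

text \<open>As \<open>flat_step (n t)\<close> increases to the indicator of \<open>t > 0\<close>, these smooth functions, supported in
  the closed box, converge boundedly to the indicator of the open box. This makes them usable as
  test functions without any normalisation.\<close>

definition box_bump :: "nat \<Rightarrow> 'a \<Rightarrow> 'a \<Rightarrow> 'a::euclidean_space \<Rightarrow> real" where
  "box_bump n a b x =
     (\<Prod>i\<in>Basis. flat_step (real n * ((x - a) \<bullet> i)) * flat_step (real n * ((b - x) \<bullet> i)))"

lemma smooth_box_bump: "smooth (box_bump n a b)"
proof -
  have "Ck k (\<lambda>x. flat_step (real n * ((x - a) \<bullet> i)))" for k and i :: 'a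
    using Ck_compose_affine[OF _ Ck_exp_cutoff, of "\<lambda>x. real n * (x \<bullet> i)" k 1 "- real n * (a \<bullet> i)"]
    by (simp add: flat_step_def inner_diff_left algebra_simps bounded_linear_mult_right[THEN bounded_linear_compose] bounded_linear_inner_left)
  moreover have "Ck k (\<lambda>x. flat_step (real n * ((b - x) \<bullet> i)))" for k and i :: 'a
    using Ck_compose_affine[OF _ Ck_exp_cutoff, of "\<lambda>x. - real n * (x \<bullet> i)" k 1 "real n * (b \<bullet> i)"]
    by (simp add: flat_step_def inner_diff_left algebra_simps bounded_linear_mult_right[THEN bounded_linear_compose] bounded_linear_inner_left bounded_linear_minus)
  ultimately show ?thesis
    unfolding smooth_def box_bump_def by (auto intro!: Ck_prod Ck_mult)
qed

lemma box_bump_bounds: "0 \<le> box_bump n a b x" "box_bump n a b x \<le> 1"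
  unfolding box_bump_def
  by (auto intro!: prod_nonneg prod_le_1 mult_nonneg_nonneg mult_le_one flat_step_bounds)

lemma box_bump_eq_0:
  assumes "x \<notin> box a b"
  shows "box_bump n a b x = 0"
proof -
  obtain i where i: "i \<in> Basis" "(x - a) \<bullet> i \<le> 0 \<or> (b - x) \<bullet> i \<le> 0"
    using assms by (force simp: mem_box inner_diff_left)
  then have "real n * ((x - a) \<bullet> i) \<le> 0 \<or> real n * ((b - x) \<bullet> i) \<le> 0"
    by (meson mult_nonneg_nonpos of_nat_0_le_iff)
  then have "flat_step (real n * ((x - a) \<bullet> i)) * flat_step (real n * ((b - x) \<bullet> i)) = 0"
    by (force simp: flat_step_eq)
  with i(1) show ?thesis
    unfolding box_bump_def by (metis (mono_tags, lifting) finite_Basis prod_zero)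
qed

lemma box_bump_tendsto:
  fixes x :: "'a::euclidean_space"
  shows "(\<lambda>n. box_bump n a b x) \<longlonglongrightarrow> (indicator (box a b) x :: real)"
proof -
  let ?P = "(\<Prod>i\<in>(Basis::'a set). ((if (x - a) \<bullet> i > 0 then 1 else 0) :: real) * (if (b - x) \<bullet> i > 0 then 1 else 0))"
  have "(\<lambda>n. box_bump n a b x) \<longlonglongrightarrow> ?P"
    unfolding box_bump_def by (intro tendsto_prod tendsto_mult flat_step_tendsto)
  also have "?P = (indicator (box a b) x :: real)"
  proof (cases "x \<in> box a b")
    case False
    then obtain i where "i \<in> Basis" "\<not> ((x - a) \<bullet> i > 0) \<or> \<not> ((b - x) \<bullet> i > 0)"
      by (auto simp: mem_box inner_diff_left)
    then have "\<exists>i\<in>Basis. (if (x - a) \<bullet> i > 0 then 1 else 0 :: real) * (if (b - x) \<bullet> i > 0 then 1 else 0) = 0"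
      by (intro bexI[of _ i]) auto
    then have "?P = 0"
      by (rule prod_zero[OF finite_Basis])
    with False show ?thesis
      by (metis indicator_simps(2))
  next
    case True
    then have "(x - a) \<bullet> i > 0" "(b - x) \<bullet> i > 0" if "i \<in> Basis" for i
      using that by (auto simp: mem_box inner_diff_left)
    with True show ?thesis
      by simp
  qed
  finally show ?thesis .
qed

lemma test_function_box_bump:
  assumes "cbox a b \<subseteq> \<Omega>"
  shows "test_function \<Omega> (box_bump n a b)"
proof -
  have "supp (box_bump n a b) \<subseteq> cbox a b"
    unfolding supp_def
    by (rule closure_minimal) (use box_bump_eq_0 box_subset_cbox in \<open>force+\<close>)
  then show ?thesis
    unfolding test_function_def
    using assms smooth_box_bump
    by (metis bounded_subset bounded_cbox closed_closure compact_eq_bounded_closed subset_trans supp_def)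
qed

section \<open>Uniqueness of weak gradients\<close>

lemma sigma_finite_lebesgue: "sigma_finite_measure (lebesgue :: 'a::euclidean_space measure)"
proof
  obtain A :: "'a set set" where A: "countable A" "A \<subseteq> sets lborel" "\<Union>A = space lborel" "\<forall>a\<in>A. emeasure lborel a \<noteq> \<infinity>"
    using lborel.sigma_finite_countable by blast
  then show "\<exists>A::'a set set. countable A \<and> A \<subseteq> sets lebesgue \<and> \<Union>A = space lebesgue \<and> (\<forall>a\<in>A. emeasure lebesgue a \<noteq> \<infinity>)"
  proof (intro exI[of _ A] conjI ballI)
    show "A \<subseteq> sets lebesgue"
      using A(2) sets_completionI_sets by blast
    show "emeasure lebesgue a \<noteq> \<infinity>" if "a \<in> A" for a
      using A(2,4) that by (metis emeasure_completion main_part sets_completionI_sets subsetD)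
  qed (use A in simp_all)
qed

text \<open>Boxes form a generator of the Borel sets that is stable under intersection, so the integral
  vanishes on all Borel sets, and then on all Lebesgue sets, which differ from Borel sets by null
  sets.\<close>

lemma integral_box_eq_0_imp_AE_0:
  fixes f :: "'a::euclidean_space \<Rightarrow> 'b::euclidean_space"
  assumes f: "integrable lebesgue f"
    and box: "\<And>a b. (LINT x:box a b|lebesgue. f x) = 0"
  shows "AE x in lebesgue. f x = 0"
proof (rule sigma_finite_measure.density_zero[OF sigma_finite_lebesgue f])
  have int: "set_integrable lebesgue A f" if "A \<in> sets lebesgue" for A
    unfolding set_integrable_def using integrable_mult_indicator[OF that f] .
  have UNIV: "(LINT x:UNIV|lebesgue. f x) = 0"
  proof -
    let ?A = "\<lambda>n::nat. box (- (real n *\<^sub>R One)) (real n *\<^sub>R One) :: 'a set"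
    have "mono ?A"
    proof (intro monoI subsetI)
      fix m n :: nat and x :: 'a
      assume "m \<le> n" and x: "x \<in> ?A m"
      then have mn: "real m \<le> real n" by simp
      have "- real n < x \<bullet> i \<and> x \<bullet> i < real n" if "i \<in> Basis" for i
      proof -
        have "- real m < x \<bullet> i \<and> x \<bullet> i < real m"
          using x that by (simp add: mem_box)
        with mn show ?thesis by linarith
      qed
      then show "x \<in> ?A n" by (simp add: mem_box)
    qed
    then have "(\<lambda>n. LINT x:?A n|lebesgue. f x) \<longlonglongrightarrow> (LINT x:(\<Union>n. ?A n)|lebesgue. f x)"
      by (intro set_integral_cont_up) (auto simp: incseq_def mono_def intro!: int)
    then show ?thesis
      unfolding UN_box_eq_UNIV box by (simp add: LIMSEQ_const_iff)
  qed
  have borel: "(LINT x:A|lebesgue. f x) = 0" if "A \<in> sets borel" for A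
  proof -
    let ?E = "range (\<lambda>(a, b). box a b::'a set)"
    have A: "A \<in> sigma_sets UNIV ?E"
      using that by (simp add: borel_eq_box)
    have Int: "Int_stable ?E"
      by (auto simp: Int_stable_def box_Int_box)
    have sub: "sigma_sets UNIV ?E \<subseteq> sets lebesgue"
    proof -
      have "sets borel = sigma_sets UNIV ?E" by (simp add: borel_eq_box)
      then show ?thesis by (metis sets_completionI_sets sets_lborel subsetI)
    qed
    have gen: "?E \<subseteq> Pow UNIV" by simp
    from Int gen A show ?thesis
    proof (induction rule: sigma_sets_induct_disjoint)
      case (basic A)
      then show ?case using box by auto
    next
      case empty
      show ?case by (simp add: set_lebesgue_integral_def)
    next
      case (compl A)
      then have "A \<in> sets lebesgue" using sub by blast
      then have "(LINT x:A \<union> (UNIV - A)|lebesgue. f x) = (LINT x:A|lebesgue. f x) + (LINT x:UNIV - A|lebesgue. f x)"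
        by (intro set_integral_Un int) auto
      moreover have "A \<union> (UNIV - A) = UNIV" by blast
      ultimately show ?case using compl UNIV by simp
    next
      case (union A)
      then have "range A \<subseteq> sets lebesgue" using sub by blast
      then have "(LINT x:(\<Union>i. A i)|lebesgue. f x) = (\<Sum>i. LINT x:A i|lebesgue. f x)"
        by (intro lebesgue_integral_countable_add int)
          (use union in \<open>auto simp: disjoint_family_on_def\<close>)
      then show ?case using union by simp
    qed
  qed
  \<comment> \<open>A Lebesgue set agrees almost everywhere with its Borel part.\<close>
  fix A :: "'a set"
  assume A: "A \<in> sets lebesgue"
  obtain N where N: "N \<in> null_sets lborel" "null_part lborel A \<subseteq> N"
    using null_part_null_sets A by (metis null_part)
  have "AE x in lebesgue. x \<notin> N"
    using N(1) AE_not_in null_sets_completionI by blast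
  then have "AE x in lebesgue. indicator A x *\<^sub>R f x = indicator (main_part lborel A) x *\<^sub>R f x"
  proof (rule AE_mp, intro AE_I2 impI)
    fix x assume "x \<notin> N"
    then have "x \<in> A \<longleftrightarrow> x \<in> main_part lborel A"
      using main_part_null_part_Un[of A lborel] A N(2) by blast
    then show "indicator A x *\<^sub>R f x = indicator (main_part lborel A) x *\<^sub>R f x"
      by (simp add: indicator_def)
  qed
  then have "(LINT x:A|lebesgue. f x) = (LINT x:main_part lborel A|lebesgue. f x)"
    unfolding set_lebesgue_integral_def
    using A f main_part_sets[of A lborel]
    by (intro integral_cong_AE borel_measurable_scaleR borel_measurable_indicator) auto
  then show "(LINT x:A|lebesgue. f x) = 0"
    using borel main_part_sets[OF A] by simp
qed

lemma test_function_continuous: "test_function \<Omega> \<phi> \<Longrightarrow> continuous_on UNIV \<phi>"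
  unfolding test_function_def smooth_def by (meson Ck.simps(1))

lemma supp_eq_0: "x \<notin> supp \<phi> \<Longrightarrow> \<phi> x = 0"
  unfolding supp_def using closure_subset[of "{x. \<phi> x \<noteq> 0}"] by blast

lemma continuous_borel_measurable_lebesgue:
  fixes f :: "'a::euclidean_space \<Rightarrow> 'b::euclidean_space"
  shows "continuous_on UNIV f \<Longrightarrow> f \<in> borel_measurable lebesgue"
  by (rule measurable_completion) (simp add: borel_measurable_continuous_onI)

text \<open>Local integrability only controls compact subsets of \<open>\<Omega>\<close>; a continuous factor supported in
  such a subset makes the product integrable on all of \<open>\<Omega>\<close>.\<close>

lemma set_integrable_compact_multiplier:
  fixes f :: "'a::euclidean_space \<Rightarrow> 'b::euclidean_space" and \<psi> :: "'a \<Rightarrow> real"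
  assumes \<psi>: "continuous_on UNIV \<psi>" "\<And>x. x \<notin> K \<Longrightarrow> \<psi> x = 0"
    and K: "compact K" "K \<subseteq> \<Omega>" and f: "loc_integrable \<Omega> f"
  shows "set_integrable lebesgue \<Omega> (\<lambda>x. \<psi> x *\<^sub>R f x)"
proof -
  have "bounded (\<psi> ` K)"
    by (intro compact_imp_bounded compact_continuous_image K(1) continuous_on_subset[OF \<psi>(1)]) simp
  then obtain C where C: "\<And>x. x \<in> K \<Longrightarrow> norm (\<psi> x) \<le> C"
    unfolding bounded_iff by auto
  have fK: "integrable lebesgue (\<lambda>x. indicator K x *\<^sub>R f x)"
    using f K unfolding loc_integrable_def set_integrable_def by blast
  have "integrable lebesgue (\<lambda>x. \<psi> x *\<^sub>R (indicator K x *\<^sub>R f x))"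
  proof (rule Bochner_Integration.integrable_bound)
    show "integrable lebesgue (\<lambda>x. C *\<^sub>R (indicator K x *\<^sub>R f x))"
      by (rule integrable_scaleR_right[OF fK])
    show "(\<lambda>x. \<psi> x *\<^sub>R indicat_real K x *\<^sub>R f x) \<in> borel_measurable lebesgue"
      by (rule borel_measurable_scaleR[OF continuous_borel_measurable_lebesgue[OF \<psi>(1)] borel_measurable_integrable[OF fK]])
    have "norm (\<psi> x *\<^sub>R indicat_real K x *\<^sub>R f x) \<le> norm (C *\<^sub>R indicat_real K x *\<^sub>R f x)" for x
      using C[of x] by (auto simp: indicator_def intro!: mult_right_mono)
    then show "AE x in lebesgue. norm (\<psi> x *\<^sub>R indicat_real K x *\<^sub>R f x) \<le> norm (C *\<^sub>R indicat_real K x *\<^sub>R f x)"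
      by simp
  qed
  moreover have "indicator \<Omega> x *\<^sub>R \<psi> x *\<^sub>R f x = \<psi> x *\<^sub>R (indicator K x *\<^sub>R f x)" for x
    using \<psi>(2)[of x] K(2) by (auto simp: indicator_def)
  ultimately show ?thesis
    unfolding set_integrable_def by (simp only:)
qed

lemma set_integrable_test_function:
  fixes f :: "'a::euclidean_space \<Rightarrow> 'b::euclidean_space"
  assumes "test_function \<Omega> \<phi>" "loc_integrable \<Omega> f"
  shows "set_integrable lebesgue \<Omega> (\<lambda>x. \<phi> x *\<^sub>R f x)"
  using assms by (intro set_integrable_compact_multiplier[where K="supp \<phi>"])
    (auto simp: test_function_def supp_eq_0 intro: test_function_continuous)

lemma box_bump_integral_tendsto:
  fixes f :: "'a::euclidean_space \<Rightarrow> 'b::euclidean_space"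
  assumes f: "set_integrable lebesgue (box a b) f" and ab: "box a b \<subseteq> \<Omega>"
  shows "(\<lambda>n. LINT x:\<Omega>|lebesgue. box_bump n a b x *\<^sub>R f x) \<longlonglongrightarrow> (LINT x:box a b|lebesgue. f x)"
  unfolding set_lebesgue_integral_def
proof (rule integral_dominated_convergence)
  let ?F = "\<lambda>x. indicator (box a b) x *\<^sub>R f x"
  have F: "integrable lebesgue ?F"
    using f by (simp add: set_integrable_def)
  then show "integrable lebesgue (\<lambda>x. norm (?F x))"
    by (rule integrable_norm)
  show meas: "?F \<in> borel_measurable lebesgue"
    using F by (rule borel_measurable_integrable)
  have eq: "indicat_real \<Omega> x *\<^sub>R box_bump n a b x *\<^sub>R f x = box_bump n a b x *\<^sub>R ?F x" for n x
    using box_bump_eq_0[of x a b n] ab by (auto simp: indicator_def)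
  show "(\<lambda>x. indicat_real \<Omega> x *\<^sub>R box_bump n a b x *\<^sub>R f x) \<in> borel_measurable lebesgue" for n
    unfolding eq using smooth_box_bump[of n a b]
    by (intro borel_measurable_scaleR meas continuous_borel_measurable_lebesgue)
      (metis Ck.simps(1) smooth_def)
  have "(\<lambda>n. box_bump n a b x *\<^sub>R ?F x) \<longlonglongrightarrow> indicat_real (box a b) x *\<^sub>R ?F x" for x
    by (intro tendsto_scaleR box_bump_tendsto tendsto_const)
  moreover have "indicat_real (box a b) x *\<^sub>R ?F x = ?F x" for x
    by (simp add: indicator_def)
  ultimately show "AE x in lebesgue. (\<lambda>n. indicat_real \<Omega> x *\<^sub>R box_bump n a b x *\<^sub>R f x) \<longlonglongrightarrow> ?F x"
    unfolding eq by (simp only: AE_I2)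
  show "AE x in lebesgue. norm (indicat_real \<Omega> x *\<^sub>R box_bump n a b x *\<^sub>R f x) \<le> norm (?F x)" for n
  proof (rule AE_I2)
    fix x
    have "norm (box_bump n a b x *\<^sub>R ?F x) = box_bump n a b x * norm (?F x)"
      using box_bump_bounds(1)[of n a b x] by (simp only: norm_scaleR abs_of_nonneg)
    also have "\<dots> \<le> norm (?F x)"
      by (intro mult_left_le_one_le box_bump_bounds norm_ge_zero)
    finally show "norm (indicat_real \<Omega> x *\<^sub>R box_bump n a b x *\<^sub>R f x) \<le> norm (?F x)"
      unfolding eq .
  qed
qed

text \<open>The fundamental lemma of the calculus of variations. Testing with box bumps shows that the
  integral over every box inside \<open>\<Omega>\<close> vanishes, and \<open>\<Omega>\<close> is a countable union of such boxes.\<close>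

lemma test_integrals_0_imp_AE_0:
  fixes f :: "'a::euclidean_space \<Rightarrow> 'b::euclidean_space"
  assumes \<Omega>: "open \<Omega>" and f: "loc_integrable \<Omega> f"
    and 0: "\<And>\<phi>. test_function \<Omega> \<phi> \<Longrightarrow> (LINT x:\<Omega>|lebesgue. \<phi> x *\<^sub>R f x) = 0"
  shows "AE x in lebesgue. x \<in> \<Omega> \<longrightarrow> f x = 0"
proof -
  have box0: "(LINT x:box a b|lebesgue. f x) = 0" if ab: "cbox a b \<subseteq> \<Omega>" for a b
  proof (rule LIMSEQ_unique)
    have "set_integrable lebesgue (box a b) f"
      using f ab set_integrable_subset[OF _ _ box_subset_cbox[of a b]]
      unfolding loc_integrable_def by (metis compact_cbox borel_open open_box sets_completionI_sets sets_lborel)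
    then show "(\<lambda>n. LINT x:\<Omega>|lebesgue. box_bump n a b x *\<^sub>R f x) \<longlonglongrightarrow> (LINT x:box a b|lebesgue. f x)"
      using ab box_subset_cbox[of a b] by (intro box_bump_integral_tendsto) auto
    show "(\<lambda>n. LINT x:\<Omega>|lebesgue. box_bump n a b x *\<^sub>R f x) \<longlonglongrightarrow> 0"
      using 0[OF test_function_box_bump[OF ab]] by simp
  qed
  have cbox: "AE x in lebesgue. x \<in> cbox a b \<longrightarrow> f x = 0" if ab: "cbox a b \<subseteq> \<Omega>" for a b
  proof -
    let ?F = "\<lambda>x. indicator (box a b) x *\<^sub>R f x"
    have "set_integrable lebesgue (cbox a b) f"
      using f ab unfolding loc_integrable_def by (meson compact_cbox)
    then have F: "integrable lebesgue ?F"
      using set_integrable_subset[of lebesgue "cbox a b" f "box a b"] box_subset_cbox[of a b]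
      by (simp add: set_integrable_def)
    have "AE x in lebesgue. ?F x = 0"
    proof (rule integral_box_eq_0_imp_AE_0[OF F])
      fix c d :: 'a
      obtain e g where eg: "box a b \<inter> box c d = box e g"
        unfolding box_Int_box by blast
      have "(LINT x:box c d|lebesgue. ?F x) = (LINT x:box e g|lebesgue. f x)"
        unfolding set_lebesgue_integral_def eg[symmetric]
        by (rule Bochner_Integration.integral_cong) (auto simp: indicator_def)
      also have "\<dots> = 0"
      proof (cases "box e g = {}")
        case True
        then show ?thesis by (simp add: set_lebesgue_integral_def)
      next
        case False
        then have "cbox e g = closure (box a b \<inter> box c d)" using eg closure_box by auto
        also have "\<dots> \<subseteq> cbox a b" by (intro closure_minimal) (use box_subset_cbox[of a b] in auto)
        finally show ?thesis using ab by (intro box0) auto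
      qed
      finally show "(LINT x:box c d|lebesgue. ?F x) = 0" .
    qed
    moreover have "AE x in lebesgue. x \<notin> cbox a b - box a b"
      by (rule AE_not_in) (use negligible_frontier_interval[of a b] in \<open>simp add: negligible_iff_null_sets\<close>)
    ultimately show ?thesis
      by eventually_elim (auto simp: indicator_def)
  qed
  obtain D where D: "countable D" "D \<subseteq> Pow \<Omega>" "\<And>X. X \<in> D \<Longrightarrow> \<exists>a b. X = cbox a b" "\<Union>D = \<Omega>"
    using open_countable_Union_open_cbox[OF \<Omega>] by metis
  have "AE x in lebesgue. \<forall>X\<in>D. x \<in> X \<longrightarrow> f x = 0"
    unfolding AE_ball_countable[OF D(1)] using cbox D(2,3) by blast
  then show ?thesis
    by eventually_elim (use D(4) in blast)
qed

lemma has_weak_gradient_unique: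
  assumes \<Omega>: "open \<Omega>" and g: "has_weak_gradient \<Omega> u g" and g': "has_weak_gradient \<Omega> u g'"
  shows "AE x in lebesgue. x \<in> \<Omega> \<longrightarrow> g x = g' x"
proof -
  have loc: "loc_integrable \<Omega> g" "loc_integrable \<Omega> g'"
    using g g' by (auto simp: has_weak_gradient_def)
  have "AE x in lebesgue. x \<in> \<Omega> \<longrightarrow> g x - g' x = 0"
  proof (rule test_integrals_0_imp_AE_0[OF \<Omega>])
    show "loc_integrable \<Omega> (\<lambda>x. g x - g' x)"
      using loc unfolding loc_integrable_def by blast
    fix \<phi> :: "'a \<Rightarrow> real" assume \<phi>: "test_function \<Omega> \<phi>"
    have "(LINT x:\<Omega>|lebesgue. \<phi> x *\<^sub>R g x - \<phi> x *\<^sub>R g' x) =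
        (LINT x:\<Omega>|lebesgue. \<phi> x *\<^sub>R g x) - (LINT x:\<Omega>|lebesgue. \<phi> x *\<^sub>R g' x)"
      by (intro set_integral_diff set_integrable_test_function \<phi> loc)
    also have "\<dots> = 0"
      using g g' \<phi> unfolding has_weak_gradient_def by (metis add.inverse_inverse diff_self)
    finally show "(LINT x:\<Omega>|lebesgue. \<phi> x *\<^sub>R (g x - g' x)) = 0"
      by (simp add: scaleR_diff_right)
  qed
  then show ?thesis by simp
qed

lemma has_weak_gradient_weak_gradient:
  "has_weak_gradient \<Omega> u g \<Longrightarrow> has_weak_gradient \<Omega> u (weak_gradient \<Omega> u)"
  unfolding weak_gradient_def by (rule someI[of "has_weak_gradient \<Omega> u"])

lemma gradient_eqI: "(f has_derivative (\<lambda>v. g \<bullet> v)) (at x) \<Longrightarrow> gradient f x = g"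
  unfolding gradient_def using frechet_derivative_at[of f "\<lambda>v. g \<bullet> v" x]
  by (metis (no_types, lifting) euclidean_representation sum.cong)

lemma gradient_real_eqI: "(f has_real_derivative d) (at x) \<Longrightarrow> gradient f x = d"
  by (rule gradient_eqI) (simp add: has_field_derivative_def)

lemma closed_supp: "closed (supp \<phi>)"
  by (simp add: supp_def)

lemma gradient_eq_0_outside_supp:
  assumes "x \<notin> supp \<phi>"
  shows "gradient \<phi> x = 0"
proof -
  have "((\<lambda>x. 0 :: real) has_derivative (\<lambda>v. 0 \<bullet> v)) (at x)" by simp
  then have "(\<phi> has_derivative (\<lambda>v. 0 \<bullet> v)) (at x)"
    by (rule has_derivative_transform_within_open[where s="- supp \<phi>"])
      (use assms supp_eq_0[of _ \<phi>] in \<open>auto simp: open_Compl closed_supp\<close>)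
  then show ?thesis by (rule gradient_eqI)
qed

lemma has_weak_gradient_subset:
  assumes g: "has_weak_gradient \<Omega> u g" and Q: "Q \<subseteq> \<Omega>"
  shows "has_weak_gradient Q u g"
  unfolding has_weak_gradient_def
proof (intro conjI allI impI)
  show "loc_integrable Q u" "loc_integrable Q g"
    using g Q unfolding has_weak_gradient_def loc_integrable_def by (meson order_trans)+
  fix \<phi> :: "'a \<Rightarrow> real" assume \<phi>: "test_function Q \<phi>"
  then have supp: "supp \<phi> \<subseteq> Q" and \<phi>': "test_function \<Omega> \<phi>"
    using Q by (auto simp: test_function_def)
  have "(LINT x:Q|lebesgue. u x *\<^sub>R gradient \<phi> x) = (LINT x:\<Omega>|lebesgue. u x *\<^sub>R gradient \<phi> x)"
    unfolding set_lebesgue_integral_def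
    using supp Q gradient_eq_0_outside_supp[of _ \<phi>]
    by (intro Bochner_Integration.integral_cong) (auto simp: indicator_def)
  also have "\<dots> = - (LINT x:\<Omega>|lebesgue. \<phi> x *\<^sub>R g x)"
    using g \<phi>' unfolding has_weak_gradient_def by blast
  also have "(LINT x:\<Omega>|lebesgue. \<phi> x *\<^sub>R g x) = (LINT x:Q|lebesgue. \<phi> x *\<^sub>R g x)"
    unfolding set_lebesgue_integral_def
    using supp Q supp_eq_0[of _ \<phi>]
    by (intro Bochner_Integration.integral_cong) (auto simp: indicator_def)
  finally show "(LINT x:Q|lebesgue. u x *\<^sub>R gradient \<phi> x) = - (LINT x:Q|lebesgue. \<phi> x *\<^sub>R g x)" .
qed

lemma weak_gradient_AE_eq:
  assumes "open \<Omega>" "has_weak_gradient \<Omega> u g"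
  shows "AE x in lebesgue. x \<in> \<Omega> \<longrightarrow> weak_gradient \<Omega> u x = g x"
  using has_weak_gradient_unique[OF assms(1) has_weak_gradient_weak_gradient[OF assms(2)] assms(2)] .

section \<open>Continuous functions with a weak derivative\<close>

definition flat_step_deriv :: "real \<Rightarrow> real" where
  "flat_step_deriv = exp_cutoff (monom 1 2)"

lemma flat_step_DERIV: "(flat_step has_real_derivative flat_step_deriv t) (at t)"
  using exp_cutoff_DERIV[of 1 t] by (simp add: flat_step_def flat_step_deriv_def)

lemma flat_step_deriv_nonneg: "0 \<le> flat_step_deriv t"
  by (simp add: flat_step_deriv_def exp_cutoff_def poly_monom)

lemma flat_step_deriv_eq_0: "t \<le> 0 \<Longrightarrow> flat_step_deriv t = 0"
  by (simp add: flat_step_deriv_def exp_cutoff_def)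

lemma continuous_flat_step: "continuous_on S flat_step"
  unfolding flat_step_def by (rule Ck_imp_continuous[OF Ck_exp_cutoff[of 0]])

lemma continuous_flat_step_deriv: "continuous_on S flat_step_deriv"
  unfolding flat_step_deriv_def by (rule Ck_imp_continuous[OF Ck_exp_cutoff[of 0]])

lemma flat_step_tendsto_1: "(flat_step \<longlongrightarrow> 1) at_top"
proof -
  have "((\<lambda>t::real. exp (- inverse t)) \<longlongrightarrow> exp (- 0)) at_top"
    by (intro tendsto_exp tendsto_minus tendsto_inverse_0_at_top filterlim_ident)
  then have "((\<lambda>t::real. exp (- inverse t)) \<longlongrightarrow> 1) at_top" by simp
  then show ?thesis
    by (rule Lim_transform_eventually)
      (auto simp: flat_step_eq inverse_eq_divide intro!: eventually_mono[OF eventually_gt_at_top[of 0]])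
qed

lemma has_bochner_integral_flat_step_deriv: "has_bochner_integral lborel flat_step_deriv 1"
proof -
  have meas [measurable]: "flat_step_deriv \<in> borel_measurable borel"
    using continuous_flat_step_deriv by (rule borel_measurable_continuous_onI)
  have "(\<integral>\<^sup>+x. ennreal (flat_step_deriv x) * indicator {0..} x \<partial>lborel) = ennreal (1 - flat_step 0)"
    by (rule nn_integral_FTC_atLeast)
      (auto simp: flat_step_deriv_nonneg flat_step_DERIV flat_step_tendsto_1)
  moreover have "ennreal (flat_step_deriv x) * indicator {0..} x = ennreal (flat_step_deriv x)" for x
    by (auto simp: indicator_def flat_step_deriv_eq_0)
  ultimately have "(\<integral>\<^sup>+x. ennreal (flat_step_deriv x) \<partial>lborel) = ennreal 1"
    by (simp add: flat_step_eq)
  then show ?thesis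
    by (intro has_bochner_integral_nn_integral) (auto simp: flat_step_deriv_nonneg)
qed

text \<open>The derivative of the flat step is a probability density on the positive half-line, so after
  rescaling it is an approximate identity that concentrates at \<open>a\<close> from the right (\<open>c = 1\<close>) or from
  the left (\<open>c = -1\<close>). The last factor is the other side of the bump; it tends to \<open>1\<close> and cuts the
  integral off at distance \<open>L\<close> from \<open>a\<close>, where \<open>h\<close> is bounded.\<close>

lemma flat_step_deriv_approx_identity:
  fixes h :: "real \<Rightarrow> real"
  assumes h: "continuous_on UNIV h" and L: "L > 0" and c: "\<bar>c\<bar> = 1"
  shows "(\<lambda>n. LBINT t. h (a + c * t / real n) * flat_step_deriv t * flat_step (real n * L - t)) \<longlonglongrightarrow> h a"
proof -
  have int: "integrable lborel flat_step_deriv" "(LBINT t. flat_step_deriv t) = 1"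
    using has_bochner_integral_flat_step_deriv by (simp_all add: has_bochner_integral_iff)
  have meas [measurable]: "flat_step_deriv \<in> borel_measurable borel" "flat_step \<in> borel_measurable borel"
      "h \<in> borel_measurable borel"
    using continuous_flat_step_deriv continuous_flat_step h by (simp_all add: borel_measurable_continuous_onI)
  have "bounded (h ` {a - L..a + L})"
    by (intro compact_imp_bounded compact_continuous_image continuous_on_subset[OF h]) auto
  then obtain C where "\<forall>y\<in>h ` {a - L..a + L}. norm y \<le> C"
    unfolding bounded_iff by blast
  then have C: "\<bar>h x\<bar> \<le> C" if "x \<in> {a - L..a + L}" for x
    using that by auto
  have "(\<lambda>n. LBINT t. h (a + c * t / real n) * flat_step_deriv t * flat_step (real n * L - t))
      \<longlonglongrightarrow> (LBINT t. h a * flat_step_deriv t)"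
  proof (rule integral_dominated_convergence)
    show "integrable lborel (\<lambda>t. C * flat_step_deriv t)"
      using int(1) by simp
    show "AE t in lborel. (\<lambda>n. h (a + c * t / real n) * flat_step_deriv t * flat_step (real n * L - t))
        \<longlonglongrightarrow> h a * flat_step_deriv t"
    proof (rule AE_I2)
      fix t
      have "(\<lambda>n. a + c * t * (1 / real n)) \<longlonglongrightarrow> a + c * t * 0"
        by (intro tendsto_intros lim_1_over_n)
      then have "(\<lambda>n. h (a + c * t / real n)) \<longlonglongrightarrow> h a"
        using h by (intro isCont_tendsto_compose[where g=h]) (auto simp: continuous_on_eq_continuous_at)
      moreover have "(\<lambda>n. flat_step (real n * L - t)) \<longlonglongrightarrow> 1"
      proof (rule filterlim_compose[OF flat_step_tendsto_1])
        show "filterlim (\<lambda>n. real n * L - t) at_top sequentially"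
          using filterlim_tendsto_add_at_top[OF tendsto_const[of "- t"]
            filterlim_tendsto_pos_mult_at_top[OF tendsto_const[of L] L filterlim_real_sequentially]]
          by (simp add: mult.commute)
      qed
      ultimately have "(\<lambda>n. h (a + c * t / real n) * flat_step_deriv t * flat_step (real n * L - t))
          \<longlonglongrightarrow> h a * flat_step_deriv t * 1"
        by (intro tendsto_mult tendsto_const)
      then show "(\<lambda>n. h (a + c * t / real n) * flat_step_deriv t * flat_step (real n * L - t))
          \<longlonglongrightarrow> h a * flat_step_deriv t" by simp
    qed
    show "AE t in lborel. norm (h (a + c * t / real n) * flat_step_deriv t * flat_step (real n * L - t))
        \<le> C * flat_step_deriv t" for n
    proof (rule AE_I2)
      fix t
      show "norm (h (a + c * t / real n) * flat_step_deriv t * flat_step (real n * L - t)) \<le> C * flat_step_deriv t"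
      proof (cases "0 < t \<and> t < real n * L")
        case True
        then have "\<bar>c * t / real n\<bar> \<le> L"
          using c by (cases "n = 0") (auto simp: abs_mult field_simps)
        then have "a + c * t / real n \<in> {a - L..a + L}"
          by (simp only: abs_le_iff atLeastAtMost_iff) linarith
        then have "\<bar>h (a + c * t / real n)\<bar> \<le> C" by (rule C)
        then have "\<bar>h (a + c * t / real n)\<bar> * flat_step_deriv t * flat_step (real n * L - t) \<le> C * flat_step_deriv t * 1"
          using flat_step_bounds flat_step_deriv_nonneg by (intro mult_mono) auto
        then show ?thesis
          using flat_step_bounds flat_step_deriv_nonneg by (simp add: abs_mult)
      next
        case False
        have "0 \<le> C" using C[of a] L by auto
        with False show ?thesis
          using flat_step_deriv_nonneg[of t] by (auto simp: flat_step_deriv_eq_0 flat_step_eq)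
      qed
    qed
  qed measurable
  then show ?thesis
    using int by simp
qed

lemma integrable_continuous_compact_support:
  fixes f :: "'a::euclidean_space \<Rightarrow> 'b::euclidean_space"
  assumes f: "continuous_on UNIV f" and "\<And>x. x \<notin> K \<Longrightarrow> f x = 0" "compact K"
  shows "integrable lborel f"
proof -
  have "integrable lborel (\<lambda>x. indicator K x *\<^sub>R f x)"
    using assms(3) by (rule borel_integrable_compact) (rule continuous_on_subset[OF f], simp)
  moreover have "indicator K x *\<^sub>R f x = f x" for x
    using assms(2)[of x] by (auto simp: indicator_def)
  ultimately show ?thesis by simp
qed

text \<open>Test with the bumps of the interval: they tend to its indicator, while their derivatives are
  differences of two approximate identities at the end points.\<close>

lemma continuous_weak_derivative_FTC:
  fixes h g :: "real \<Rightarrow> real"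
  assumes wg: "has_weak_gradient UNIV h g" and h: "continuous_on UNIV h" and ab: "a < b"
  shows "(g has_integral h b - h a) {a..b}"
proof -
  have g: "set_integrable lebesgue {a..b} g"
    using wg unfolding has_weak_gradient_def loc_integrable_def by (meson compact_Icc subset_UNIV)
  have lim_g: "(\<lambda>n. LINT x:UNIV|lebesgue. box_bump n a b x *\<^sub>R g x) \<longlonglongrightarrow> (LINT x:{a<..<b}|lebesgue. g x)"
    using box_bump_integral_tendsto[of a b g UNIV] set_integrable_subset[OF g, of "{a<..<b}"]
    by (simp add: box_real subset_iff)
  let ?D = "\<lambda>n x. real n * flat_step_deriv (real n * (x - a)) * flat_step (real n * (b - x))"
  let ?E = "\<lambda>n x. real n * flat_step_deriv (real n * (b - x)) * flat_step (real n * (x - a))"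
  have grad: "gradient (box_bump n a b) x = ?D n x - ?E n x" for n x
  proof (rule gradient_real_eqI)
    have "((\<lambda>x. flat_step (real n * (x - a))) has_real_derivative
        flat_step_deriv (real n * (x - a)) * real n) (at x)"
      by (rule DERIV_chain2[OF flat_step_DERIV]) (auto intro!: derivative_eq_intros)
    moreover have "((\<lambda>x. flat_step (real n * (b - x))) has_real_derivative
        flat_step_deriv (real n * (b - x)) * (- real n)) (at x)"
      by (rule DERIV_chain2[OF flat_step_DERIV]) (auto intro!: derivative_eq_intros)
    ultimately have "((\<lambda>x. flat_step (real n * (x - a)) * flat_step (real n * (b - x))) has_real_derivative
        (flat_step (real n * (x - a)) * (flat_step_deriv (real n * (b - x)) * - real n) +
         flat_step_deriv (real n * (x - a)) * real n * flat_step (real n * (b - x)))) (at x)"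
      by (rule DERIV_mult')
    moreover have "box_bump n a b = (\<lambda>x. flat_step (real n * (x - a)) * flat_step (real n * (b - x)))"
      by (simp add: box_bump_def fun_eq_iff)
    ultimately show "(box_bump n a b has_real_derivative ?D n x - ?E n x) (at x)"
      by (simp add: algebra_simps)
  qed
  have cont: "continuous_on UNIV (?D n)" "continuous_on UNIV (?E n)" for n
    by (auto intro!: continuous_intros continuous_on_compose2[OF continuous_flat_step[of UNIV]]
      continuous_on_compose2[OF continuous_flat_step_deriv[of UNIV]])
  have zero: "?D n x = 0" "?E n x = 0" if "x \<notin> {a..b}" for n x
  proof -
    have "real n * (x - a) \<le> 0 \<or> real n * (b - x) \<le> 0"
      using that by (auto intro!: mult_nonneg_nonpos)
    then show "?D n x = 0" "?E n x = 0"
      by (auto simp: flat_step_deriv_eq_0 flat_step_eq)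
  qed
  \<comment> \<open>Substitute \<open>x = a + t / n\<close> and \<open>x = b - t / n\<close>, respectively.\<close>
  have D: "(LBINT x. h x * ?D n x) = (LBINT t. h (a + 1 * t / real n) * flat_step_deriv t * flat_step (real n * (b - a) - t))"
    if n: "n \<ge> 1" for n
  proof -
    have e: "real n * (a + 1 / real n * t - a) = t" "real n * (b - (a + 1 / real n * t)) = real n * (b - a) - t" for t
      using n by (simp_all add: field_simps)
    have "(LBINT x. h x * ?D n x) = \<bar>1 / real n\<bar> *\<^sub>R (LBINT t. h (a + 1 / real n * t) * ?D n (a + 1 / real n * t))"
      by (rule lborel_integral_real_affine) (use n in simp)
    also have "\<dots> = \<bar>1 / real n\<bar> *\<^sub>R (LBINT t. real n * (h (a + 1 * t / real n) * flat_step_deriv t * flat_step (real n * (b - a) - t)))"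
      unfolding e by (simp add: ac_simps)
    also have "\<dots> = (LBINT t. h (a + 1 * t / real n) * flat_step_deriv t * flat_step (real n * (b - a) - t))"
      unfolding integral_mult_right_zero using n by simp
    finally show ?thesis .
  qed
  have E: "(LBINT x. h x * ?E n x) = (LBINT t. h (b + (-1) * t / real n) * flat_step_deriv t * flat_step (real n * (b - a) - t))"
    if n: "n \<ge> 1" for n
  proof -
    have e: "real n * (b - (b + (-1 / real n) * t)) = t" "real n * (b + (-1 / real n) * t - a) = real n * (b - a) - t" for t
      using n by (simp_all add: field_simps)
    have "(LBINT x. h x * ?E n x) = \<bar>-1 / real n\<bar> *\<^sub>R (LBINT t. h (b + (-1 / real n) * t) * ?E n (b + (-1 / real n) * t))"
      by (rule lborel_integral_real_affine) (use n in simp)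
    also have "\<dots> = \<bar>-1 / real n\<bar> *\<^sub>R (LBINT t. real n * (h (b + (-1) * t / real n) * flat_step_deriv t * flat_step (real n * (b - a) - t)))"
      unfolding e by (simp add: ac_simps)
    also have "\<dots> = (LBINT t. h (b + (-1) * t / real n) * flat_step_deriv t * flat_step (real n * (b - a) - t))"
      unfolding integral_mult_right_zero using n by simp
    finally show ?thesis .
  qed
  have "(\<lambda>n. LBINT x. h x * ?D n x) \<longlonglongrightarrow> h a"
    by (rule Lim_transform_eventually[OF flat_step_deriv_approx_identity[OF h, of "b - a" 1]])
      (use ab D in \<open>auto intro!: eventually_sequentiallyI[of 1]\<close>)
  moreover have "(\<lambda>n. LBINT x. h x * ?E n x) \<longlonglongrightarrow> h b"
    by (rule Lim_transform_eventually[OF flat_step_deriv_approx_identity[OF h, of "b - a" "-1"]])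
      (use ab E in \<open>auto intro!: eventually_sequentiallyI[of 1]\<close>)
  ultimately have "(\<lambda>n. (LBINT x. h x * ?D n x) - (LBINT x. h x * ?E n x)) \<longlonglongrightarrow> h a - h b"
    by (rule tendsto_diff)
  moreover have "(LBINT x. h x * ?D n x) - (LBINT x. h x * ?E n x) = - (LINT x:UNIV|lebesgue. box_bump n a b x *\<^sub>R g x)" for n
  proof -
    have int: "integrable lborel (\<lambda>x. h x * ?D n x)" "integrable lborel (\<lambda>x. h x * ?E n x)"
      by (rule integrable_continuous_compact_support[of _ "{a..b}"];
        use zero in \<open>auto intro!: continuous_on_mult h cont\<close>)+
    have "(LBINT x. h x * ?D n x) - (LBINT x. h x * ?E n x) = (LBINT x. h x * ?D n x - h x * ?E n x)"
      by (rule Bochner_Integration.integral_diff[OF int, symmetric])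
    also have "\<dots> = (LINT x|lebesgue. h x * ?D n x - h x * ?E n x)"
      using Bochner_Integration.integrable_diff[OF int] by (intro integral_completion[symmetric]) auto
    also have "\<dots> = (LINT x:UNIV|lebesgue. h x *\<^sub>R gradient (box_bump n a b) x)"
      by (simp add: grad set_lebesgue_integral_def right_diff_distrib)
    also have "\<dots> = - (LINT x:UNIV|lebesgue. box_bump n a b x *\<^sub>R g x)"
      using wg test_function_box_bump[of a b UNIV n] unfolding has_weak_gradient_def by blast
    finally show ?thesis .
  qed
  ultimately have "(\<lambda>n. - (LINT x:UNIV|lebesgue. box_bump n a b x *\<^sub>R g x)) \<longlonglongrightarrow> h a - h b"
    by simp
  with tendsto_minus[OF lim_g] have "(LINT x:{a<..<b}|lebesgue. g x) = h b - h a"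
    using LIMSEQ_unique by fastforce
  then have "(g has_integral h b - h a) {a<..<b}"
    using has_integral_set_lebesgue[OF set_integrable_subset[OF g, of "{a<..<b}"]] by (simp add: subset_iff)
  then show ?thesis
    using has_integral_Icc_iff_Ioo by blast
qed

text \<open>The variance of \<open>f\<close> over the interval is nonnegative.\<close>

lemma integral_Cauchy_Schwarz_interval:
  fixes f :: "real \<Rightarrow> real"
  assumes f: "f integrable_on {a..b}" "(\<lambda>x. (f x)\<^sup>2) integrable_on {a..b}" and ab: "a < b"
  shows "(integral {a..b} f)\<^sup>2 \<le> (b - a) * integral {a..b} (\<lambda>x. (f x)\<^sup>2)"
proof -
  define m where "m = integral {a..b} f / (b - a)"
  have "0 \<le> integral {a..b} (\<lambda>x. (f x - m)\<^sup>2)"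
    by (cases "(\<lambda>x. (f x - m)\<^sup>2) integrable_on {a..b}") (auto intro!: integral_nonneg simp: not_integrable_integral)
  also have "integral {a..b} (\<lambda>x. (f x - m)\<^sup>2) = integral {a..b} (\<lambda>x. (f x)\<^sup>2 - 2 * m * f x + m\<^sup>2)"
    by (simp add: power2_diff algebra_simps)
  also have "((\<lambda>x. (f x)\<^sup>2 - 2 * m * f x + m\<^sup>2) has_integral
      integral {a..b} (\<lambda>x. (f x)\<^sup>2) - 2 * m * integral {a..b} f + (b - a) *\<^sub>R m\<^sup>2) {a..b}"
    using ab f has_integral_const_real[of "m\<^sup>2" a b]
    by (intro has_integral_add has_integral_diff has_integral_mult_right integrable_integral) auto
  then have "integral {a..b} (\<lambda>x. (f x)\<^sup>2 - 2 * m * f x + m\<^sup>2) =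
      integral {a..b} (\<lambda>x. (f x)\<^sup>2) - 2 * m * integral {a..b} f + (b - a) *\<^sub>R m\<^sup>2"
    by (rule integral_unique)
  finally have "0 \<le> integral {a..b} (\<lambda>x. (f x)\<^sup>2) - 2 * m * integral {a..b} f + (b - a) * m\<^sup>2"
    by simp
  moreover have "2 * m * integral {a..b} f - (b - a) * m\<^sup>2 = (integral {a..b} f)\<^sup>2 / (b - a)"
    using ab by (simp add: m_def power2_eq_square divide_simps)
  ultimately have "(integral {a..b} f)\<^sup>2 / (b - a) \<le> integral {a..b} (\<lambda>x. (f x)\<^sup>2)"
    by linarith
  then show ?thesis
    using ab by (simp add: field_simps)
qed

section \<open>Square-integrable fields\<close>

lemma L2_AE_cong:
  fixes f g :: "'a::euclidean_space \<Rightarrow> 'b::euclidean_space"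
  assumes f: "L2 S f" and ae: "AE x in lebesgue. x \<in> S \<longrightarrow> f x = g x"
  shows "L2 S g"
proof -
  have "AE x in lebesgue. indicat_real S x *\<^sub>R f x = indicat_real S x *\<^sub>R g x"
    using ae by eventually_elim (auto simp: indicator_def)
  then have "set_borel_measurable lebesgue S g"
    using f unfolding L2_def set_borel_measurable_def by (blast intro: borel_measurable_AE)
  moreover have ae2: "AE x in lebesgue. indicat_real S x *\<^sub>R (norm (f x))\<^sup>2 = indicat_real S x *\<^sub>R (norm (g x))\<^sup>2"
    using ae by eventually_elim (auto simp: indicator_def)
  moreover have "set_integrable lebesgue S (\<lambda>x. (norm (g x))\<^sup>2)"
    unfolding set_integrable_def
  proof (rule integrable_cong_AE_imp[OF _ _ ae2])
    show f2: "integrable lebesgue (\<lambda>x. indicat_real S x *\<^sub>R (norm (f x))\<^sup>2)"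
      using f by (simp add: L2_def set_integrable_def)
    show "(\<lambda>x. indicat_real S x *\<^sub>R (norm (g x))\<^sup>2) \<in> borel_measurable lebesgue"
      using borel_measurable_AE[OF borel_measurable_integrable[OF f2] ae2] .
  qed
  ultimately show ?thesis
    by (simp add: L2_def)
qed

lemma H1_weak_gradient:
  assumes \<Omega>: "open \<Omega>" and u: "u \<in> H1 \<Omega>"
  shows "has_weak_gradient \<Omega> u (weak_gradient \<Omega> u)" "L2 \<Omega> (weak_gradient \<Omega> u)"
proof -
  obtain g where g: "has_weak_gradient \<Omega> u g" "L2 \<Omega> g"
    using u by (auto simp: H1_def)
  show "has_weak_gradient \<Omega> u (weak_gradient \<Omega> u)"
    by (rule has_weak_gradient_weak_gradient[OF g(1)])
  show "L2 \<Omega> (weak_gradient \<Omega> u)"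
    by (rule L2_AE_cong[OF g(2)]) (use weak_gradient_AE_eq[OF \<Omega> g(1)] in eventually_elim, auto)
qed

lemma mult_le_sum_squares: "u * v \<le> u\<^sup>2 + (v::real)\<^sup>2"
  using sum_squares_bound[of u v] zero_le_power2[of u] zero_le_power2[of v] by linarith

lemma L2_inner_set_integrable:
  fixes f g :: "'a::euclidean_space \<Rightarrow> 'b::euclidean_space"
  assumes f: "L2 S f" and g: "L2 S g"
  shows "set_integrable lebesgue S (\<lambda>x. f x \<bullet> g x)"
  unfolding set_integrable_def
proof (rule Bochner_Integration.integrable_bound)
  let ?b = "\<lambda>x. indicat_real S x *\<^sub>R (norm (f x))\<^sup>2 + indicat_real S x *\<^sub>R (norm (g x))\<^sup>2"
  show "integrable lebesgue ?b"
    using f g by (auto simp: L2_def set_integrable_def)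
  have eq: "indicat_real S x *\<^sub>R (f x \<bullet> g x) = (indicat_real S x *\<^sub>R f x) \<bullet> (indicat_real S x *\<^sub>R g x)" for x
    by (simp add: indicator_def)
  show "(\<lambda>x. indicat_real S x *\<^sub>R (f x \<bullet> g x)) \<in> borel_measurable lebesgue"
    unfolding eq by (rule borel_measurable_inner) (use f g in \<open>simp_all only: L2_def set_borel_measurable_def\<close>)
  show "AE x in lebesgue. norm (indicat_real S x *\<^sub>R (f x \<bullet> g x)) \<le> norm (?b x)"
  proof (rule AE_I2)
    fix x
    have "\<bar>f x \<bullet> g x\<bar> \<le> norm (f x) * norm (g x)" by (rule Cauchy_Schwarz_ineq2)
    also have "\<dots> \<le> (norm (f x))\<^sup>2 + (norm (g x))\<^sup>2"
      by (rule mult_le_sum_squares)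
    finally show "norm (indicat_real S x *\<^sub>R (f x \<bullet> g x)) \<le> norm (?b x)"
      by (simp add: indicator_def)
  qed
qed

lemma L2_diff:
  fixes f g :: "'a::euclidean_space \<Rightarrow> 'b::euclidean_space"
  assumes f: "L2 S f" and g: "L2 S g"
  shows "L2 S (\<lambda>x. f x - g x)"
proof -
  have "set_integrable lebesgue S (\<lambda>x. ((norm (f x))\<^sup>2 + (norm (g x))\<^sup>2) - 2 * (f x \<bullet> g x))"
    using f g by (intro set_integral_diff(1) set_integral_add(1) set_integrable_mult_right L2_inner_set_integrable)
      (auto simp: L2_def)
  moreover have "((norm (f x))\<^sup>2 + (norm (g x))\<^sup>2) - 2 * (f x \<bullet> g x) = (norm (f x - g x))\<^sup>2" for x
    by (simp add: power2_norm_eq_inner inner_diff inner_commute)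
  moreover have "set_borel_measurable lebesgue S (\<lambda>x. f x - g x)"
    using f g unfolding L2_def set_borel_measurable_def scaleR_diff_right
    by (auto intro!: borel_measurable_diff)
  ultimately show ?thesis
    unfolding L2_def by simp
qed

text \<open>Young's inequality with a free parameter serves as a substitute for the Cauchy-Schwarz
  inequality.\<close>

lemma L2_inner_Young:
  fixes f g :: "'a::euclidean_space \<Rightarrow> 'b::euclidean_space"
  assumes f: "L2 S f" and g: "L2 S g" and t: "t > 0"
  shows "\<bar>LINT x:S|lebesgue. f x \<bullet> g x\<bar>
    \<le> t * (LINT x:S|lebesgue. (norm (f x))\<^sup>2) + (LINT x:S|lebesgue. (norm (g x))\<^sup>2) / t"
proof -
  have int: "set_integrable lebesgue S (\<lambda>x. (norm (f x))\<^sup>2)" "set_integrable lebesgue S (\<lambda>x. (norm (g x))\<^sup>2)"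
    using f g by (auto simp: L2_def)
  have "\<bar>LINT x:S|lebesgue. f x \<bullet> g x\<bar> \<le> (LINT x:S|lebesgue. \<bar>f x \<bullet> g x\<bar>)"
    using set_integral_norm_bound[OF L2_inner_set_integrable[OF f g]] by simp
  also have "\<dots> \<le> (LINT x:S|lebesgue. t * (norm (f x))\<^sup>2 + (norm (g x))\<^sup>2 / t)"
  proof (rule set_integral_mono)
    show "set_integrable lebesgue S (\<lambda>x. \<bar>f x \<bullet> g x\<bar>)"
      using set_integrable_abs[OF L2_inner_set_integrable[OF f g]] .
    show "set_integrable lebesgue S (\<lambda>x. t * (norm (f x))\<^sup>2 + (norm (g x))\<^sup>2 / t)"
      using int by (intro set_integral_add(1) set_integrable_mult_right set_integrable_divide) auto
    fix x
    have "\<bar>f x \<bullet> g x\<bar> \<le> norm (f x) * norm (g x)" by (rule Cauchy_Schwarz_ineq2)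
    also have "\<dots> = (sqrt t * norm (f x)) * (norm (g x) / sqrt t)"
      using t by simp
    also have "\<dots> \<le> (sqrt t * norm (f x))\<^sup>2 + (norm (g x) / sqrt t)\<^sup>2"
      by (rule mult_le_sum_squares)
    finally show "\<bar>f x \<bullet> g x\<bar> \<le> t * (norm (f x))\<^sup>2 + (norm (g x))\<^sup>2 / t"
      using t by (simp add: power_mult_distrib power_divide)
  qed
  also have "\<dots> = t * (LINT x:S|lebesgue. (norm (f x))\<^sup>2) + (LINT x:S|lebesgue. (norm (g x))\<^sup>2) / t"
    using int by (subst set_integral_add(2)) (auto intro!: set_integrable_mult_right set_integrable_divide)
  finally show ?thesis .
qed

lemma L2_inner_tendsto_0:
  fixes p :: "'a::euclidean_space \<Rightarrow> 'b::euclidean_space"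
  assumes p: "L2 S p" and f: "\<And>n. L2 S (f n)"
    and lim: "(\<lambda>n. LINT x:S|lebesgue. (norm (f n x))\<^sup>2) \<longlonglongrightarrow> 0"
  shows "(\<lambda>n. LINT x:S|lebesgue. p x \<bullet> f n x) \<longlonglongrightarrow> 0"
proof -
  define A where "A = (LINT x:S|lebesgue. (norm (p x))\<^sup>2)"
  define B where "B n = (LINT x:S|lebesgue. (norm (f n x))\<^sup>2)" for n
  have B0: "0 \<le> B n" for n
    unfolding B_def set_lebesgue_integral_def by (intro Bochner_Integration.integral_nonneg) (simp add: indicator_def)
  \<comment> \<open>The optimal parameter would be proportional to \<open>sqrt (B n)\<close>, which may be \<open>0\<close>.\<close>
  define t where "t n = sqrt (B n) + 1 / real (Suc n)" for n
  have t0: "t n > 0" for n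
    unfolding t_def using B0[of n] by (intro add_nonneg_pos) auto
  have bound: "norm (LINT x:S|lebesgue. p x \<bullet> f n x) \<le> t n * A + sqrt (B n)" for n
  proof -
    have "B n = sqrt (B n) * sqrt (B n)" using B0 by simp
    also have "\<dots> \<le> sqrt (B n) * t n"
      using B0 by (intro mult_left_mono) (auto simp: t_def)
    finally have "B n / t n \<le> sqrt (B n)"
      using t0[of n] by (simp add: field_simps)
    then show ?thesis
      using L2_inner_Young[OF p f[of n] t0[of n]] unfolding A_def[symmetric] B_def[symmetric] real_norm_def by linarith
  qed
  have sq: "(\<lambda>n. sqrt (B n)) \<longlonglongrightarrow> 0"
    using tendsto_real_sqrt[OF lim] by (simp add: B_def)
  have "(\<lambda>n. (sqrt (B n) + 1 / real (Suc n)) * A + sqrt (B n)) \<longlonglongrightarrow> (0 + 0) * A + 0"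
    by (intro tendsto_intros sq LIMSEQ_Suc[OF lim_1_over_n])
  then have lim0: "(\<lambda>n. t n * A + sqrt (B n)) \<longlonglongrightarrow> 0"
    by (simp add: t_def)
  show ?thesis
    by (rule Lim_null_comparison[OF _ lim0]) (use bound in simp)
qed

lemma set_integrable_continuous_bounded:
  fixes f :: "'a::euclidean_space \<Rightarrow> 'b::euclidean_space"
  assumes f: "continuous_on UNIV f" and S: "bounded S" "S \<in> sets lebesgue"
  shows "set_integrable lebesgue S f"
proof -
  obtain a where a: "S \<subseteq> cbox (- a) a"
    using bounded_subset_cbox_symmetric[OF S(1)] by blast
  have "set_integrable lebesgue (cbox (- a) a) f"
    by (intro absolutely_integrable_continuous continuous_on_subset[OF f]) simp
  then show ?thesis
    using S(2) a by (rule set_integrable_subset)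
qed

lemma L2_continuous_bounded:
  fixes f :: "'a::euclidean_space \<Rightarrow> 'b::euclidean_space"
  assumes f: "continuous_on UNIV f" and S: "bounded S" "S \<in> sets lebesgue"
  shows "L2 S f"
  unfolding L2_def
proof
  show "set_borel_measurable lebesgue S f"
    unfolding set_borel_measurable_def
    by (intro borel_measurable_scaleR borel_measurable_indicator S continuous_borel_measurable_lebesgue f)
  show "set_integrable lebesgue S (\<lambda>x. (norm (f x))\<^sup>2)"
    by (intro set_integrable_continuous_bounded S continuous_intros f)
qed

section \<open>Divergence-free fields and traces on rectangles\<close>

lemma has_integral_DERIV:
  fixes F f :: "real \<Rightarrow> real"
  assumes "\<And>x. (F has_real_derivative f x) (at x)" "a \<le> b"
  shows "(f has_integral F b - F a) {a..b}"
  using assms by (intro fundamental_theorem_of_calculus)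
    (auto simp: has_real_derivative_iff_has_vector_derivative[symmetric] intro: has_field_derivative_at_within)

lemma smooth_has_derivative_gradient:
  fixes \<phi> :: "'a::euclidean_space \<Rightarrow> real"
  assumes "smooth \<phi>"
  shows "(\<phi> has_derivative (\<lambda>v. gradient \<phi> x \<bullet> v)) (at x)" "continuous_on S (gradient \<phi>)"
proof -
  have C1: "Ck (Suc 0) \<phi>" using assms unfolding smooth_def by blast
  have D: "(\<phi> has_derivative frechet_derivative \<phi> (at x)) (at x)"
    by (rule Ck_Suc_has_derivative[OF C1])
  interpret linear "frechet_derivative \<phi> (at x)"
    by (rule has_derivative_linear[OF D])
  have "frechet_derivative \<phi> (at x) v = gradient \<phi> x \<bullet> v" for v
  proof -
    have "frechet_derivative \<phi> (at x) v = frechet_derivative \<phi> (at x) (\<Sum>b\<in>Basis. (v \<bullet> b) *\<^sub>R b)"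
      by (simp only: euclidean_representation)
    also have "\<dots> = (\<Sum>b\<in>Basis. (v \<bullet> b) * frechet_derivative \<phi> (at x) b)"
      by (simp only: sum scale real_scaleR_def)
    also have "\<dots> = gradient \<phi> x \<bullet> v"
      unfolding gradient_def inner_sum_left inner_scaleR_left by (simp add: inner_commute mult.commute)
    finally show ?thesis .
  qed
  then have "frechet_derivative \<phi> (at x) = (\<lambda>v. gradient \<phi> x \<bullet> v)" by blast
  with D show "(\<phi> has_derivative (\<lambda>v. gradient \<phi> x \<bullet> v)) (at x)" by (simp only:)
  have "continuous_on S (\<lambda>x. frechet_derivative \<phi> (at x) b)" for b
  proof (rule Ck_imp_continuous)
    show "Ck 0 (\<lambda>x. frechet_derivative \<phi> (at x) b)"
      using C1 unfolding Ck.simps(2) by blast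
  qed
  then show "continuous_on S (gradient \<phi>)"
    unfolding gradient_def[abs_def] by (intro continuous_intros)
qed

lemma rectangle_eq_box: "{a<..<b} \<times> {0<..<d} = box (a, 0) (b, d :: real)"
  for a b :: real
  by (auto simp: box_def Basis_prod_def)

lemma set_integral_rectangle_eq_integral_cbox:
  fixes F :: "real \<times> real \<Rightarrow> real"
  assumes F: "continuous_on UNIV F"
  shows "(LINT z:{a<..<b} \<times> {0<..<d}|lebesgue. F z) = integral (cbox (a, 0) (b, d)) F"
proof -
  have "set_integrable lebesgue ({a<..<b} \<times> {0<..<d}) F"
    by (rule set_integrable_continuous_bounded[OF F]) (auto simp: rectangle_eq_box)
  then show ?thesis
    by (simp add: set_lebesgue_integral_eq_integral rectangle_eq_box integral_open_interval)
qed

lemma rectangle_divergence_theorem: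
  fixes F\<^sub>1 F\<^sub>2 D\<^sub>1 D\<^sub>2 :: "real \<times> real \<Rightarrow> real"
  assumes ab: "a \<le> b" and d: "0 \<le> d"
    and F1: "\<And>x y. ((\<lambda>x. F\<^sub>1 (x, y)) has_real_derivative D\<^sub>1 (x, y)) (at x)"
    and F2: "\<And>x y. ((\<lambda>y. F\<^sub>2 (x, y)) has_real_derivative D\<^sub>2 (x, y)) (at y)"
    and cont: "continuous_on UNIV D\<^sub>1" "continuous_on UNIV D\<^sub>2"
  shows "integral (cbox (a, 0) (b, d)) (\<lambda>z. D\<^sub>1 z + D\<^sub>2 z) =
    integral {0..d} (\<lambda>y. F\<^sub>1 (b, y) - F\<^sub>1 (a, y)) + integral {a..b} (\<lambda>x. F\<^sub>2 (x, d) - F\<^sub>2 (x, 0))"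
proof -
  have cont': "continuous_on S D\<^sub>1" "continuous_on S D\<^sub>2" for S
    using cont continuous_on_subset by blast+
  have int: "D\<^sub>1 integrable_on cbox (a, 0) (b, d)" "D\<^sub>2 integrable_on cbox (a, 0) (b, d)"
    by (intro integrable_continuous cont')+
  have "integral (cbox (a, 0) (b, d)) D\<^sub>1 = integral (cbox a b) (\<lambda>x. integral (cbox 0 d) (\<lambda>y. D\<^sub>1 (x, y)))"
    by (intro integral_prod_continuous cont')
  also have "\<dots> = integral (cbox 0 d) (\<lambda>y. integral (cbox a b) (\<lambda>x. D\<^sub>1 (x, y)))"
    by (rule integral_swap_continuous) (simp add: cont')
  also have "\<dots> = integral {0..d} (\<lambda>y. F\<^sub>1 (b, y) - F\<^sub>1 (a, y))"
  proof -
    have "integral {a..b} (\<lambda>x. D\<^sub>1 (x, y)) = F\<^sub>1 (b, y) - F\<^sub>1 (a, y)" for y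
      by (rule integral_unique[OF has_integral_DERIV[OF F1 ab]])
    then show ?thesis by simp
  qed
  finally have 1: "integral (cbox (a, 0) (b, d)) D\<^sub>1 = integral {0..d} (\<lambda>y. F\<^sub>1 (b, y) - F\<^sub>1 (a, y))" .
  have "integral (cbox (a, 0) (b, d)) D\<^sub>2 = integral (cbox a b) (\<lambda>x. integral (cbox 0 d) (\<lambda>y. D\<^sub>2 (x, y)))"
    by (intro integral_prod_continuous cont')
  also have "\<dots> = integral {a..b} (\<lambda>x. F\<^sub>2 (x, d) - F\<^sub>2 (x, 0))"
  proof -
    have "integral {0..d} (\<lambda>y. D\<^sub>2 (x, y)) = F\<^sub>2 (x, d) - F\<^sub>2 (x, 0)" for x
      by (rule integral_unique[OF has_integral_DERIV[OF F2 d]])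
    then show ?thesis by simp
  qed
  finally have 2: "integral (cbox (a, 0) (b, d)) D\<^sub>2 = integral {a..b} (\<lambda>x. F\<^sub>2 (x, d) - F\<^sub>2 (x, 0))" .
  show ?thesis
    using integral_add[OF int] 1 2 by simp
qed

lemma smooth_partial_derivatives:
  fixes v :: "real \<times> real \<Rightarrow> real"
  assumes v: "smooth v"
  shows "((\<lambda>x. v (x, y)) has_real_derivative fst (gradient v (x, y))) (at x)"
    and "((\<lambda>y. v (x, y)) has_real_derivative snd (gradient v (x, y))) (at y)"
    and "continuous_on S v" and "continuous_on S (gradient v)"
proof -
  note D = smooth_has_derivative_gradient[OF v]
  have "((\<lambda>x. v (x, y)) has_derivative (\<lambda>t. gradient v (x, y) \<bullet> (t, 0))) (at x)"
    by (rule has_derivative_compose[where g=v and f="\<lambda>x. (x, y)", OF _ D(1)])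
      (auto intro!: derivative_eq_intros)
  then show "((\<lambda>x. v (x, y)) has_real_derivative fst (gradient v (x, y))) (at x)"
    unfolding has_field_derivative_def by (simp add: inner_prod_def)
  have "((\<lambda>y. v (x, y)) has_derivative (\<lambda>t. gradient v (x, y) \<bullet> (0, t))) (at y)"
    by (rule has_derivative_compose[where g=v and f="\<lambda>y. (x, y)", OF _ D(1)])
      (auto intro!: derivative_eq_intros)
  then show "((\<lambda>y. v (x, y)) has_real_derivative snd (gradient v (x, y))) (at y)"
    unfolding has_field_derivative_def by (simp add: inner_prod_def)
  show "continuous_on S v"
    using D(1) by (auto intro!: continuous_at_imp_continuous_on has_derivative_continuous)
  show "continuous_on S (gradient v)"
    by (rule D(2))
qed

text \<open>If \<open>p\<close> is divergence free, then \<open>p \<bullet> \<nabla>v\<close> is the divergence of \<open>v p\<close>. The field \<open>p\<close> is tangent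
  to all sides of the rectangle but the base, where it leaves only a boundary term. The common
  mixed derivative \<open>m\<close> is given explicitly, so \<open>v\<close> enters only through its first derivatives.\<close>

lemma rectangle_divergence_free:
  fixes p :: "real \<times> real \<Rightarrow> real \<times> real" and m v :: "real \<times> real \<Rightarrow> real"
  assumes ab: "a \<le> b" and d: "0 \<le> d"
    and p1: "\<And>x y. ((\<lambda>x. fst (p (x, y))) has_real_derivative m (x, y)) (at x)"
    and p2: "\<And>x y. ((\<lambda>y. snd (p (x, y))) has_real_derivative - m (x, y)) (at y)"
    and cont: "continuous_on UNIV p" "continuous_on UNIV m"
    and sides: "\<And>y. fst (p (a, y)) = 0" "\<And>y. fst (p (b, y)) = 0"
    and top: "\<And>x. x \<in> {a..b} \<Longrightarrow> snd (p (x, d)) = 0"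
    and v: "smooth v"
  shows "integral (cbox (a, 0) (b, d)) (\<lambda>z. p z \<bullet> gradient v z) = - integral {a..b} (\<lambda>x. snd (p (x, 0)) * v (x, 0))"
proof -
  note dv = smooth_partial_derivatives[OF v]
  have "integral (cbox (a, 0) (b, d)) (\<lambda>z. p z \<bullet> gradient v z) =
    integral (cbox (a, 0) (b, d)) (\<lambda>z. (fst (gradient v z) * fst (p z) + m z * v z) +
      (snd (gradient v z) * snd (p z) - m z * v z))"
    by (rule arg_cong[where f="integral _"]) (simp add: fun_eq_iff inner_prod_def algebra_simps)
  also have "\<dots> = integral {0..d} (\<lambda>y. v (b, y) * fst (p (b, y)) - v (a, y) * fst (p (a, y)))
      + integral {a..b} (\<lambda>x. v (x, d) * snd (p (x, d)) - v (x, 0) * snd (p (x, 0)))"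
  proof (rule rectangle_divergence_theorem[OF ab d, where F\<^sub>1="\<lambda>z. v z * fst (p z)" and F\<^sub>2="\<lambda>z. v z * snd (p z)"])
    show "((\<lambda>x. v (x, y) * fst (p (x, y))) has_real_derivative
        fst (gradient v (x, y)) * fst (p (x, y)) + m (x, y) * v (x, y)) (at x)" for x y
      using DERIV_mult[OF dv(1) p1] by simp
    show "((\<lambda>y. v (x, y) * snd (p (x, y))) has_real_derivative
        snd (gradient v (x, y)) * snd (p (x, y)) - m (x, y) * v (x, y)) (at y)" for x y
      using DERIV_mult[OF dv(2) p2] by simp
    show "continuous_on UNIV (\<lambda>z. fst (gradient v z) * fst (p z) + m z * v z)"
      "continuous_on UNIV (\<lambda>z. snd (gradient v z) * snd (p z) - m z * v z)"
      by (intro continuous_intros dv(3,4) cont)+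
  qed
  also have "integral {0..d} (\<lambda>y. v (b, y) * fst (p (b, y)) - v (a, y) * fst (p (a, y))) = 0"
    by (simp add: sides)
  also have "integral {a..b} (\<lambda>x. v (x, d) * snd (p (x, d)) - v (x, 0) * snd (p (x, 0))) =
      integral {a..b} (\<lambda>x. - (snd (p (x, 0)) * v (x, 0)))"
    by (rule integral_cong) (simp add: top)
  finally show ?thesis by simp
qed

text \<open>Both sides are continuous in the convergence that defines the trace: the gradients converge in
  \<open>L\<^sup>2\<close> of the rectangle and the boundary values in \<open>L\<^sup>2\<close> of the base.\<close>

lemma rectangle_divergence_free_trace:
  fixes p :: "real \<times> real \<Rightarrow> real \<times> real" and m u :: "real \<times> real \<Rightarrow> real"
  assumes ab: "a < b" and d: "0 < d"
    and p1: "\<And>x y. ((\<lambda>x. fst (p (x, y))) has_real_derivative m (x, y)) (at x)"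
    and p2: "\<And>x y. ((\<lambda>y. snd (p (x, y))) has_real_derivative - m (x, y)) (at y)"
    and cont: "continuous_on UNIV p" "continuous_on UNIV m"
    and sides: "\<And>y. fst (p (a, y)) = 0" "\<And>y. fst (p (b, y)) = 0"
    and top: "\<And>x. x \<in> {a..b} \<Longrightarrow> snd (p (x, d)) = 0"
    and tr: "rectangle_trace a b d u \<tau>"
  shows "(LINT z:{a<..<b} \<times> {0<..<d}|lebesgue. p z \<bullet> weak_gradient ({a<..<b} \<times> {0<..<d}) u z)
    = - (LINT x:{a<..<b}|lebesgue. snd (p (x, 0)) * \<tau> x)"
proof -
  define Q where "Q = {a<..<b} \<times> {0<..<d}"
  define g where "g = weak_gradient Q u"
  define r where "r x = snd (p (x, 0))" for x
  obtain \<phi> where u: "u \<in> H1 Q" and \<tau>: "L2 {a<..<b} \<tau>" and \<phi>: "\<And>n. smooth (\<phi> n)"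
    and lim_g: "(\<lambda>n. LINT z:Q|lebesgue. (norm (gradient (\<phi> n) z - g z))\<^sup>2) \<longlonglongrightarrow> 0"
    and lim_\<tau>: "(\<lambda>n. LINT x:{a<..<b}|lebesgue. (\<phi> n (x, 0) - \<tau> x)\<^sup>2) \<longlonglongrightarrow> 0"
    using tr unfolding rectangle_trace_def Let_def Q_def[symmetric] g_def[symmetric] by blast
  have Q: "open Q" "bounded Q" "Q \<in> sets lebesgue"
    by (auto simp: Q_def rectangle_eq_box)
  have I: "bounded {a<..<b}" "{a<..<b} \<in> sets lebesgue" by auto
  have g: "L2 Q g" unfolding g_def by (rule H1_weak_gradient[OF Q(1) u])
  have p: "L2 Q p" by (intro L2_continuous_bounded cont Q)
  have cr: "continuous_on S r" for S
    unfolding r_def by (intro continuous_intros continuous_on_compose2[OF cont(1)]) auto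
  have r: "L2 {a<..<b} r" by (intro L2_continuous_bounded cr I)
  have c\<phi>: "continuous_on S (\<lambda>x. \<phi> n (x, 0))" for n S
    by (intro continuous_on_compose2[OF smooth_partial_derivatives(3)[OF \<phi>, of UNIV]] continuous_intros) auto
  have \<phi>0: "L2 {a<..<b} (\<lambda>x. \<phi> n (x, 0))" for n
    by (intro L2_continuous_bounded c\<phi> I)
  have \<phi>g: "L2 Q (gradient (\<phi> n))" for n
    by (intro L2_continuous_bounded smooth_partial_derivatives(4)[OF \<phi>] Q)
  have "(\<lambda>n. LINT z:Q|lebesgue. p z \<bullet> (gradient (\<phi> n) z - g z)) \<longlonglongrightarrow> 0"
    by (intro L2_inner_tendsto_0 p L2_diff \<phi>g g lim_g)
  moreover have "(LINT z:Q|lebesgue. p z \<bullet> (gradient (\<phi> n) z - g z)) =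
      (LINT z:Q|lebesgue. p z \<bullet> gradient (\<phi> n) z) - (LINT z:Q|lebesgue. p z \<bullet> g z)" for n
    unfolding inner_diff_right by (intro set_integral_diff(2) L2_inner_set_integrable p \<phi>g g)
  ultimately have "(\<lambda>n. LINT z:Q|lebesgue. p z \<bullet> gradient (\<phi> n) z) \<longlonglongrightarrow> (LINT z:Q|lebesgue. p z \<bullet> g z)"
    by (simp add: LIM_zero_iff)
  moreover have "(LINT z:Q|lebesgue. p z \<bullet> gradient (\<phi> n) z) = - (LINT x:{a<..<b}|lebesgue. r x * \<phi> n (x, 0))" for n
  proof -
    have "(LINT z:Q|lebesgue. p z \<bullet> gradient (\<phi> n) z) = integral (cbox (a, 0) (b, d)) (\<lambda>z. p z \<bullet> gradient (\<phi> n) z)"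
      unfolding Q_def by (intro set_integral_rectangle_eq_integral_cbox continuous_intros cont smooth_partial_derivatives(4)[OF \<phi>])
    also have "\<dots> = - integral {a..b} (\<lambda>x. r x * \<phi> n (x, 0))"
      unfolding r_def using ab d by (intro rectangle_divergence_free[OF _ _ p1 p2 cont sides top \<phi>]) auto
    also have "integral {a..b} (\<lambda>x. r x * \<phi> n (x, 0)) = integral {a<..<b} (\<lambda>x. r x * \<phi> n (x, 0))"
      by (simp add: integral_open_interval_real)
    also have "\<dots> = (LINT x:{a<..<b}|lebesgue. r x * \<phi> n (x, 0))"
      by (intro set_lebesgue_integral_eq_integral(2)[symmetric] set_integrable_continuous_bounded I
        continuous_intros cr c\<phi>)
    finally show ?thesis .
  qed
  moreover have "(\<lambda>n. LINT x:{a<..<b}|lebesgue. r x \<bullet> (\<phi> n (x, 0) - \<tau> x)) \<longlonglongrightarrow> 0"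
    by (intro L2_inner_tendsto_0 r L2_diff \<phi>0 \<tau>) (simp add: lim_\<tau>)
  moreover have "(LINT x:{a<..<b}|lebesgue. r x \<bullet> (\<phi> n (x, 0) - \<tau> x)) =
      (LINT x:{a<..<b}|lebesgue. r x \<bullet> \<phi> n (x, 0)) - (LINT x:{a<..<b}|lebesgue. r x \<bullet> \<tau> x)" for n
    unfolding inner_diff_right by (intro set_integral_diff(2) L2_inner_set_integrable r \<phi>0 \<tau>)
  ultimately have 1: "(\<lambda>n. - (LINT x:{a<..<b}|lebesgue. r x * \<phi> n (x, 0))) \<longlonglongrightarrow> (LINT z:Q|lebesgue. p z \<bullet> g z)"
    and 2: "(\<lambda>n. LINT x:{a<..<b}|lebesgue. r x * \<phi> n (x, 0)) \<longlonglongrightarrow> (LINT x:{a<..<b}|lebesgue. r x * \<tau> x)"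
    by (simp_all add: LIM_zero_iff)
  then show ?thesis
    using LIMSEQ_unique[OF 1 tendsto_minus[OF 2]] by (simp add: Q_def g_def r_def)
qed

section \<open>Spline cutoffs\<close>

lemma DERIV_max_0_power:
  "((\<lambda>t. max 0 t ^ Suc (Suc n)) has_real_derivative real (Suc (Suc n)) * max 0 t ^ Suc n) (at t)"
proof (cases t "0::real" rule: linorder_cases)
  case less
  have "((\<lambda>_. 0) has_real_derivative 0) (at t)" by simp
  then have "((\<lambda>t. max 0 t ^ Suc (Suc n)) has_real_derivative 0) (at t)"
    by (rule has_field_derivative_transform_within_open[of _ _ _ "{..<0}"]) (use less in auto)
  then show ?thesis using less by simp
next
  case equal
  have "((\<lambda>t::real. t * max 0 t ^ n) \<longlongrightarrow> 0 * max 0 0 ^ n) (at 0)"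
    by (intro tendsto_intros)
  then have lim: "((\<lambda>t::real. \<bar>t * max 0 t ^ n\<bar>) \<longlongrightarrow> 0) (at 0)"
    by (intro tendsto_rabs_zero) simp
  have "norm (max 0 y ^ Suc (Suc n) / y) \<le> \<bar>y * max 0 y ^ n\<bar>" if "y \<noteq> 0" for y :: real
    using that by (cases "y > 0") (auto simp: max_def)
  then have "((\<lambda>y::real. max 0 y ^ Suc (Suc n) / y) \<longlongrightarrow> 0) (at 0)"
    by (intro Lim_null_comparison[OF _ lim]) (simp add: eventually_at_filter)
  then show ?thesis
    unfolding equal has_field_derivative_iff by simp
next
  case greater
  have "((\<lambda>t. t ^ Suc (Suc n)) has_real_derivative real (Suc (Suc n)) * t ^ Suc n) (at t)"
    using DERIV_pow[of "Suc (Suc n)" t UNIV] by simp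
  then have "((\<lambda>t. max 0 t ^ Suc (Suc n)) has_real_derivative real (Suc (Suc n)) * t ^ Suc n) (at t)"
    by (rule has_field_derivative_transform_within_open[of _ _ _ "{0<..}"]) (use greater in auto)
  then show ?thesis using greater by simp
qed

text \<open>A chain of splines, each the derivative of the next: a tent on \<open>[0, 1]\<close> of mass one, a
  continuously differentiable step, and a twice continuously differentiable approximation of
  the positive part. All are combinations of powers of shifted positive parts.\<close>

definition spline_bump :: "real \<Rightarrow> real" where
  "spline_bump t = 4 * max 0 t - 8 * max 0 (t - 1 / 2) + 4 * max 0 (t - 1)"

definition spline_step :: "real \<Rightarrow> real" where
  "spline_step t = 2 * (max 0 t)\<^sup>2 - 4 * (max 0 (t - 1 / 2))\<^sup>2 + 2 * (max 0 (t - 1))\<^sup>2"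

definition spline_ramp :: "real \<Rightarrow> real" where
  "spline_ramp t = 2 / 3 * max 0 t ^ 3 - 4 / 3 * max 0 (t - 1 / 2) ^ 3 + 2 / 3 * max 0 (t - 1) ^ 3"

lemma DERIV_max_0_square: "((\<lambda>t. (max 0 (t - c))\<^sup>2) has_real_derivative 2 * max 0 (t - c)) (at t)"
proof -
  have "((\<lambda>t. max 0 t ^ 2) has_real_derivative 2 * max 0 (t - c)) (at (t - c))"
    using DERIV_max_0_power[of 0 "t - c"] by (simp add: numeral_2_eq_2)
  moreover have "((\<lambda>t. t - c) has_real_derivative 1) (at t)"
    by (auto intro!: derivative_eq_intros)
  ultimately show ?thesis
    using DERIV_chain2[where f="\<lambda>t. max 0 t ^ 2" and g="\<lambda>t. t - c"] by fastforce
qed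

lemma DERIV_max_0_cube: "((\<lambda>t. max 0 (t - c) ^ 3) has_real_derivative 3 * (max 0 (t - c))\<^sup>2) (at t)"
proof -
  have "((\<lambda>t. max 0 t ^ 3) has_real_derivative 3 * (max 0 (t - c))\<^sup>2) (at (t - c))"
    using DERIV_max_0_power[of 1 "t - c"] by (simp add: numeral_2_eq_2 numeral_3_eq_3)
  moreover have "((\<lambda>t. t - c) has_real_derivative 1) (at t)"
    by (auto intro!: derivative_eq_intros)
  ultimately show ?thesis
    using DERIV_chain2[where f="\<lambda>t. max 0 t ^ 3" and g="\<lambda>t. t - c"] by fastforce
qed

lemma spline_step_DERIV: "(spline_step has_real_derivative spline_bump t) (at t)"
proof -
  have "(spline_step has_real_derivative 2 * (2 * max 0 (t - 0)) - 4 * (2 * max 0 (t - 1 / 2)) + 2 * (2 * max 0 (t - 1))) (at t)"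
    unfolding spline_step_def[abs_def]
    using DERIV_max_0_square[of 0 t] by (intro DERIV_add DERIV_diff DERIV_cmult DERIV_max_0_square) simp
  then show ?thesis by (simp add: spline_bump_def)
qed

lemma spline_ramp_DERIV: "(spline_ramp has_real_derivative spline_step t) (at t)"
proof -
  have "(spline_ramp has_real_derivative 2 / 3 * (3 * (max 0 (t - 0))\<^sup>2) - 4 / 3 * (3 * (max 0 (t - 1 / 2))\<^sup>2)
      + 2 / 3 * (3 * (max 0 (t - 1))\<^sup>2)) (at t)"
    unfolding spline_ramp_def[abs_def]
    using DERIV_max_0_cube[of 0 t] by (intro DERIV_add DERIV_diff DERIV_cmult DERIV_max_0_cube) simp
  then show ?thesis by (simp add: spline_step_def)
qed

lemma continuous_spline_bump: "continuous_on S spline_bump"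
  unfolding spline_bump_def[abs_def] by (intro continuous_intros)

lemma continuous_spline_step: "continuous_on S spline_step"
  by (intro DERIV_continuous_on) (use spline_step_DERIV DERIV_subset in blast)

lemma continuous_spline_ramp: "continuous_on S spline_ramp"
  by (intro DERIV_continuous_on) (use spline_ramp_DERIV DERIV_subset in blast)

lemma spline_nonpos:
  assumes "t \<le> 0"
  shows "spline_bump t = 0" "spline_step t = 0" "spline_ramp t = 0"
  using assms by (simp_all add: spline_bump_def spline_step_def spline_ramp_def max_def)

lemma spline_ge_1:
  assumes "t \<ge> 1"
  shows "spline_bump t = 0" "spline_step t = 1" "spline_ramp t = t - 1 / 2"
  using assms by (simp_all add: spline_bump_def spline_step_def spline_ramp_def field_simps power2_eq_square power3_eq_cube)

lemma spline_bump_bounds: "0 \<le> spline_bump t" "spline_bump t \<le> 2"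
  by (auto simp: spline_bump_def max_def)

lemma spline_step_bounds: "0 \<le> spline_step t" "spline_step t \<le> 1"
proof -
  consider "t \<le> 0" | "0 \<le> t" "t \<le> 1 / 2" | "1 / 2 \<le> t" "t \<le> 1" | "1 \<le> t" by linarith
  then have "0 \<le> spline_step t \<and> spline_step t \<le> 1"
  proof cases
    case 2
    then have "spline_step t = 2 * t\<^sup>2" by (simp add: spline_step_def max_def)
    moreover have "t\<^sup>2 \<le> (1 / 2)\<^sup>2" using 2 by (intro power_mono) auto
    ultimately show ?thesis by (simp add: power2_eq_square)
  next
    case 3
    then have "spline_step t = 1 - 2 * (1 - t)\<^sup>2"
      by (simp add: spline_step_def max_def power2_eq_square field_simps)
    moreover have "(1 - t)\<^sup>2 \<le> (1 / 2)\<^sup>2" using 3 by (intro power_mono) auto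
    ultimately show ?thesis by (simp add: power2_eq_square)
  qed (auto simp: spline_nonpos spline_ge_1)
  then show "0 \<le> spline_step t" "spline_step t \<le> 1" by auto
qed

lemma spline_ramp_bounds: "0 \<le> spline_ramp t" "t - 1 \<le> spline_ramp t" "0 \<le> t \<Longrightarrow> spline_ramp t \<le> t"
proof -
  have mono: "spline_ramp s \<le> spline_ramp t" if "s \<le> t" for s t
    using that by (rule DERIV_nonneg_imp_nondecreasing) (use spline_ramp_DERIV spline_step_bounds in blast)
  have mono': "s - spline_ramp s \<le> t - spline_ramp t" if "s \<le> t" for s t
  proof (rule DERIV_nonneg_imp_nondecreasing[OF that])
    fix x
    have "((\<lambda>t. t - spline_ramp t) has_real_derivative 1 - spline_step x) (at x)"
      by (intro DERIV_diff DERIV_ident spline_ramp_DERIV)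
    then show "\<exists>y. ((\<lambda>t. t - spline_ramp t) has_real_derivative y) (at x) \<and> 0 \<le> y"
      using spline_step_bounds by (intro exI[of _ "1 - spline_step x"]) auto
  qed
  show nonneg: "0 \<le> spline_ramp t"
    using mono[of 0 t] by (cases "t \<le> 0") (auto simp: spline_nonpos)
  show "t - 1 \<le> spline_ramp t"
    using nonneg by (cases "t \<le> 1") (auto simp: spline_ge_1)
  show "spline_ramp t \<le> t" if "0 \<le> t"
    using mono'[OF that] by (simp add: spline_nonpos)
qed

text \<open>The stream function below is \<open>ramp \<epsilon> (k x - y)\<close>; the parameter \<open>\<epsilon>\<close> is the length over
  which the positive part is smoothed, and tends to \<open>0\<close> in the end.\<close>

definition ramp :: "real \<Rightarrow> real \<Rightarrow> real" where
  "ramp \<epsilon> t = \<epsilon> * spline_ramp (t / \<epsilon>)"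

definition step :: "real \<Rightarrow> real \<Rightarrow> real" where
  "step \<epsilon> t = spline_step (t / \<epsilon>)"

definition bump :: "real \<Rightarrow> real \<Rightarrow> real" where
  "bump \<epsilon> t = spline_bump (t / \<epsilon>) / \<epsilon>"

lemma step_DERIV:
  assumes "\<epsilon> > 0"
  shows "(step \<epsilon> has_real_derivative bump \<epsilon> t) (at t)"
proof -
  have "((\<lambda>t. spline_step (t / \<epsilon>)) has_real_derivative spline_bump (t / \<epsilon>) * (1 / \<epsilon>)) (at t)"
    by (rule DERIV_chain2[OF spline_step_DERIV DERIV_cdivide[OF DERIV_ident]])
  then show ?thesis by (simp add: step_def[abs_def] bump_def)
qed

lemma ramp_DERIV:
  assumes "\<epsilon> > 0"
  shows "(ramp \<epsilon> has_real_derivative step \<epsilon> t) (at t)"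
proof -
  have "((\<lambda>t. spline_ramp (t / \<epsilon>)) has_real_derivative spline_step (t / \<epsilon>) * (1 / \<epsilon>)) (at t)"
    by (rule DERIV_chain2[OF spline_ramp_DERIV DERIV_cdivide[OF DERIV_ident]])
  then have "((\<lambda>t. \<epsilon> * spline_ramp (t / \<epsilon>)) has_real_derivative \<epsilon> * (spline_step (t / \<epsilon>) * (1 / \<epsilon>))) (at t)"
    by (rule DERIV_cmult)
  then show ?thesis using assms by (simp add: step_def ramp_def[abs_def])
qed

lemma ramp_nonpos:
  assumes "\<epsilon> > 0" "t \<le> 0"
  shows "bump \<epsilon> t = 0" "step \<epsilon> t = 0" "ramp \<epsilon> t = 0"
  using assms by (simp_all add: bump_def step_def ramp_def spline_nonpos divide_nonpos_pos)

lemma step_bounds: "0 \<le> step \<epsilon> t" "step \<epsilon> t \<le> 1"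
  by (simp_all add: step_def spline_step_bounds)

lemma ramp_bounds:
  assumes "\<epsilon> > 0"
  shows "0 \<le> ramp \<epsilon> t" "t - \<epsilon> \<le> ramp \<epsilon> t" "0 \<le> t \<Longrightarrow> ramp \<epsilon> t \<le> t"
proof -
  show "0 \<le> ramp \<epsilon> t" using assms spline_ramp_bounds(1) by (simp add: ramp_def)
  have "\<epsilon> * (t / \<epsilon> - 1) \<le> \<epsilon> * spline_ramp (t / \<epsilon>)"
    using assms by (intro mult_left_mono spline_ramp_bounds(2)) simp
  moreover have "\<epsilon> * (t / \<epsilon> - 1) = t - \<epsilon>"
    using assms by (simp add: field_simps)
  ultimately show "t - \<epsilon> \<le> ramp \<epsilon> t" by (simp add: ramp_def)
  assume "0 \<le> t"
  then have "\<epsilon> * spline_ramp (t / \<epsilon>) \<le> \<epsilon> * (t / \<epsilon>)"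
    using assms by (intro mult_left_mono spline_ramp_bounds(3)) auto
  then show "ramp \<epsilon> t \<le> t" using assms by (simp add: ramp_def)
qed

lemma continuous_on_ramp:
  assumes "continuous_on S f"
  shows "continuous_on S (\<lambda>x. ramp \<epsilon> (f x))" "continuous_on S (\<lambda>x. step \<epsilon> (f x))" "continuous_on S (\<lambda>x. bump \<epsilon> (f x))"
proof -
  have f: "continuous_on S (\<lambda>x. f x / \<epsilon>)"
    unfolding divide_inverse by (intro continuous_intros assms)
  show "continuous_on S (\<lambda>x. ramp \<epsilon> (f x))"
    unfolding ramp_def
    by (intro continuous_on_mult continuous_on_const continuous_on_compose2[OF continuous_spline_ramp f subset_UNIV])
  show "continuous_on S (\<lambda>x. step \<epsilon> (f x))"
    unfolding step_def by (rule continuous_on_compose2[OF continuous_spline_step f subset_UNIV])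
  show "continuous_on S (\<lambda>x. bump \<epsilon> (f x))"
    unfolding bump_def divide_inverse[of "spline_bump _"]
    by (intro continuous_on_mult continuous_on_const continuous_on_compose2[OF continuous_spline_bump f subset_UNIV])
qed

text \<open>Consecutive differences of shifted steps telescope, which gives a partition of unity made of
  pieces of length \<open>2 \<eta>\<close>. The index \<open>i\<close> is shifted by \<open>N\<close> in order to cover a neighbourhood of \<open>0\<close>.\<close>

definition partition_piece :: "real \<Rightarrow> nat \<Rightarrow> nat \<Rightarrow> real \<Rightarrow> real" where
  "partition_piece \<eta> N i x = spline_step (x / \<eta> + (real N - real i)) - spline_step (x / \<eta> + (real N - real (Suc i)))"

definition partition_piece_deriv :: "real \<Rightarrow> nat \<Rightarrow> nat \<Rightarrow> real \<Rightarrow> real" where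
  "partition_piece_deriv \<eta> N i x = spline_bump (x / \<eta> + (real N - real i)) / \<eta> - spline_bump (x / \<eta> + (real N - real (Suc i))) / \<eta>"

lemma partition_piece_DERIV:
  assumes "\<eta> > 0"
  shows "(partition_piece \<eta> N i has_real_derivative partition_piece_deriv \<eta> N i x) (at x)"
proof -
  have "((\<lambda>x. spline_step (x / \<eta> + c)) has_real_derivative spline_bump (x / \<eta> + c) / \<eta>) (at x)" for c
  proof -
    have "((\<lambda>x. x / \<eta> + c) has_real_derivative 1 / \<eta>) (at x)"
      using DERIV_add[OF DERIV_cdivide[OF DERIV_ident] DERIV_const] by simp
    from DERIV_chain2[OF spline_step_DERIV this] show ?thesis by simp
  qed
  then show ?thesis
    unfolding partition_piece_def[abs_def] partition_piece_deriv_def by (intro DERIV_diff)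
qed

lemma continuous_partition_piece_deriv: "continuous_on S (partition_piece_deriv \<eta> N i)"
  unfolding partition_piece_deriv_def[abs_def] divide_inverse
  by (intro continuous_intros continuous_on_compose2[OF continuous_spline_bump _ subset_UNIV])

lemma partition_piece_eq_0:
  assumes \<eta>: "\<eta> > 0" and x: "x \<notin> {\<eta> * (real i - real N)<..<\<eta> * (real i - real N) + 2 * \<eta>}"
  shows "partition_piece \<eta> N i x = 0 \<and> partition_piece_deriv \<eta> N i x = 0"
proof -
  have "x \<le> \<eta> * (real i - real N) \<or> \<eta> * (real i - real N) + 2 * \<eta> \<le> x"
    using x by auto
  then have "x / \<eta> + (real N - real i) \<le> 0 \<or> x / \<eta> + (real N - real i) \<ge> 2"
    using \<eta> by (simp add: field_simps)
  then show ?thesis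
    by (auto simp: partition_piece_def partition_piece_deriv_def spline_nonpos spline_ge_1)
qed

lemma sum_partition_piece:
  assumes \<eta>: "\<eta> > 0" and x: "\<bar>x\<bar> \<le> \<eta> * (real N - 1)"
  shows "(\<Sum>i<2 * N. partition_piece \<eta> N i x) = 1" "(\<Sum>i<2 * N. partition_piece_deriv \<eta> N i x) = 0"
proof -
  have "\<bar>x / \<eta>\<bar> \<le> real N - 1"
    using x \<eta> by (simp add: field_simps)
  then have "- (real N - 1) \<le> x / \<eta>" "x / \<eta> \<le> real N - 1"
    by (simp_all only: abs_le_iff) linarith
  then have ge: "x / \<eta> + (real N - real 0) \<ge> 1" and le: "x / \<eta> + (real N - real (2 * N)) \<le> 0"
    by simp_all
  show "(\<Sum>i<2 * N. partition_piece \<eta> N i x) = 1"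
    unfolding partition_piece_def
    using sum_lessThan_telescope'[of "\<lambda>i. spline_step (x / \<eta> + (real N - real i))" "2 * N"] ge le
    by (simp only: spline_nonpos spline_ge_1)
  show "(\<Sum>i<2 * N. partition_piece_deriv \<eta> N i x) = 0"
    unfolding partition_piece_deriv_def
    using sum_lessThan_telescope'[of "\<lambda>i. spline_bump (x / \<eta> + (real N - real i)) / \<eta>" "2 * N"] ge le
    by (simp only: spline_nonpos spline_ge_1)
qed

section \<open>The flux of the gradient through the subgraph\<close>

lemma mem_subgraph: "(x, y) \<in> subgraph h \<longleftrightarrow> 0 < y \<and> y < h x"
  by (simp add: subgraph_def)

lemma open_subgraph:
  assumes "continuous_on UNIV h"
  shows "open (subgraph h)"
proof -
  have "subgraph h = {z. 0 < snd z} \<inter> {z. snd z < h (fst z)}"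
    by (auto simp: subgraph_def)
  moreover have "open {z :: real \<times> real. snd z < h (fst z)}"
    by (intro open_Collect_less continuous_intros continuous_on_compose2[OF assms]) auto
  ultimately show ?thesis
    by (auto intro!: open_Int open_Collect_less continuous_intros)
qed

lemma L2_subset:
  assumes "L2 \<Omega> f" "Q \<subseteq> \<Omega>" "Q \<in> sets lebesgue"
  shows "L2 Q f"
  using assms unfolding L2_def by (meson set_borel_measurable_subset set_integrable_subset)

text \<open>The rotated gradient \<open>(- \<Psi>\<^sub>y, \<Psi>\<^sub>x)\<close> of the stream function \<open>\<Psi>(x,y) = \<theta>(x) ramp \<epsilon> (k(x) - y)\<close>,
  where \<open>\<theta>'\<close> and \<open>k'\<close> stand for the derivatives of \<open>\<theta>\<close> and \<open>k\<close>.\<close>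

definition flow_field ::
    "real \<Rightarrow> (real \<Rightarrow> real) \<Rightarrow> (real \<Rightarrow> real) \<Rightarrow> (real \<Rightarrow> real) \<Rightarrow> (real \<Rightarrow> real) \<Rightarrow> real \<times> real \<Rightarrow> real \<times> real" where
  "flow_field \<epsilon> \<theta> \<theta>' k k' z =
    (let x = fst z; t = k x - snd z in
      (\<theta> x * step \<epsilon> t, \<theta>' x * ramp \<epsilon> t + \<theta> x * (step \<epsilon> t * k' x)))"

lemma flow_field_eq_0:
  assumes "\<epsilon> > 0" "k x \<le> y \<or> \<theta> x = 0 \<and> \<theta>' x = 0"
  shows "flow_field \<epsilon> \<theta> \<theta>' k k' (x, y) = 0"
  using assms by (auto simp: flow_field_def ramp_nonpos zero_prod_def)

lemma continuous_flow_field: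
  assumes "continuous_on UNIV \<theta>" "continuous_on UNIV \<theta>'" "continuous_on UNIV k" "continuous_on UNIV k'"
  shows "continuous_on S (flow_field \<epsilon> \<theta> \<theta>' k k')"
proof -
  have c: "continuous_on S (\<lambda>z. f (fst z))" if "continuous_on UNIV f" for f :: "real \<Rightarrow> real" and S :: "(real \<times> real) set"
    by (intro continuous_on_compose2[OF that] continuous_intros) auto
  show ?thesis
    unfolding flow_field_def[abs_def] Let_def
    by (intro continuous_intros continuous_on_ramp c assms)
qed

text \<open>Let \<open>d\<close> be the maximum of \<open>k\<close> over the strip. The rectangle of height \<open>d\<close> over the strip lies in
  the subgraph of \<open>h\<close>, because every value of \<open>k\<close> in the strip is at most every value of \<open>h\<close> there. It
  contains all points of the subgraph at which the field \<open>p\<close> does not vanish. Hence the trace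
  identity on this single rectangle computes the whole flux, and the upper part of the subgraph, where the
  boundary may be irregular, is never touched. On the base \<open>u = x\<close>, and integrating \<open>x \<Psi>\<^sub>x\<close> by
  parts gives the integral of \<open>\<Psi>(x,0)\<close>.\<close>

lemma strip_flux:
  fixes h k k' \<theta> \<theta>' :: "real \<Rightarrow> real"
  assumes ab: "a < b" and \<epsilon>: "\<epsilon> > 0"
    and \<theta>: "\<And>x. (\<theta> has_real_derivative \<theta>' x) (at x)" "continuous_on UNIV \<theta>'"
    and \<theta>0: "\<And>x. x \<notin> {a<..<b} \<Longrightarrow> \<theta> x = 0 \<and> \<theta>' x = 0"
    and k: "\<And>x. (k has_real_derivative k' x) (at x)" "continuous_on UNIV k'" "\<And>x. 0 \<le> k x"
    and kh: "\<And>x y. x \<in> {a..b} \<Longrightarrow> y \<in> {a..b} \<Longrightarrow> k x \<le> h y"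
    and h: "continuous_on UNIV h"
    and u: "u \<in> H1 (subgraph h)"
    and tr: "bottom_trace h u \<tau>" "AE x in lebesgue. x \<in> supp h \<longrightarrow> \<tau> x = x"
  defines "p \<equiv> flow_field \<epsilon> \<theta> \<theta>' k k'" and "g \<equiv> weak_gradient (subgraph h) u"
  shows "set_integrable lebesgue (subgraph h) (\<lambda>z. p z \<bullet> g z)" (is ?int)
    and "(LINT z:subgraph h|lebesgue. p z \<bullet> g z) = integral {a..b} (\<lambda>x. \<theta> x * ramp \<epsilon> (k x))" (is ?eq)
proof -
  have cont: "continuous_on UNIV \<theta>" "continuous_on UNIV k"
    using \<theta>(1) k(1) by (auto intro!: continuous_at_imp_continuous_on DERIV_isCont)
  have cp: "continuous_on S p" for S
    unfolding p_def by (intro continuous_flow_field cont \<theta>(2) k(2))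
  have "\<exists>x\<in>{a..b}. \<forall>y\<in>{a..b}. k y \<le> k x"
    by (rule continuous_attains_sup[OF compact_Icc _ continuous_on_subset[OF cont(2) subset_UNIV]]) (use ab in simp)
  then obtain x\<^sub>0 where x0: "x\<^sub>0 \<in> {a..b}" "\<And>x. x \<in> {a..b} \<Longrightarrow> k x \<le> k x\<^sub>0"
    by blast
  define d where "d = k x\<^sub>0"
  define Q where "Q = {a<..<b} \<times> {0<..<d}"
  have p0: "p (x, y) = 0" if "x \<notin> {a<..<b} \<or> d \<le> y" for x y
  proof (cases "x \<in> {a<..<b}")
    case True
    then have "k x \<le> y"
      using that x0(2)[of x] by (simp add: d_def)
    then show ?thesis
      unfolding p_def by (intro flow_field_eq_0 \<epsilon>) simp
  next
    case False
    then show ?thesis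
      unfolding p_def by (intro flow_field_eq_0 \<epsilon>) (simp add: \<theta>0)
  qed
  have \<Omega>: "open (subgraph h)" by (rule open_subgraph[OF h])
  have Qsub: "Q \<subseteq> subgraph h"
  proof
    fix z assume z: "z \<in> Q"
    then have "d \<le> h (fst z)"
      using kh[OF x0(1), of "fst z"] by (auto simp: Q_def d_def)
    with z show "z \<in> subgraph h" by (auto simp: Q_def subgraph_def)
  qed
  have Q: "open Q" "bounded Q" "Q \<in> sets lebesgue"
    by (auto simp: Q_def rectangle_eq_box)
  have eqQ: "indicator (subgraph h) z *\<^sub>R (p z \<bullet> g z) = indicator Q z *\<^sub>R (p z \<bullet> g z)" for z
  proof (cases "z \<in> Q")
    case True
    then show ?thesis using Qsub by (auto simp: indicator_def)
  next
    case False
    then have "p z = 0 \<or> z \<notin> subgraph h"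
      using p0[of "fst z" "snd z"] by (cases z) (auto simp: Q_def mem_subgraph)
    with False show ?thesis by auto
  qed
  have L2g: "L2 Q g"
    unfolding g_def by (rule L2_subset[OF H1_weak_gradient(2)[OF \<Omega> u] Qsub Q(3)])
  have intQ: "set_integrable lebesgue Q (\<lambda>z. p z \<bullet> g z)"
    by (rule L2_inner_set_integrable[OF L2_continuous_bounded[OF cp Q(2,3)] L2g])
  then show ?int
    unfolding set_integrable_def eqQ .
  have eq1: "(LINT z:subgraph h|lebesgue. p z \<bullet> g z) = (LINT z:Q|lebesgue. p z \<bullet> g z)"
    unfolding set_lebesgue_integral_def eqQ ..
  show ?eq
  proof (cases "d > 0")
    case False
    then have "Q = {}" by (auto simp: Q_def)
    moreover have "k x = 0" if "x \<in> {a..b}" for x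
      using False x0(2)[OF that] k(3)[of x] by (simp add: d_def)
    then have "integral {a..b} (\<lambda>x. \<theta> x * ramp \<epsilon> (k x)) = integral {a..b} (\<lambda>x. 0)"
      by (intro Henstock_Kurzweil_Integration.integral_cong) (simp add: ramp_nonpos \<epsilon>)
    ultimately show ?thesis
      using eq1 by (simp add: set_lebesgue_integral_def)
  next
    case d: True
    define m where "m z = \<theta>' (fst z) * step \<epsilon> (k (fst z) - snd z)
        + \<theta> (fst z) * (bump \<epsilon> (k (fst z) - snd z) * k' (fst z))" for z
    define r where "r x = \<theta>' x * ramp \<epsilon> (k x) + \<theta> x * (step \<epsilon> (k x) * k' x)" for x
    have trQ: "rectangle_trace a b d u \<tau>"
      using tr(1) ab d Qsub unfolding bottom_trace_def Q_def by blast
    then have uQ: "u \<in> H1 Q" unfolding rectangle_trace_def Q_def Let_def by blast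
    have p1: "((\<lambda>x. fst (p (x, y))) has_real_derivative m (x, y)) (at x)" for x y
    proof -
      have "((\<lambda>x. k x - y) has_real_derivative k' x) (at x)"
        using DERIV_diff[OF k(1) DERIV_const] by simp
      then have "((\<lambda>x. step \<epsilon> (k x - y)) has_real_derivative bump \<epsilon> (k x - y) * k' x) (at x)"
        by (rule DERIV_chain2[OF step_DERIV[OF \<epsilon>]])
      from DERIV_mult'[OF \<theta>(1) this] show ?thesis
        by (simp add: p_def flow_field_def m_def Let_def algebra_simps)
    qed
    have p2: "((\<lambda>y. snd (p (x, y))) has_real_derivative - m (x, y)) (at y)" for x y
    proof -
      have "((\<lambda>y. k x - y) has_real_derivative - 1) (at y)"
        using DERIV_diff[OF DERIV_const DERIV_ident] by simp
      note DERIV_chain2[OF ramp_DERIV[OF \<epsilon>] this] DERIV_chain2[OF step_DERIV[OF \<epsilon>] this]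
      then have "((\<lambda>y. \<theta>' x * ramp \<epsilon> (k x - y) + \<theta> x * (step \<epsilon> (k x - y) * k' x)) has_real_derivative
          \<theta>' x * (step \<epsilon> (k x - y) * - 1) + \<theta> x * (bump \<epsilon> (k x - y) * - 1 * k' x)) (at y)"
        by (intro DERIV_add DERIV_cmult DERIV_cmult_right)
      then show ?thesis
        by (simp add: p_def flow_field_def m_def Let_def algebra_simps)
    qed
    have cm: "continuous_on UNIV m"
    proof -
      have c: "continuous_on UNIV (\<lambda>z. f (fst z))" if "continuous_on UNIV f" for f :: "real \<Rightarrow> real"
        by (intro continuous_on_compose2[OF that] continuous_intros) auto
      show ?thesis
        unfolding m_def[abs_def] by (intro continuous_intros continuous_on_ramp c cont \<theta>(2) k(2))
    qed
    have "AE z in lebesgue. z \<in> Q \<longrightarrow> weak_gradient Q u z = g z"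
      unfolding g_def
      by (rule weak_gradient_AE_eq[OF Q(1) has_weak_gradient_subset[OF H1_weak_gradient(1)[OF \<Omega> u] Qsub]])
    then have ae: "AE z in lebesgue. indicator Q z *\<^sub>R (p z \<bullet> g z) = indicator Q z *\<^sub>R (p z \<bullet> weak_gradient Q u z)"
      by eventually_elim (auto simp: indicator_def)
    have "set_integrable lebesgue Q (\<lambda>z. p z \<bullet> weak_gradient Q u z)"
      by (rule L2_inner_set_integrable[OF L2_continuous_bounded[OF cp Q(2,3)] H1_weak_gradient(2)[OF Q(1) uQ]])
    then have "(LINT z:Q|lebesgue. p z \<bullet> g z) = (LINT z:Q|lebesgue. p z \<bullet> weak_gradient Q u z)"
      using intQ ae
      unfolding set_lebesgue_integral_def set_integrable_def
      by (intro integral_cong_AE) (rule borel_measurable_integrable, assumption)+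
    also have "\<dots> = - (LINT x:{a<..<b}|lebesgue. snd (p (x, 0)) * \<tau> x)"
      unfolding Q_def
      by (rule rectangle_divergence_free_trace[OF ab d p1 p2 cp cm _ _ _ trQ]) (simp_all add: p0)
    also have "(LINT x:{a<..<b}|lebesgue. snd (p (x, 0)) * \<tau> x) = (LINT x:{a<..<b}|lebesgue. r x * x)"
    proof -
      have supp: "x \<in> supp h" if "x \<in> {a<..<b}" for x
        using kh[OF x0(1), of x] that d closure_subset[of "{x. h x \<noteq> 0}"] by (auto simp: supp_def d_def)
      have ae: "AE x in lebesgue. indicator {a<..<b} x *\<^sub>R (snd (p (x, 0)) * \<tau> x) = indicator {a<..<b} x *\<^sub>R (r x * x)"
        using tr(2) by eventually_elim (use supp in \<open>auto simp: indicator_def p_def flow_field_def Let_def r_def\<close>)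
      have "continuous_on UNIV (\<lambda>x. r x * x)"
        unfolding r_def by (intro continuous_intros continuous_on_ramp cont \<theta>(2) k(2))
      then have "(\<lambda>x. indicator {a<..<b} x *\<^sub>R (r x * x)) \<in> borel_measurable lebesgue"
        by (intro borel_measurable_scaleR borel_measurable_indicator continuous_borel_measurable_lebesgue) auto
      moreover from this have "(\<lambda>x. indicator {a<..<b} x *\<^sub>R (snd (p (x, 0)) * \<tau> x)) \<in> borel_measurable lebesgue"
        by (rule borel_measurable_AE) (rule eventually_mono[OF ae], rule sym)
      ultimately show ?thesis
        unfolding set_lebesgue_integral_def using ae by (intro integral_cong_AE)
    qed
    also have "\<dots> = - integral {a..b} (\<lambda>x. \<theta> x * ramp \<epsilon> (k x))"
    proof -
      have cr: "continuous_on S r" for S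
        unfolding r_def[abs_def] by (intro continuous_intros continuous_on_ramp
          continuous_on_subset[OF cont(1)] continuous_on_subset[OF cont(2)]
          continuous_on_subset[OF \<theta>(2)] continuous_on_subset[OF k(2)] subset_UNIV)
      have c\<theta>: "continuous_on S (\<lambda>x. \<theta> x * ramp \<epsilon> (k x))" for S
        by (intro continuous_intros continuous_on_ramp
          continuous_on_subset[OF cont(1)] continuous_on_subset[OF cont(2)] subset_UNIV)
      have D: "((\<lambda>x. \<theta> x * ramp \<epsilon> (k x) * x) has_real_derivative r x * x + \<theta> x * ramp \<epsilon> (k x)) (at x)" for x
      proof -
        have "((\<lambda>x. \<theta> x * ramp \<epsilon> (k x)) has_real_derivative r x) (at x)"
          using DERIV_mult'[OF \<theta>(1) DERIV_chain2[OF ramp_DERIV[OF \<epsilon>] k(1)]]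
          by (simp add: r_def algebra_simps)
        from DERIV_mult'[OF this DERIV_ident] show ?thesis
          by (simp add: algebra_simps)
      qed
      have "((\<lambda>x. r x * x + \<theta> x * ramp \<epsilon> (k x)) has_integral
          \<theta> b * ramp \<epsilon> (k b) * b - \<theta> a * ramp \<epsilon> (k a) * a) {a..b}"
        by (rule has_integral_DERIV[OF D]) (use ab in simp)
      moreover have "\<theta> a = 0" "\<theta> b = 0" using \<theta>0[of a] \<theta>0[of b] by auto
      ultimately have "integral {a..b} (\<lambda>x. r x * x + \<theta> x * ramp \<epsilon> (k x)) = 0"
        by (simp add: integral_unique)
      moreover have "integral {a..b} (\<lambda>x. r x * x + \<theta> x * ramp \<epsilon> (k x))
          = integral {a..b} (\<lambda>x. r x * x) + integral {a..b} (\<lambda>x. \<theta> x * ramp \<epsilon> (k x))"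
        by (intro Henstock_Kurzweil_Integration.integral_add integrable_continuous_interval continuous_intros cr c\<theta>)
      moreover have "(LINT x:{a<..<b}|lebesgue. r x * x) = integral {a..b} (\<lambda>x. r x * x)"
        by (subst set_lebesgue_integral_eq_integral(2))
          (auto intro!: set_integrable_continuous_bounded continuous_intros cr simp: integral_open_interval_real)
      ultimately show ?thesis by simp
    qed
    finally show ?thesis using eq1 by simp
  qed
qed

section \<open>Lower bound for the elastic energy\<close>

lemma continuous_has_antiderivative:
  fixes f :: "real \<Rightarrow> real"
  assumes "continuous_on UNIV f"
  obtains F where "\<And>x. (F has_real_derivative f x) (at x)"
proof -
  have "\<exists>F. \<forall>x::real. -\<infinity> < ereal x \<longrightarrow> ereal x < \<infinity> \<longrightarrow> (F has_vector_derivative f x) (at x)"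
    using assms by (intro einterval_antiderivative) (auto simp: continuous_on_eq_continuous_at)
  then show ?thesis
    using that by (auto simp: has_real_derivative_iff_has_vector_derivative)
qed

text \<open>For an increasing bounded \<open>P\<close> the right-hand side is at most \<open>s\<close> times the total increase of
  \<open>P\<close>, and for a \<open>P\<close> that is constant on each of the two intervals of length \<open>s\<close> it is exactly that. Thus integrals of difference
  quotients are controlled without interchanging integrals.\<close>

lemma integral_translation_difference:
  fixes P :: "real \<Rightarrow> real"
  assumes cont: "continuous_on {a..b + s} P" and ab: "a \<le> b" "0 \<le> s"
  shows "integral {a..b} (\<lambda>x. P (x + s) - P x) = integral {b..b + s} P - integral {a..a + s} P"
proof -
  have int: "P integrable_on {c..d}" if "a \<le> c" "d \<le> b + s" for c d
    using that by (intro integrable_continuous_interval continuous_on_subset[OF cont]) auto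
  have shift: "integral {a..b} (\<lambda>x. P (x + s)) = integral {a + s..b + s} P"
    using integral_shift[of a s b P] continuous_on_subset[OF cont, of "{a + s..b + s}"] ab by (simp add: o_def)
  have ints: "(\<lambda>x. P (x + s)) integrable_on {a..b}"
    by (intro integrable_continuous_interval continuous_on_compose2[OF cont] continuous_intros) (use ab in auto)
  have "integral {a..b} (\<lambda>x. P (x + s) - P x) = integral {a + s..b + s} P - integral {a..b} P"
    using ints int[of a b] ab by (simp add: Henstock_Kurzweil_Integration.integral_diff shift)
  also have "\<dots> = integral {b..b + s} P - integral {a..a + s} P"
    using Henstock_Kurzweil_Integration.integral_combine[of a b "b + s" P]
      Henstock_Kurzweil_Integration.integral_combine[of a "a + s" "b + s" P] int[of a "b + s"] ab by simp
  finally show ?thesis .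
qed

lemma integral_interval_eq_UNIV:
  fixes f :: "real \<Rightarrow> real"
  assumes "\<And>x. x \<notin> S \<Longrightarrow> f x = 0"
  shows "integral S f = integral UNIV f"
  unfolding integral_restrict_UNIV[of S f, symmetric]
  by (rule Henstock_Kurzweil_Integration.integral_cong) (use assms in auto)

text \<open>The duality bound for a regular profile \<open>k\<close> below \<open>h\<close>. The hypothesis \<open>k x \<le> h y\<close> for nearby
  \<open>x\<close> and \<open>y\<close> is what allows rectangles of a fixed width \<open>\<eta>\<close> to fit between \<open>k\<close> and \<open>h\<close>. The flux of the
  field \<open>P\<close> is the integral of \<open>ramp \<epsilon> (k x)\<close>, its squared norm integrates to at most
  \<open>\<integral> ramp \<epsilon> (k x) (1 + k'\<^sup>2)\<close>, and \<open>2 P \<bullet> g - |P|\<^sup>2 \<le> |g|\<^sup>2\<close>.\<close>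

lemma elastic_energy_ge:
  fixes h k k' :: "real \<Rightarrow> real"
  assumes h: "continuous_on UNIV h"
    and u: "u \<in> H1 (subgraph h)"
    and tr: "bottom_trace h u \<tau>" "AE x in lebesgue. x \<in> supp h \<longrightarrow> \<tau> x = x"
    and k: "\<And>x. (k has_real_derivative k' x) (at x)" "continuous_on UNIV k'" "\<And>x. 0 \<le> k x"
    and R: "R > 0" "\<And>x. x \<notin> {-R..R} \<Longrightarrow> k x = 0 \<and> k' x = 0"
    and \<eta>: "\<eta> > 0" "\<And>x y. \<bar>x - y\<bar> \<le> \<eta> \<Longrightarrow> k x \<le> h y"
    and D: "\<And>x. k x \<le> D"
  shows "integral {-R..R} k - D * integral {-R..R} (\<lambda>x. (k' x)\<^sup>2) \<le> elastic_energy u h"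
proof (rule field_le_epsilon)
  fix e :: real assume e: "e > 0"
  \<comment> \<open>Smoothing the positive part costs at most \<open>\<epsilon>\<close> per unit length of \<open>[-R, R]\<close>.\<close>
  define \<epsilon> where "\<epsilon> = e / (2 * R)"
  have \<epsilon>: "\<epsilon> > 0" using e R by (simp add: \<epsilon>_def)
  define \<Omega> where "\<Omega> = subgraph h"
  define g where "g = weak_gradient \<Omega> u"
  have \<Omega>: "open \<Omega>" "\<Omega> \<in> sets lebesgue"
    using open_subgraph[OF h] by (auto simp: \<Omega>_def)
  have g: "L2 \<Omega> g"
    unfolding g_def using H1_weak_gradient(2)[OF \<Omega>(1)] u by (simp add: \<Omega>_def)
  have D0: "0 \<le> D" using k(3)[of 0] D[of 0] by linarith
  have ck: "continuous_on S k" "continuous_on S k'" for S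
    using k(1) continuous_on_subset[OF k(2)] by (auto intro!: continuous_at_imp_continuous_on DERIV_isCont)
  \<comment> \<open>The pieces of the partition have length \<open>2 \<eta>' = \<eta>\<close>, and \<open>2 N\<close> of them cover \<open>[-R, R]\<close>.\<close>
  define \<eta>' where "\<eta>' = \<eta> / 2"
  have \<eta>': "\<eta>' > 0" using \<eta> by (simp add: \<eta>'_def)
  obtain N :: nat where N: "R / \<eta>' + 1 \<le> real N"
    using real_arch_simple by blast
  have RN: "R \<le> \<eta>' * (real N - 1)"
    using N \<eta>' by (simp add: field_simps)
  define p where "p i = flow_field \<epsilon> (partition_piece \<eta>' N i) (partition_piece_deriv \<eta>' N i) k k'" for i
  define P where "P z = (step \<epsilon> (k (fst z) - snd z), step \<epsilon> (k (fst z) - snd z) * k' (fst z))" for z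
  have strip: "set_integrable lebesgue \<Omega> (\<lambda>z. p i z \<bullet> g z)"
    "(LINT z:\<Omega>|lebesgue. p i z \<bullet> g z) = integral {-R..R} (\<lambda>x. partition_piece \<eta>' N i x * ramp \<epsilon> (k x))" for i
  proof -
    let ?a = "\<eta>' * (real i - real N)" and ?b = "\<eta>' * (real i - real N) + 2 * \<eta>'"
    have ab: "?a < ?b" using \<eta>' by simp
    have kh: "k x \<le> h y" if "x \<in> {?a..?b}" "y \<in> {?a..?b}" for x y
      using that by (intro \<eta>(2)) (auto simp: \<eta>'_def)
    note flux = strip_flux[OF ab \<epsilon> partition_piece_DERIV[OF \<eta>'] continuous_partition_piece_deriv
        partition_piece_eq_0[OF \<eta>'] k kh h u tr]
    show "set_integrable lebesgue \<Omega> (\<lambda>z. p i z \<bullet> g z)"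
      using flux(1) by (simp add: p_def g_def \<Omega>_def)
    have "(LINT z:\<Omega>|lebesgue. p i z \<bullet> g z) = integral {?a..?b} (\<lambda>x. partition_piece \<eta>' N i x * ramp \<epsilon> (k x))"
      using flux(2) by (simp add: p_def g_def \<Omega>_def)
    also have "\<dots> = integral UNIV (\<lambda>x. partition_piece \<eta>' N i x * ramp \<epsilon> (k x))"
      using partition_piece_eq_0[OF \<eta>'] by (intro integral_interval_eq_UNIV) auto
    also have "\<dots> = integral {-R..R} (\<lambda>x. partition_piece \<eta>' N i x * ramp \<epsilon> (k x))"
      using R(2) \<epsilon> by (intro integral_interval_eq_UNIV[symmetric]) (auto simp: ramp_nonpos)
    finally show "(LINT z:\<Omega>|lebesgue. p i z \<bullet> g z) = integral {-R..R} (\<lambda>x. partition_piece \<eta>' N i x * ramp \<epsilon> (k x))" .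
  qed
  have sum_p: "(\<Sum>i<2 * N. p i z) = P z" if "z \<in> \<Omega>" for z
  proof (cases "fst z \<in> {-R..R}")
    case True
    then have "\<bar>fst z\<bar> \<le> \<eta>' * (real N - 1)" using RN by auto
    note part = sum_partition_piece[OF \<eta>' this]
    have "(\<Sum>i<2 * N. p i z) = ((\<Sum>i<2 * N. partition_piece \<eta>' N i (fst z)) * step \<epsilon> (k (fst z) - snd z),
        (\<Sum>i<2 * N. partition_piece_deriv \<eta>' N i (fst z)) * ramp \<epsilon> (k (fst z) - snd z) +
        (\<Sum>i<2 * N. partition_piece \<eta>' N i (fst z)) * (step \<epsilon> (k (fst z) - snd z) * k' (fst z)))"
      unfolding p_def flow_field_def Let_def
      by (simp add: prod_eq_iff fst_sum snd_sum sum.distrib sum_distrib_right)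
    then show ?thesis
      unfolding part P_def by simp
  next
    case False
    have "0 < snd z" using that by (auto simp: \<Omega>_def subgraph_def)
    with False R(2)[of "fst z"] have "k (fst z) \<le> snd z" by auto
    then have "p i z = 0" for i
      unfolding p_def using flow_field_eq_0[OF \<epsilon>, of k "fst z" "snd z"] by simp
    moreover have "P z = 0"
      using \<open>k (fst z) \<le> snd z\<close> \<epsilon> by (simp add: P_def ramp_nonpos zero_prod_def)
    ultimately show ?thesis by simp
  qed
  have Pg_eq: "indicator \<Omega> z *\<^sub>R (P z \<bullet> g z) = indicator \<Omega> z *\<^sub>R (\<Sum>i<2 * N. p i z \<bullet> g z)" for z
    using sum_p[of z] by (cases "z \<in> \<Omega>") (auto simp: inner_sum_left[symmetric])
  have Pg_int: "set_integrable lebesgue \<Omega> (\<lambda>z. P z \<bullet> g z)"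
    unfolding set_integrable_def Pg_eq scaleR_sum_right
    by (rule Bochner_Integration.integrable_sum) (use strip(1) in \<open>simp add: set_integrable_def\<close>)
  have Pg: "(LINT z:\<Omega>|lebesgue. P z \<bullet> g z) = integral {-R..R} (\<lambda>x. ramp \<epsilon> (k x))"
  proof -
    have "(LINT z:\<Omega>|lebesgue. P z \<bullet> g z) = (\<Sum>i<2 * N. LINT z:\<Omega>|lebesgue. p i z \<bullet> g z)"
      unfolding set_lebesgue_integral_def Pg_eq scaleR_sum_right
      by (rule Bochner_Integration.integral_sum) (use strip(1) in \<open>simp add: set_integrable_def\<close>)
    also have "\<dots> = (\<Sum>i<2 * N. integral {-R..R} (\<lambda>x. partition_piece \<eta>' N i x * ramp \<epsilon> (k x)))"
      by (simp add: strip)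
    also have "\<dots> = integral {-R..R} (\<lambda>x. \<Sum>i<2 * N. partition_piece \<eta>' N i x * ramp \<epsilon> (k x))"
    proof (rule Henstock_Kurzweil_Integration.integral_sum[symmetric])
      fix i
      have "continuous_on {-R..R} (partition_piece \<eta>' N i)"
        using partition_piece_DERIV[OF \<eta>'] by (auto intro!: continuous_at_imp_continuous_on DERIV_isCont)
      then show "(\<lambda>x. partition_piece \<eta>' N i x * ramp \<epsilon> (k x)) integrable_on {-R..R}"
        by (intro integrable_continuous_interval continuous_on_mult continuous_on_ramp ck)
    qed simp
    also have "\<dots> = integral {-R..R} (\<lambda>x. ramp \<epsilon> (k x))"
    proof (rule Henstock_Kurzweil_Integration.integral_cong)
      fix x assume "x \<in> {-R..R}"
      then have "\<bar>x\<bar> \<le> \<eta>' * (real N - 1)" using RN by auto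
      from sum_partition_piece(1)[OF \<eta>' this]
      show "(\<Sum>i<2 * N. partition_piece \<eta>' N i x * ramp \<epsilon> (k x)) = ramp \<epsilon> (k x)"
        by (simp add: sum_distrib_right[symmetric])
    qed
    finally show ?thesis .
  qed
  let ?n = "\<lambda>z. (norm (P z))\<^sup>2"
  have n_eq: "?n z = (step \<epsilon> (k (fst z) - snd z))\<^sup>2 * (1 + (k' (fst z))\<^sup>2)" for z
    by (simp add: P_def norm_Pair power_mult_distrib algebra_simps)
  have cn: "continuous_on S ?n" for S
  proof -
    have c: "continuous_on S (\<lambda>z. f (fst z))" if "continuous_on UNIV f" for f :: "real \<Rightarrow> real"
      by (intro continuous_on_compose2[OF that] continuous_intros) auto
    show ?thesis
      unfolding n_eq by (intro continuous_intros continuous_on_ramp c ck)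
  qed
  let ?B = "cbox (-R, 0) (R, D)"
  have nB: "set_integrable lebesgue ?B ?n"
    by (intro absolutely_integrable_continuous cn)
  have n0: "?n z = 0" if "z \<in> \<Omega>" "z \<notin> ?B" for z
  proof -
    have "0 < snd z" using that by (auto simp: \<Omega>_def subgraph_def)
    moreover have "fst z \<notin> {-R..R} \<or> D < snd z"
      using that calculation by (cases z) (auto simp: cbox_Pair_eq)
    ultimately have "k (fst z) \<le> snd z"
      using R(2)[of "fst z"] D[of "fst z"] by force
    then show ?thesis
      unfolding n_eq using \<epsilon> by (simp add: ramp_nonpos)
  qed
  have ind_le: "indicator \<Omega> z *\<^sub>R ?n z \<le> indicator ?B z *\<^sub>R ?n z" for z
    using n0[of z] by (auto simp: indicator_def)
  have n_int: "set_integrable lebesgue \<Omega> ?n"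
    unfolding set_integrable_def
  proof (rule Bochner_Integration.integrable_bound[OF nB[unfolded set_integrable_def]])
    show "(\<lambda>z. indicat_real \<Omega> z *\<^sub>R ?n z) \<in> borel_measurable lebesgue"
      by (intro borel_measurable_scaleR borel_measurable_indicator \<Omega>(2) continuous_borel_measurable_lebesgue cn)
    show "AE z in lebesgue. norm (indicat_real \<Omega> z *\<^sub>R ?n z) \<le> norm (indicat_real ?B z *\<^sub>R ?n z)"
      using ind_le by (intro AE_I2) (auto simp: indicator_def)
  qed
  have n_le: "(LINT z:\<Omega>|lebesgue. ?n z) \<le> integral {-R..R} (\<lambda>x. ramp \<epsilon> (k x) * (1 + (k' x)\<^sup>2))"
  proof -
    have "(LINT z:\<Omega>|lebesgue. ?n z) \<le> (LINT z:?B|lebesgue. ?n z)"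
      unfolding set_lebesgue_integral_def
      by (rule integral_mono) (use n_int nB ind_le in \<open>simp_all only: set_integrable_def\<close>)
    also have "\<dots> = integral ?B ?n"
      by (rule set_lebesgue_integral_eq_integral(2)[OF nB])
    also have "\<dots> = integral (cbox (-R) R) (\<lambda>x. integral (cbox 0 D) (\<lambda>y. ?n (x, y)))"
      by (rule integral_prod_continuous[OF cn])
    also have "\<dots> = integral {-R..R} (\<lambda>x. integral {0..D} (\<lambda>y. (step \<epsilon> (k x - y))\<^sup>2) * (1 + (k' x)\<^sup>2))"
      by (simp add: n_eq)
    also have "\<dots> \<le> integral {-R..R} (\<lambda>x. ramp \<epsilon> (k x) * (1 + (k' x)\<^sup>2))"
    proof (rule integral_le)
      have "(\<lambda>x. integral (cbox 0 D) (\<lambda>y. ?n (x, y))) integrable_on cbox (-R) R"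
        by (rule integral_integrable_2dim[OF cn])
      then show "(\<lambda>x. integral {0..D} (\<lambda>y. (step \<epsilon> (k x - y))\<^sup>2) * (1 + (k' x)\<^sup>2)) integrable_on {-R..R}"
        by (simp add: n_eq)
      show "(\<lambda>x. ramp \<epsilon> (k x) * (1 + (k' x)\<^sup>2)) integrable_on {-R..R}"
        by (intro integrable_continuous_interval continuous_intros continuous_on_ramp ck)
      fix x
      have cs: "continuous_on {0..D} (\<lambda>y. step \<epsilon> (k x - y))"
        by (intro continuous_on_ramp continuous_intros)
      have "integral {0..D} (\<lambda>y. (step \<epsilon> (k x - y))\<^sup>2) \<le> integral {0..D} (\<lambda>y. step \<epsilon> (k x - y))"
      proof (rule integral_le)
        show "(\<lambda>y. (step \<epsilon> (k x - y))\<^sup>2) integrable_on {0..D}" "(\<lambda>y. step \<epsilon> (k x - y)) integrable_on {0..D}"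
          by (intro integrable_continuous_interval continuous_intros cs)+
        show "(step \<epsilon> (k x - y))\<^sup>2 \<le> step \<epsilon> (k x - y)" for y
          using step_bounds[of \<epsilon> "k x - y"] by (simp add: power2_eq_square mult_left_le_one_le)
      qed
      also have "((\<lambda>y. step \<epsilon> (k x - y)) has_integral - ramp \<epsilon> (k x - D) - - ramp \<epsilon> (k x - 0)) {0..D}"
      proof (rule has_integral_DERIV[OF _ D0])
        fix y
        have "((\<lambda>y. k x - y) has_real_derivative - 1) (at y)"
          using DERIV_diff[OF DERIV_const DERIV_ident] by simp
        from DERIV_minus[OF DERIV_chain2[OF ramp_DERIV[OF \<epsilon>] this]]
        show "((\<lambda>y. - ramp \<epsilon> (k x - y)) has_real_derivative step \<epsilon> (k x - y)) (at y)"
          by simp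
      qed
      then have "integral {0..D} (\<lambda>y. step \<epsilon> (k x - y)) = ramp \<epsilon> (k x)"
        using ramp_nonpos(3)[OF \<epsilon>, of "k x - D"] D[of x] by (simp add: integral_unique)
      finally show "integral {0..D} (\<lambda>y. (step \<epsilon> (k x - y))\<^sup>2) * (1 + (k' x)\<^sup>2) \<le> ramp \<epsilon> (k x) * (1 + (k' x)\<^sup>2)"
        by (intro mult_right_mono) auto
    qed
    finally show ?thesis .
  qed
  have int: "(\<lambda>x. ramp \<epsilon> (k x)) integrable_on {-R..R}" "(\<lambda>x. ramp \<epsilon> (k x) * (1 + (k' x)\<^sup>2)) integrable_on {-R..R}"
      "k integrable_on {-R..R}" "(\<lambda>x. (k' x)\<^sup>2) integrable_on {-R..R}"
    by (intro integrable_continuous_interval continuous_intros continuous_on_ramp ck)+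
  have "integral {-R..R} k - D * integral {-R..R} (\<lambda>x. (k' x)\<^sup>2) - e
      = integral {-R..R} (\<lambda>x. k x - D * (k' x)\<^sup>2 - \<epsilon>)"
  proof -
    have "((\<lambda>x. k x - D * (k' x)\<^sup>2 - \<epsilon>) has_integral
        integral {-R..R} k - D * integral {-R..R} (\<lambda>x. (k' x)\<^sup>2) - (R - - R) *\<^sub>R \<epsilon>) {-R..R}"
      using R(1) has_integral_const_real[of \<epsilon> "- R" R]
      by (intro has_integral_diff has_integral_mult_right integrable_integral int) auto
    moreover have "(R - - R) *\<^sub>R \<epsilon> = e" using R(1) by (simp add: \<epsilon>_def)
    ultimately show ?thesis by (simp add: integral_unique)
  qed
  also have "\<dots> \<le> integral {-R..R} (\<lambda>x. 2 * ramp \<epsilon> (k x) - ramp \<epsilon> (k x) * (1 + (k' x)\<^sup>2))"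
  proof (rule integral_le)
    show "(\<lambda>x. k x - D * (k' x)\<^sup>2 - \<epsilon>) integrable_on {-R..R}"
      "(\<lambda>x. 2 * ramp \<epsilon> (k x) - ramp \<epsilon> (k x) * (1 + (k' x)\<^sup>2)) integrable_on {-R..R}"
      by (intro integrable_continuous_interval continuous_intros continuous_on_ramp ck)+
    fix x
    have "ramp \<epsilon> (k x) * (k' x)\<^sup>2 \<le> D * (k' x)\<^sup>2"
      using ramp_bounds(3)[OF \<epsilon> k(3)[of x]] D[of x] by (intro mult_right_mono) auto
    then show "k x - D * (k' x)\<^sup>2 - \<epsilon> \<le> 2 * ramp \<epsilon> (k x) - ramp \<epsilon> (k x) * (1 + (k' x)\<^sup>2)"
      using ramp_bounds(2)[OF \<epsilon>, of "k x"] by (simp add: algebra_simps)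
  qed
  also have "\<dots> = 2 * integral {-R..R} (\<lambda>x. ramp \<epsilon> (k x)) - integral {-R..R} (\<lambda>x. ramp \<epsilon> (k x) * (1 + (k' x)\<^sup>2))"
    using int by (simp add: Henstock_Kurzweil_Integration.integral_diff)
  also have "\<dots> \<le> 2 * (LINT z:\<Omega>|lebesgue. P z \<bullet> g z) - (LINT z:\<Omega>|lebesgue. ?n z)"
    using n_le Pg by simp
  also have "\<dots> = (LINT z:\<Omega>|lebesgue. 2 * (P z \<bullet> g z) - ?n z)"
    using Pg_int n_int by (simp add: set_integral_diff(2))
  also have "\<dots> \<le> (LINT z:\<Omega>|lebesgue. (norm (g z))\<^sup>2)"
  proof (rule set_integral_mono)
    show "set_integrable lebesgue \<Omega> (\<lambda>z. 2 * (P z \<bullet> g z) - ?n z)"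
      using Pg_int n_int by (intro set_integral_diff(1) set_integrable_mult_right) auto
    show "set_integrable lebesgue \<Omega> (\<lambda>z. (norm (g z))\<^sup>2)"
      using g by (simp add: L2_def)
    fix z
    have "0 \<le> (norm (g z - P z))\<^sup>2" by simp
    then show "2 * (P z \<bullet> g z) - ?n z \<le> (norm (g z))\<^sup>2"
      by (simp add: power2_norm_eq_inner inner_diff inner_commute)
  qed
  also have "\<dots> = elastic_energy u h"
    by (simp add: elastic_energy_def g_def \<Omega>_def)
  finally show "integral {-R..R} k - D * integral {-R..R} (\<lambda>x. (k' x)\<^sup>2) \<le> elastic_energy u h + e"
    by simp
qed

context
  fixes h :: "real \<Rightarrow> real" and V :: real
  assumes hH1: "h \<in> H1 UNIV" and hc: "continuous_on UNIV h" and h0: "\<And>x. 0 \<le> h x"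
    and hV: "has_bochner_integral lebesgue h V"
begin

lemma weak_derivative_square_integrable:
  "(\<lambda>x. (weak_gradient UNIV h x)\<^sup>2) integrable_on UNIV"
  "(\<lambda>x. (weak_gradient UNIV h x)\<^sup>2) integrable_on {a..b}"
  "surface_energy h = integral UNIV (\<lambda>x. (weak_gradient UNIV h x)\<^sup>2)"
proof -
  have "L2 UNIV (weak_gradient UNIV h)"
    using H1_weak_gradient(2)[OF open_UNIV hH1] .
  then have int: "set_integrable lebesgue UNIV (\<lambda>x. (weak_gradient UNIV h x)\<^sup>2)"
    by (simp add: L2_def)
  then show "(\<lambda>x. (weak_gradient UNIV h x)\<^sup>2) integrable_on UNIV"
    by (rule set_lebesgue_integral_eq_integral(1))
  show "(\<lambda>x. (weak_gradient UNIV h x)\<^sup>2) integrable_on {a..b}"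
    by (rule set_lebesgue_integral_eq_integral(1)[OF set_integrable_subset[OF int]]) auto
  show "surface_energy h = integral UNIV (\<lambda>x. (weak_gradient UNIV h x)\<^sup>2)"
    using set_lebesgue_integral_eq_integral(2)[OF int] by (simp add: surface_energy_def set_lebesgue_integral_def)
qed

lemma surface_energy_nonneg: "0 \<le> surface_energy h"
  unfolding surface_energy_def by simp

lemma local_surface_energy_bounds:
  "0 \<le> integral {a..b} (\<lambda>x. (weak_gradient UNIV h x)\<^sup>2)"
  "integral {a..b} (\<lambda>x. (weak_gradient UNIV h x)\<^sup>2) \<le> surface_energy h"
  unfolding weak_derivative_square_integrable(3)
  by (auto intro!: Henstock_Kurzweil_Integration.integral_nonneg integral_subset_le weak_derivative_square_integrable)

lemma square_increment_le:
  assumes "a < b"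
  shows "(h b - h a)\<^sup>2 \<le> (b - a) * integral {a..b} (\<lambda>x. (weak_gradient UNIV h x)\<^sup>2)"
proof -
  have "(weak_gradient UNIV h has_integral h b - h a) {a..b}"
    by (rule continuous_weak_derivative_FTC[OF H1_weak_gradient(1)[OF open_UNIV hH1] hc assms])
  then show ?thesis
    using integral_Cauchy_Schwarz_interval[of "weak_gradient UNIV h" a b] weak_derivative_square_integrable(2) assms
    by (auto simp: integral_unique has_integral_integrable)
qed

lemma increment_le: "\<bar>h x - h y\<bar> \<le> sqrt (surface_energy h * \<bar>x - y\<bar>)"
proof -
  have *: "\<bar>h b - h a\<bar> \<le> sqrt (surface_energy h * (b - a))" if "a < b" for a b
  proof (rule real_le_rsqrt)
    have "(h b - h a)\<^sup>2 \<le> (b - a) * integral {a..b} (\<lambda>x. (weak_gradient UNIV h x)\<^sup>2)"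
      by (rule square_increment_le[OF that])
    also have "\<dots> \<le> (b - a) * surface_energy h"
      using that by (intro mult_left_mono local_surface_energy_bounds) auto
    finally show "\<bar>h b - h a\<bar>\<^sup>2 \<le> surface_energy h * (b - a)" by (simp add: mult.commute)
  qed
  show ?thesis
    using *[of x y] *[of y x] by (cases x y rule: linorder_cases) (auto simp: abs_minus_commute)
qed

lemma volume_integral:
  "integral UNIV h = V" "h integrable_on UNIV" "integral {a..b} h \<le> V"
proof -
  have int: "integrable lebesgue h" "(\<integral>x. h x \<partial>lebesgue) = V"
    using hV by (simp_all add: has_bochner_integral_iff)
  show V: "integral UNIV h = V"
    using int integral_lebesgue by metis
  show U: "h integrable_on UNIV"
    by (rule integrable_on_lebesgue[OF int(1)])
  have "integral {a..b} h \<le> integral UNIV h"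
    by (intro integral_subset_le U h0 integrable_continuous_interval continuous_on_subset[OF hc]) (auto simp: h0)
  then show "integral {a..b} h \<le> V" by (simp add: V)
qed

lemma integral_h_ge:
  assumes "0 \<le> r" and "\<And>t. x \<le> t \<Longrightarrow> t \<le> x + r \<Longrightarrow> c \<le> h t"
  shows "r * c \<le> integral {x..x + r} h"
proof -
  have "integral {x..x + r} (\<lambda>_. c) \<le> integral {x..x + r} h"
    using assms by (intro integral_le integrable_continuous_interval continuous_on_subset[OF hc]) auto
  then show ?thesis using assms(1) by simp
qed

text \<open>By the Hoelder estimate \<open>h\<close> loses at most \<open>sqrt S\<close> over a unit interval, on which its integral
  is at most \<open>V\<close>.\<close>

lemma height_le: "h x \<le> V + sqrt (surface_energy h)"
proof -
  have "h x - sqrt (surface_energy h) \<le> h t" if "x \<le> t" "t \<le> x + 1" for t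
  proof -
    have "sqrt (surface_energy h * \<bar>x - t\<bar>) \<le> sqrt (surface_energy h * 1)"
      using that surface_energy_nonneg by (intro real_sqrt_le_mono mult_left_mono) auto
    then show ?thesis
      using increment_le[of x t] unfolding mult_1_right by linarith
  qed
  from integral_h_ge[of 1 x, OF _ this] have "h x - sqrt (surface_energy h) \<le> integral {x..x + 1} h"
    by simp
  then show ?thesis
    using volume_integral(3)[of x "x + 1"] by linarith
qed

text \<open>By the Hoelder estimate, each point where \<open>h > \<delta>\<close> starts an interval of a fixed length on which
  \<open>h \<ge> \<delta> / 2\<close>. Far out there is not enough volume left for such an interval.\<close>

lemma h_vanishes_at_infinity:
  assumes \<delta>: "\<delta> > 0"
  obtains R where "R > 0" "\<And>x. R \<le> \<bar>x\<bar> \<Longrightarrow> h x \<le> \<delta>"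
proof -
  let ?S = "surface_energy h"
  \<comment> \<open>Over a distance \<open>r\<close> the function \<open>h\<close> oscillates by at most \<open>\<delta> / 2\<close>. The summand \<open>1\<close> avoids
    a division by zero, and \<open>r \<le> 1\<close> keeps the interval away from \<open>[-n, n]\<close>.\<close>
  define r where "r = min 1 (\<delta>\<^sup>2 / (4 * (?S + 1)))"
  have r: "0 < r" "r \<le> 1" "?S * r \<le> (\<delta> / 2)\<^sup>2"
  proof -
    show "0 < r" "r \<le> 1" using \<delta> surface_energy_nonneg by (auto simp: r_def)
    have "?S * r \<le> (?S + 1) * (\<delta>\<^sup>2 / (4 * (?S + 1)))"
      using surface_energy_nonneg \<open>0 < r\<close> by (intro mult_mono) (auto simp: r_def)
    also have "\<dots> = (\<delta> / 2)\<^sup>2"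
      using surface_energy_nonneg by (simp add: field_simps power2_eq_square)
    finally show "?S * r \<le> (\<delta> / 2)\<^sup>2" .
  qed
  have big: "r * (\<delta> / 2) \<le> integral {x..x + r} h" if "\<delta> < h x" for x
  proof (rule integral_h_ge)
    fix t assume t: "x \<le> t" "t \<le> x + r"
    have "?S * \<bar>x - t\<bar> \<le> ?S * r"
      using t surface_energy_nonneg by (intro mult_left_mono) auto
    then have "sqrt (?S * \<bar>x - t\<bar>) \<le> sqrt ((\<delta> / 2)\<^sup>2)"
      using r(3) by (intro real_sqrt_le_mono) linarith
    also have "\<dots> = \<delta> / 2" using \<delta> by simp
    finally show "\<delta> / 2 \<le> h t"
      using increment_le[of x t] that by linarith
  qed (use r in auto)
  have hint: "h integrable_on {a..b}" for a b
    by (intro integrable_continuous_interval continuous_on_subset[OF hc]) auto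
  have combine: "integral {a..b} h + integral {c..d} h \<le> V" if "a \<le> b" "b \<le> c" "c \<le> d" for a b c d
  proof -
    have "integral {a..b} h + integral {b..d} h = integral {a..d} h"
      using that hint by (intro Henstock_Kurzweil_Integration.integral_combine) auto
    moreover have "integral {b..c} h + integral {c..d} h = integral {b..d} h"
      using that hint by (intro Henstock_Kurzweil_Integration.integral_combine) auto
    moreover have "0 \<le> integral {b..c} h"
      using hint h0 by (intro Henstock_Kurzweil_Integration.integral_nonneg) auto
    ultimately show ?thesis using volume_integral(3)[of a d] by linarith
  qed
  have "(\<lambda>n::nat. LINT x:{- real n..real n}|lebesgue. h x) \<longlonglongrightarrow> (LINT x:(\<Union>n::nat. {- real n..real n})|lebesgue. h x)"
  proof (rule set_integral_cont_up)
    show "incseq (\<lambda>n::nat. {- real n..real n})" by (auto simp: incseq_def)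
    have "(\<Union>n::nat. {- real n..real n}) \<in> sets lebesgue" by (rule sets.countable_UN) auto
    then show "set_integrable lebesgue (\<Union>n::nat. {- real n..real n}) h"
      using hV unfolding set_integrable_def
      by (intro integrable_mult_indicator) (auto simp: has_bochner_integral_iff)
  qed auto
  moreover have "(\<Union>n::nat. {- real n..real n}) = UNIV"
  proof -
    have "\<exists>n::nat. - real n \<le> x \<and> x \<le> real n" for x
    proof -
      obtain n :: nat where "\<bar>x\<bar> \<le> real n" using real_arch_simple by blast
      then show ?thesis by (intro exI[of _ n]) linarith
    qed
    then show ?thesis by auto
  qed
  ultimately have "(\<lambda>n::nat. LINT x:{- real n..real n}|lebesgue. h x) \<longlonglongrightarrow> V"
    using hV by (simp add: set_lebesgue_integral_def has_bochner_integral_iff)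
  moreover have "V - r * (\<delta> / 2) < V" using r(1) \<delta> by simp
  ultimately have "\<forall>\<^sub>F n::nat in sequentially. V - r * (\<delta> / 2) < (LINT x:{- real n..real n}|lebesgue. h x)"
    by (rule order_tendstoD(1))
  then obtain n :: nat where "V - r * (\<delta> / 2) < (LINT x:{- real n..real n}|lebesgue. h x)"
    by (auto simp: eventually_sequentially)
  also have "(LINT x:{- real n..real n}|lebesgue. h x) = integral {- real n..real n} h"
    by (intro set_lebesgue_integral_eq_integral(2) absolutely_integrable_continuous_real continuous_on_subset[OF hc]) auto
  finally have n: "V - r * (\<delta> / 2) < integral {- real n..real n} h" .
  show ?thesis
  proof (rule that)
    show "0 < real n + 1" by simp
    fix x assume x: "real n + 1 \<le> \<bar>x\<bar>"
    show "h x \<le> \<delta>"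
    proof (rule ccontr)
      assume "\<not> h x \<le> \<delta>"
      then have 1: "r * (\<delta> / 2) \<le> integral {x..x + r} h" by (intro big) simp
      consider "real n \<le> x" | "x + r \<le> - real n"
        using x r(2) by linarith
      then have "integral {- real n..real n} h + integral {x..x + r} h \<le> V"
      proof cases
        case 1
        then show ?thesis using r by (intro combine) auto
      next
        case 2
        then have "integral {x..x + r} h + integral {- real n..real n} h \<le> V"
          using r by (intro combine) auto
        then show ?thesis by simp
      qed
      with 1 n show False by linarith
    qed
  qed
qed

text \<open>The profile \<open>k(x)\<close> is the average of \<open>max 0 (h - \<delta>)\<close> over \<open>[x, x + s]\<close>. It is continuously
  differentiable and has compact support, since \<open>h\<close> vanishes at infinity. It has the same integral as
  \<open>max 0 (h - \<delta>)\<close>, and a Dirichlet integral of at most that of \<open>h\<close>. Lowering \<open>h\<close> by \<open>\<delta>\<close> leaves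
  room for the oscillation of \<open>h\<close> over distances up to \<open>2 s\<close>.\<close>

lemma elastic_energy_ge_truncated:
  assumes u: "u \<in> H1 (subgraph h)"
    and tr: "bottom_trace h u \<tau>" "AE x in lebesgue. x \<in> supp h \<longrightarrow> \<tau> x = x"
    and D: "\<And>x. h x \<le> D" and \<delta>: "\<delta> > 0"
  shows "(\<integral>x. max 0 (h x - \<delta>) \<partial>lebesgue) - D * surface_energy h \<le> elastic_energy u h"
proof -
  let ?S = "surface_energy h"
  let ?g = "weak_gradient UNIV h"
  have D0: "0 \<le> D" using h0[of 0] D[of 0] by linarith
  define f where "f x = max 0 (h x - \<delta>)" for x
  have cf: "continuous_on A f" for A
    unfolding f_def by (intro continuous_intros continuous_on_subset[OF hc]) auto
  obtain R where R: "R > 0" "\<And>x. R \<le> \<bar>x\<bar> \<Longrightarrow> h x \<le> \<delta>"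
    using h_vanishes_at_infinity[OF \<delta>] by blast
  then have fR: "f x = 0" if "R \<le> \<bar>x\<bar>" for x
    using that by (simp add: f_def)
  \<comment> \<open>Over a distance \<open>2 s\<close> the function \<open>h\<close> oscillates by at most \<open>\<delta>\<close>.\<close>
  define s where "s = \<delta>\<^sup>2 / (2 * (?S + 1))"
  have s: "0 < s" "?S * (2 * s) \<le> \<delta>\<^sup>2"
  proof -
    show "0 < s" using \<delta> surface_energy_nonneg by (simp add: s_def)
    have "?S * (2 * s) \<le> (?S + 1) * (2 * s)"
      using \<open>0 < s\<close> by (intro mult_right_mono) auto
    also have "\<dots> = \<delta>\<^sup>2"
      using surface_energy_nonneg by (simp add: s_def field_simps)
    finally show "?S * (2 * s) \<le> \<delta>\<^sup>2" .
  qed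
  obtain F where F: "\<And>x. (F has_real_derivative f x) (at x)"
    using continuous_has_antiderivative[OF cf] by blast
  define k where "k x = (F (x + s) - F x) / s" for x
  define k' where "k' x = (f (x + s) - f x) / s" for x
  have k: "(k has_real_derivative k' x) (at x)" for x
  proof -
    have "((\<lambda>x. F (x + s)) has_real_derivative f (x + s)) (at x)"
      using DERIV_shift[of F "f (x + s)" x s] F[of "x + s"] by simp
    from DERIV_cdivide[OF DERIV_diff[OF this F]] show ?thesis
      unfolding k_def k'_def .
  qed
  have ck': "continuous_on UNIV k'"
    unfolding k'_def divide_inverse by (intro continuous_intros continuous_on_compose2[OF cf] cf) auto
  have k_mean: "\<exists>\<xi>. x < \<xi> \<and> \<xi> < x + s \<and> k x = f \<xi>" for x
  proof -
    obtain \<xi> where "x < \<xi>" "\<xi> < x + s" "F (x + s) - F x = (x + s - x) * f \<xi>"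
      using MVT2[of x "x + s" F f] s(1) F by auto
    then show ?thesis using s(1) by (auto simp: k_def)
  qed
  have k0: "0 \<le> k x" and kD: "k x \<le> D" for x
  proof -
    obtain \<xi> where "k x = f \<xi>" using k_mean by blast
    then show "0 \<le> k x" "k x \<le> D"
      using D[of \<xi>] D0 \<delta> by (simp_all add: f_def)
  qed
  define R' where "R' = R + s"
  have R': "R' > 0" using R s by (simp add: R'_def)
  have kR: "k x = 0 \<and> k' x = 0" if "x \<notin> {-R'..R'}" for x
  proof -
    obtain \<xi> where \<xi>: "x < \<xi>" "\<xi> < x + s" "k x = f \<xi>" using k_mean by blast
    have "R \<le> \<bar>\<xi>\<bar>" "R \<le> \<bar>x\<bar>" "R \<le> \<bar>x + s\<bar>"
      using \<xi>(1,2) that s(1) R(1) by (auto simp: R'_def)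
    then show ?thesis using \<xi>(3) fR by (simp add: k'_def)
  qed
  have kh: "k x \<le> h y" if "\<bar>x - y\<bar> \<le> s" for x y
  proof -
    obtain \<xi> where \<xi>: "x < \<xi>" "\<xi> < x + s" "k x = f \<xi>" using k_mean by blast
    have "?S * \<bar>\<xi> - y\<bar> \<le> ?S * (2 * s)"
      using \<xi>(1,2) that surface_energy_nonneg by (intro mult_left_mono) auto
    then have "sqrt (?S * \<bar>\<xi> - y\<bar>) \<le> sqrt (\<delta>\<^sup>2)"
      using s(2) by (intro real_sqrt_le_mono) linarith
    also have "\<dots> = \<delta>" using \<delta> by simp
    finally have "h \<xi> - \<delta> \<le> h y"
      using increment_le[of \<xi> y] by linarith
    then show ?thesis using \<xi>(3) h0 by (simp add: f_def)
  qed
  have E: "integral {-R'..R'} k - D * integral {-R'..R'} (\<lambda>x. (k' x)\<^sup>2) \<le> elastic_energy u h"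
    by (rule elastic_energy_ge[OF hc u tr k ck' k0 R' kR s(1) kh kD])
  have cF: "continuous_on A F" for A
    using F by (auto intro!: continuous_at_imp_continuous_on DERIV_isCont)
  have int_k: "integral {-R'..R'} k = (\<integral>x. f x \<partial>lebesgue)"
  proof -
    have const: "F y = F x" if "x \<le> y" "\<And>t. t \<in> {x..y} \<Longrightarrow> R \<le> \<bar>t\<bar>" for x y
    proof -
      have "(f has_integral 0) {x..y}"
        by (rule has_integral_eq[OF _ has_integral_0]) (use that fR in simp)
      then show ?thesis
        using has_integral_unique[OF has_integral_DERIV[OF F that(1)]] by fastforce
    qed
    have "integral {-R'..R'} k = integral {-R'..R'} (\<lambda>x. F (x + s) - F x) / s"
      unfolding k_def by simp
    also have "integral {-R'..R'} (\<lambda>x. F (x + s) - F x) = integral {R'..R' + s} F - integral {-R'..-R' + s} F"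
      using R' s(1) by (intro integral_translation_difference cF) auto
    also have "integral {R'..R' + s} F = integral {R'..R' + s} (\<lambda>_. F R)"
      by (intro Henstock_Kurzweil_Integration.integral_cong const) (use R(1) s(1) in \<open>auto simp: R'_def\<close>)
    also have "integral {-R'..-R' + s} F = integral {-R'..-R' + s} (\<lambda>_. F (- R))"
      by (intro Henstock_Kurzweil_Integration.integral_cong const[symmetric]) (use R(1) s(1) in \<open>auto simp: R'_def\<close>)
    also have "(integral {R'..R' + s} (\<lambda>_. F R) - integral {-R'..-R' + s} (\<lambda>_. F (- R))) / s = F R - F (- R)"
      using s(1) by (simp add: field_simps)
    also have "\<dots> = integral {-R..R} f"
      using has_integral_DERIV[OF F, of "- R" R] R(1) by (simp add: integral_unique)
    also have "\<dots> = integral UNIV f"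
      using fR by (intro integral_interval_eq_UNIV) auto
    also have "\<dots> = (\<integral>x. f x \<partial>lebesgue)"
    proof (rule integral_lebesgue)
      have "integrable lborel f"
        by (rule integrable_continuous_compact_support[OF cf, of "{-R..R}"]) (use fR in auto)
      then show "integrable lebesgue f"
        using integrable_completion by (metis borel_measurable_integrable)
    qed
    finally show ?thesis .
  qed
  have int_k': "integral {-R'..R'} (\<lambda>x. (k' x)\<^sup>2) \<le> ?S"
  proof -
    \<comment> \<open>By the Cauchy-Schwarz inequality the square of \<open>k'\<close> is bounded by a difference quotient of the
      increasing function \<open>P\<close>.\<close>
    define P where "P x = integral {-R'..x} (\<lambda>x. (?g x)\<^sup>2)" for x
    have cP: "continuous_on {-R'..R' + s} P"
      unfolding P_def by (intro indefinite_integral_continuous_1 weak_derivative_square_integrable)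
    have le: "(k' x)\<^sup>2 \<le> (P (x + s) - P x) / s" if "x \<in> {-R'..R'}" for x
    proof -
      have "\<bar>f (x + s) - f x\<bar> \<le> \<bar>h (x + s) - h x\<bar>"
        by (auto simp: f_def)
      then have "(f (x + s) - f x)\<^sup>2 \<le> (h (x + s) - h x)\<^sup>2"
        by (simp add: abs_le_square_iff)
      also have "\<dots> \<le> (x + s - x) * integral {x..x + s} (\<lambda>x. (?g x)\<^sup>2)"
        using s(1) by (intro square_increment_le) simp
      also have "integral {x..x + s} (\<lambda>x. (?g x)\<^sup>2) = P (x + s) - P x"
        using Henstock_Kurzweil_Integration.integral_combine[of "- R'" x "x + s" "\<lambda>x. (?g x)\<^sup>2"] that s(1)
          weak_derivative_square_integrable(2) by (simp add: P_def)
      finally have "(f (x + s) - f x)\<^sup>2 / s\<^sup>2 \<le> s * (P (x + s) - P x) / s\<^sup>2"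
        by (intro divide_right_mono) auto
      then show ?thesis
        using s(1) by (simp add: k'_def power_divide power2_eq_square)
    qed
    have cPs: "continuous_on {-R'..R'} (\<lambda>x. (P (x + s) - P x) / s)"
      unfolding divide_inverse
      by (intro continuous_intros continuous_on_compose2[OF cP] continuous_on_subset[OF cP]) (use s(1) in auto)
    have "integral {-R'..R'} (\<lambda>x. (k' x)\<^sup>2) \<le> integral {-R'..R'} (\<lambda>x. (P (x + s) - P x) / s)"
      by (intro integral_le le integrable_continuous_interval cPs continuous_intros continuous_on_subset[OF ck']) auto
    also have "\<dots> = integral {-R'..R'} (\<lambda>x. P (x + s) - P x) / s"
      by simp
    also have "integral {-R'..R'} (\<lambda>x. P (x + s) - P x) = integral {R'..R' + s} P - integral {-R'..-R' + s} P"
      using R' s(1) by (intro integral_translation_difference cP) auto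
    also have "\<dots> \<le> integral {R'..R' + s} (\<lambda>_. ?S) - 0"
    proof (rule diff_mono)
      show "integral {R'..R' + s} P \<le> integral {R'..R' + s} (\<lambda>_. ?S)"
        by (intro integral_le integrable_continuous_interval continuous_on_subset[OF cP] continuous_intros)
          (use R' in \<open>auto simp: P_def local_surface_energy_bounds\<close>)
      show "0 \<le> integral {-R'..-R' + s} P"
        by (intro Henstock_Kurzweil_Integration.integral_nonneg integrable_continuous_interval continuous_on_subset[OF cP])
          (use R' in \<open>auto simp: P_def local_surface_energy_bounds\<close>)
    qed
    also have "\<dots> = s * ?S" using s(1) by simp
    finally show ?thesis using s(1) by (simp add: divide_right_mono)
  qed
  have "D * integral {-R'..R'} (\<lambda>x. (k' x)\<^sup>2) \<le> D * ?S"
    using int_k' D0 by (rule mult_left_mono)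
  then show ?thesis
    using E int_k by (simp add: f_def)
qed

lemma elastic_energy_lower_bound:
  assumes u: "u \<in> H1 (subgraph h)"
    and tr: "bottom_trace h u \<tau>" "AE x in lebesgue. x \<in> supp h \<longrightarrow> \<tau> x = x"
    and D: "\<And>x. h x \<le> D"
  shows "V - D * surface_energy h \<le> elastic_energy u h"
proof -
  have int: "integrable lebesgue h" "(\<integral>x. h x \<partial>lebesgue) = V"
    using hV by (simp_all add: has_bochner_integral_iff)
  have "(\<lambda>n. \<integral>x. max 0 (h x - 1 / real (Suc n)) \<partial>lebesgue) \<longlonglongrightarrow> (\<integral>x. h x \<partial>lebesgue)"
  proof (rule integral_dominated_convergence[where w=h])
    show "h \<in> borel_measurable lebesgue" "integrable lebesgue h" using int by auto
    show "(\<lambda>x. max 0 (h x - 1 / real (Suc n))) \<in> borel_measurable lebesgue" for n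
      by (intro continuous_borel_measurable_lebesgue continuous_intros hc)
    show "AE x in lebesgue. (\<lambda>n. max 0 (h x - 1 / real (Suc n))) \<longlonglongrightarrow> h x"
    proof (rule AE_I2)
      fix x
      have "(\<lambda>n. max 0 (h x - 1 / real (Suc n))) \<longlonglongrightarrow> max 0 (h x - 0)"
        by (intro tendsto_intros LIMSEQ_Suc[OF lim_1_over_n])
      then show "(\<lambda>n. max 0 (h x - 1 / real (Suc n))) \<longlonglongrightarrow> h x"
        using h0[of x] by simp
    qed
    show "AE x in lebesgue. norm (max 0 (h x - 1 / real (Suc n))) \<le> h x" for n
      using h0 by (intro AE_I2) (auto simp: max_def)
  qed
  then have "(\<lambda>n. (\<integral>x. max 0 (h x - 1 / real (Suc n)) \<partial>lebesgue) - D * surface_energy h) \<longlonglongrightarrow> V - D * surface_energy h"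
    unfolding int(2) by (intro tendsto_intros)
  then show ?thesis
    by (rule LIMSEQ_le_const2) (use elastic_energy_ge_truncated[OF u tr D] in auto)
qed

lemma surface_energy_pos:
  assumes "V > 0"
  shows "surface_energy h > 0"
proof (rule ccontr)
  assume "\<not> ?thesis"
  then have S: "surface_energy h = 0" using surface_energy_nonneg by linarith
  have const: "h x = h 0" for x
    using increment_le[of x 0] by (simp add: S)
  have "h 0 = 0"
  proof (rule ccontr)
    assume "h 0 \<noteq> 0"
    then have pos: "0 < h 0" using h0[of 0] by linarith
    obtain R where "\<And>x. R \<le> \<bar>x\<bar> \<Longrightarrow> h x \<le> h 0 / 2"
      using h_vanishes_at_infinity[of "h 0 / 2"] pos by auto
    then have "h \<bar>R\<bar> \<le> h 0 / 2" by simp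
    then show False using const[of "\<bar>R\<bar>"] pos by simp
  qed
  then have "h = (\<lambda>x. 0)" using const by auto
  then have "V = 0" using hV by (simp add: has_bochner_integral_iff)
  then show False using assms by simp
qed

end

text \<open>The bound \<open>1 / 10\<close> is not optimal; it guarantees \<open>h \<le> V + sqrt S \<le> 1 / 10 + 1 / 2 < 1\<close> when
  \<open>S \<le> V\<close>.\<close>

lemma energy_gt_volume:
  assumes adm: "(u, h) \<in> admissible V" and V: "0 < V" "V \<le> 1 / 10"
  shows "V < elastic_energy u h + surface_energy h"
proof -
  have h: "h \<in> H1 UNIV" "continuous_on UNIV h" "\<And>x. 0 \<le> h x" "has_bochner_integral lebesgue h V"
    and u: "u \<in> H1 (subgraph h)"
    using adm by (auto simp: admissible_def)
  obtain \<tau> where tr: "bottom_trace h u \<tau>" "AE x in lebesgue. x \<in> supp h \<longrightarrow> \<tau> x = x"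
    using adm by (auto simp: admissible_def)
  let ?S = "surface_energy h"
  have S: "0 < ?S" by (rule surface_energy_pos[OF h V(1)])
  show ?thesis
  proof (cases "?S > V")
    case True
    have "0 \<le> elastic_energy u h"
      unfolding elastic_energy_def set_lebesgue_integral_def
      by (intro Bochner_Integration.integral_nonneg) (simp add: indicator_def)
    with True show ?thesis by linarith
  next
    case False
    have D: "h x \<le> V + sqrt ?S" for x by (rule height_le[OF h])
    have "sqrt ?S \<le> 1 / 2"
      using False V by (intro real_le_lsqrt) (auto simp: power2_eq_square)
    then have "(V + sqrt ?S) * ?S < 1 * ?S"
      using V S by (intro mult_strict_right_mono) auto
    then show ?thesis
      using elastic_energy_lower_bound[OF h u tr D] by linarith
  qed
qed

section \<open>Flat profiles\<close>

text \<open>The difference quotients of \<open>\<psi>\<close> have integral zero by translation invariance, and converge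
  boundedly to the directional derivative.\<close>

lemma integral_gradient_eq_0:
  fixes \<psi> :: "'a::euclidean_space \<Rightarrow> real" and G :: "'a \<Rightarrow> 'a"
  assumes D: "\<And>x. (\<psi> has_derivative (\<lambda>v. G x \<bullet> v)) (at x)"
    and G: "continuous_on UNIV G" "\<And>x. x \<notin> K \<Longrightarrow> G x = 0"
    and K: "compact K" "\<And>x. x \<notin> K \<Longrightarrow> \<psi> x = 0"
  shows "(\<integral>x. G x \<partial>lborel) = 0"
proof (rule euclidean_eqI)
  fix b :: 'a assume b: "b \<in> Basis"
  have c\<psi>: "continuous_on UNIV \<psi>"
    using D by (auto intro!: continuous_at_imp_continuous_on has_derivative_continuous)
  have int\<psi>: "integrable lborel \<psi>"
    by (rule integrable_continuous_compact_support[OF c\<psi> K(2) K(1)])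
  have intG: "integrable lborel G"
    by (rule integrable_continuous_compact_support[OF G K(1)])
  have "bounded (G ` K)"
    by (intro compact_imp_bounded compact_continuous_image continuous_on_subset[OF G(1)] K) auto
  then obtain C\<^sub>0 where "\<forall>y\<in>G ` K. norm y \<le> C\<^sub>0"
    unfolding bounded_iff by blast
  then have C: "norm (G x) \<le> max 0 C\<^sub>0" for x
    using G(2)[of x] by (cases "x \<in> K") (auto simp: le_max_iff_disj)
  define C where "C = max 0 C\<^sub>0"
  have lip: "norm (\<psi> x - \<psi> y) \<le> C * norm (x - y)" for x y
  proof (rule differentiable_bound[of UNIV \<psi> "\<lambda>x v. G x \<bullet> v"])
    show "onorm (\<lambda>v. G x \<bullet> v) \<le> C" for x
    proof (rule onorm_bound)
      show "0 \<le> C" by (simp add: C_def)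
      fix v
      have "norm (G x \<bullet> v) \<le> norm (G x) * norm v" unfolding real_norm_def by (rule Cauchy_Schwarz_ineq2)
      also have "\<dots> \<le> C * norm v" using C[of x] by (intro mult_right_mono) (auto simp: C_def)
      finally show "norm (G x \<bullet> v) \<le> C * norm v" .
    qed
  qed (use D in auto)
  obtain r where "\<forall>x\<in>K. norm x \<le> r"
    using compact_imp_bounded[OF K(1)] unfolding bounded_iff by blast
  then have r: "K \<subseteq> cball 0 r" by auto
  define t where "t n = 1 / real (Suc n)" for n
  have t: "0 < t n" "t n \<le> 1" for n by (auto simp: t_def)
  have nb: "norm b = 1" using b by simp
  define f where "f n x = (\<psi> (x + t n *\<^sub>R b) - \<psi> x) / t n" for n x
  have "(\<lambda>n. \<integral>x. f n x \<partial>lborel) \<longlonglongrightarrow> (\<integral>x. G x \<bullet> b \<partial>lborel)"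
  proof (rule integral_dominated_convergence[where w="\<lambda>x. C * indicator (cball 0 (r + 1)) x"])
    show "(\<lambda>x. G x \<bullet> b) \<in> borel_measurable lborel"
      using borel_measurable_integrable[OF intG] by (intro borel_measurable_inner) auto
    show "f n \<in> borel_measurable lborel" for n
    proof -
      have "continuous_on UNIV (f n)"
        unfolding f_def[abs_def] divide_inverse
        by (intro continuous_intros c\<psi> continuous_on_compose2[OF c\<psi>]) auto
      then show ?thesis using borel_measurable_continuous_onI by simp
    qed
    show "integrable lborel (\<lambda>x::'a. C * indicator (cball 0 (r + 1)) x)"
      using emeasure_bounded_finite[OF bounded_cball, of "0 :: 'a" "r + 1"]
      by (intro integrable_mult_right integrable_real_indicator) auto
    show "AE x in lborel. (\<lambda>n. f n x) \<longlonglongrightarrow> G x \<bullet> b"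
    proof (rule AE_I2)
      fix x
      have "((\<lambda>s. \<psi> (x + s *\<^sub>R b)) has_derivative (\<lambda>s. G x \<bullet> (s *\<^sub>R b))) (at 0)"
        by (rule has_derivative_compose[where f="\<lambda>s. x + s *\<^sub>R b" and g=\<psi>])
          (use D in \<open>auto intro!: derivative_eq_intros\<close>)
      then have "((\<lambda>s. \<psi> (x + s *\<^sub>R b)) has_real_derivative G x \<bullet> b) (at 0)"
        unfolding has_field_derivative_def by (simp add: mult_commute_abs)
      then have lim: "((\<lambda>s. (\<psi> (x + s *\<^sub>R b) - \<psi> x) / s) \<longlongrightarrow> G x \<bullet> b) (at 0)"
        unfolding has_field_derivative_iff by simp
      have "filterlim t (at 0) sequentially"
        unfolding filterlim_at t_def using LIMSEQ_Suc[OF lim_1_over_n] by auto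
      from filterlim_compose[OF lim this] show "(\<lambda>n. f n x) \<longlonglongrightarrow> G x \<bullet> b"
        unfolding f_def .
    qed
    show "AE x in lborel. norm (f n x) \<le> C * indicator (cball 0 (r + 1)) x" for n
    proof (rule AE_I2)
      fix x
      show "norm (f n x) \<le> C * indicator (cball 0 (r + 1)) x"
      proof (cases "x \<in> cball 0 (r + 1)")
        case True
        have "norm (\<psi> (x + t n *\<^sub>R b) - \<psi> x) \<le> C * t n"
          using lip[of "x + t n *\<^sub>R b" x] t[of n] nb by simp
        then show ?thesis
          using True t[of n] by (simp add: f_def field_simps)
      next
        case False
        then have "r + 1 < norm x" by simp
        moreover have "norm x \<le> norm (x + t n *\<^sub>R b) + norm (t n *\<^sub>R b)"
          using norm_triangle_ineq4[of "x + t n *\<^sub>R b" "t n *\<^sub>R b"] by simp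
        ultimately have "r < norm (x + t n *\<^sub>R b)" "r < norm x"
          using t[of n] nb by auto
        then have "x + t n *\<^sub>R b \<notin> K" "x \<notin> K" using r by auto
        then show ?thesis using K(2) False by (simp add: f_def)
      qed
    qed
  qed
  moreover have "(\<integral>x. f n x \<partial>lborel) = 0" for n
  proof -
    have shift: "integrable lborel (\<lambda>x. \<psi> (x + t n *\<^sub>R b))" "(\<integral>x. \<psi> (x + t n *\<^sub>R b) \<partial>lborel) = (\<integral>x. \<psi> x \<partial>lborel)"
    proof -
      have m: "\<psi> \<in> borel_measurable borel" using c\<psi> by (rule borel_measurable_continuous_onI)
      have "integrable (distr lborel borel ((+) (t n *\<^sub>R b))) \<psi>"
        using int\<psi> by (simp add: lborel_distr_plus)
      then show "integrable lborel (\<lambda>x. \<psi> (x + t n *\<^sub>R b))"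
        using m by (subst (asm) integrable_distr_eq) (auto simp: add.commute)
      have "(\<integral>x. \<psi> x \<partial>lborel) = (\<integral>x. \<psi> x \<partial>distr lborel borel ((+) (t n *\<^sub>R b)))"
        by (simp add: lborel_distr_plus)
      also have "\<dots> = (\<integral>x. \<psi> (x + t n *\<^sub>R b) \<partial>lborel)"
        using m by (subst integral_distr) (auto simp: add.commute)
      finally show "(\<integral>x. \<psi> (x + t n *\<^sub>R b) \<partial>lborel) = (\<integral>x. \<psi> x \<partial>lborel)" by simp
    qed
    show ?thesis
      unfolding f_def using shift int\<psi> by (simp add: Bochner_Integration.integral_diff)
  qed
  ultimately have "(\<integral>x. G x \<bullet> b \<partial>lborel) = 0"
    by (simp add: LIMSEQ_const_iff)
  then show "(\<integral>x. G x \<partial>lborel) \<bullet> b = 0 \<bullet> b"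
    using intG by simp
qed

text \<open>Integration by parts: \<open>f \<nabla>\<phi> + \<phi> \<nabla>f\<close> is the gradient of the compactly supported
  function \<open>f \<phi>\<close>.\<close>

lemma has_weak_gradient_C1:
  fixes f :: "'a::euclidean_space \<Rightarrow> real" and G :: "'a \<Rightarrow> 'a"
  assumes D: "\<And>x. (f has_derivative (\<lambda>v. G x \<bullet> v)) (at x)" and G: "continuous_on UNIV G"
  shows "has_weak_gradient \<Omega> f G"
  unfolding has_weak_gradient_def
proof (intro conjI allI impI)
  have cf: "continuous_on UNIV f"
    using D by (auto intro!: continuous_at_imp_continuous_on has_derivative_continuous)
  show "loc_integrable \<Omega> f" "loc_integrable \<Omega> G"
    unfolding loc_integrable_def
    by (auto intro!: set_integrable_continuous_bounded cf G compact_imp_bounded lmeasurable_compact fmeasurableD)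
  fix \<phi> :: "'a \<Rightarrow> real" assume \<phi>: "test_function \<Omega> \<phi>"
  then have supp: "compact (supp \<phi>)" "supp \<phi> \<subseteq> \<Omega>" and sm: "smooth \<phi>"
    by (auto simp: test_function_def)
  note d\<phi> = smooth_has_derivative_gradient[OF sm]
  have c\<phi>: "continuous_on UNIV \<phi>" by (rule test_function_continuous[OF \<phi>])
  have int: "integrable lborel (\<lambda>x. f x *\<^sub>R gradient \<phi> x)" "integrable lborel (\<lambda>x. \<phi> x *\<^sub>R G x)"
    by (rule integrable_continuous_compact_support[of _ "supp \<phi>"];
      auto intro!: continuous_intros cf G c\<phi> d\<phi>(2) simp: supp supp_eq_0 gradient_eq_0_outside_supp)+
  have "(\<integral>x. f x *\<^sub>R gradient \<phi> x + \<phi> x *\<^sub>R G x \<partial>lborel) = 0"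
  proof (rule integral_gradient_eq_0[of "\<lambda>x. f x * \<phi> x" _ "supp \<phi>"])
    show "((\<lambda>x. f x * \<phi> x) has_derivative (\<lambda>v. (f x *\<^sub>R gradient \<phi> x + \<phi> x *\<^sub>R G x) \<bullet> v)) (at x)" for x
      using has_derivative_mult[OF D[of x] d\<phi>(1)[of x]] by (simp add: inner_add_left mult.commute)
    show "continuous_on UNIV (\<lambda>x. f x *\<^sub>R gradient \<phi> x + \<phi> x *\<^sub>R G x)"
      by (intro continuous_intros cf G c\<phi> d\<phi>(2))
  qed (auto simp: supp supp_eq_0 gradient_eq_0_outside_supp)
  then have eq: "(\<integral>x. f x *\<^sub>R gradient \<phi> x \<partial>lborel) = - (\<integral>x. \<phi> x *\<^sub>R G x \<partial>lborel)"
    using int by (simp add: Bochner_Integration.integral_add eq_neg_iff_add_eq_0)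
  have "(LINT x:\<Omega>|lebesgue. f x *\<^sub>R gradient \<phi> x) = (LINT x|lebesgue. f x *\<^sub>R gradient \<phi> x)"
    unfolding set_lebesgue_integral_def using supp gradient_eq_0_outside_supp[of _ \<phi>]
    by (intro Bochner_Integration.integral_cong) (auto simp: indicator_def)
  moreover have "(LINT x:\<Omega>|lebesgue. \<phi> x *\<^sub>R G x) = (LINT x|lebesgue. \<phi> x *\<^sub>R G x)"
    unfolding set_lebesgue_integral_def using supp supp_eq_0[of _ \<phi>]
    by (intro Bochner_Integration.integral_cong) (auto simp: indicator_def)
  ultimately show "(LINT x:\<Omega>|lebesgue. f x *\<^sub>R gradient \<phi> x) = - (LINT x:\<Omega>|lebesgue. \<phi> x *\<^sub>R G x)"
    using eq integral_completion[OF borel_measurable_integrable[OF int(1)]]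
      integral_completion[OF borel_measurable_integrable[OF int(2)]] by simp
qed

lemma has_derivative_fst_inner: "(fst has_derivative (\<lambda>v. (1, 0) \<bullet> v)) (at z)"
  for z :: "real \<times> real"
  by (auto intro!: derivative_eq_intros simp: inner_prod_def fun_eq_iff)

lemma has_weak_gradient_fst: "has_weak_gradient \<Omega> fst (\<lambda>_. (1, 0))"
  for \<Omega> :: "(real \<times> real) set"
  by (rule has_weak_gradient_C1) (auto intro: has_derivative_fst_inner continuous_intros)

lemma smooth_fst: "smooth (fst :: real \<times> real \<Rightarrow> real)"
proof -
  have "Ck k (\<lambda>z :: real \<times> real. fst z + 0)" for k
    by (rule Ck_affine[OF bounded_linear_fst])
  then show ?thesis by (simp add: smooth_def)
qed

lemma fst_in_H1:
  fixes \<Omega> :: "(real \<times> real) set"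
  assumes "bounded \<Omega>" "\<Omega> \<in> sets lebesgue"
  shows "fst \<in> H1 \<Omega>"
  unfolding H1_def
  by (auto intro!: L2_continuous_bounded assms continuous_intros exI[of _ "\<lambda>_. (1, 0)"] has_weak_gradient_fst)

text \<open>The function is its own smooth approximation.\<close>

lemma rectangle_trace_fst: "rectangle_trace a b d fst (\<lambda>x. x)"
proof -
  define Q where "Q = {a<..<b} \<times> {0<..<d}"
  have Q: "open Q" "bounded Q" "Q \<in> sets lebesgue"
    by (auto simp: Q_def rectangle_eq_box)
  have "AE z in lebesgue. z \<in> Q \<longrightarrow> weak_gradient Q fst z = (1, 0)"
    by (rule weak_gradient_AE_eq[OF Q(1) has_weak_gradient_fst])
  moreover have "gradient fst z = (1, 0)" for z :: "real \<times> real"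
    by (rule gradient_eqI[OF has_derivative_fst_inner])
  ultimately have "AE z in lebesgue. indicator Q z *\<^sub>R (norm (gradient fst z - weak_gradient Q fst z))\<^sup>2 = (0::real)"
    by (auto elim!: eventually_mono simp: indicator_def)
  then have "(LINT z:Q|lebesgue. (norm (gradient fst z - weak_gradient Q fst z))\<^sup>2) = 0"
    unfolding set_lebesgue_integral_def by (rule integral_eq_zero_AE)
  moreover have "L2 {a<..<b} (\<lambda>x. x)"
    by (intro L2_continuous_bounded continuous_intros) auto
  ultimately show ?thesis
    unfolding rectangle_trace_def Let_def Q_def[symmetric]
    using fst_in_H1[OF Q(2,3)] by (auto intro!: exI[of _ "\<lambda>_. fst"] simp: smooth_fst)
qed

text \<open>Cavalieri's principle.\<close>

lemma measure_subgraph: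
  assumes h: "continuous_on UNIV h" "\<And>x. 0 \<le> h x" "has_bochner_integral lborel h V"
  shows "measure lebesgue (subgraph h) = V"
proof -
  have [measurable]: "h \<in> borel_measurable borel"
    using h(1) by (rule borel_measurable_continuous_onI)
  have sets: "subgraph h \<in> sets borel" using open_subgraph[OF h(1)] by simp
  have "0 \<le> V"
    using h(2,3) by (auto simp: has_bochner_integral_iff)
  have "emeasure lborel (subgraph h) = emeasure (lborel \<Otimes>\<^sub>M lborel) (subgraph h)"
    by (simp only: lborel_prod)
  also have "\<dots> = (\<integral>\<^sup>+x. emeasure lborel (Pair x -` subgraph h) \<partial>lborel)"
    using sets by (intro lborel.emeasure_pair_measure_alt) (simp only: lborel_prod sets_lborel)
  also have "\<dots> = (\<integral>\<^sup>+x. ennreal (h x) \<partial>lborel)"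
  proof (rule nn_integral_cong)
    fix x
    have "Pair x -` subgraph h = {0<..<h x}" by (auto simp: subgraph_def)
    then show "emeasure lborel (Pair x -` subgraph h) = ennreal (h x)" using h(2)[of x] by simp
  qed
  also have "\<dots> = ennreal V"
    using h(2,3) by (subst nn_integral_eq_integral) (auto simp: has_bochner_integral_iff)
  finally have "emeasure lebesgue (subgraph h) = ennreal V"
    using sets by simp
  then show ?thesis using \<open>0 \<le> V\<close> by (simp add: measure_def)
qed

lemma admissible_compact_profile:
  fixes h h' :: "real \<Rightarrow> real"
  assumes h: "\<And>x. (h has_real_derivative h' x) (at x)" "continuous_on UNIV h'" "\<And>x. 0 \<le> h x"
    and L: "\<And>x. x \<notin> {-L..L} \<Longrightarrow> h x = 0 \<and> h' x = 0"
    and V: "integral {-L..L} h = V"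
  shows "(fst, h) \<in> admissible V" "elastic_energy fst h = V"
    "surface_energy h = integral {-L..L} (\<lambda>x. (h' x)\<^sup>2)"
proof -
  have ch: "continuous_on S h" for S
    using h(1) by (auto intro!: continuous_at_imp_continuous_on DERIV_isCont)
  have int: "integrable lborel f" if "continuous_on UNIV f" "\<And>x. x \<notin> {-L..L} \<Longrightarrow> f x = 0" for f :: "real \<Rightarrow> real"
    by (rule integrable_continuous_compact_support[of f "{-L..L}"]) (use that in auto)
  have int': "integrable lebesgue f" "(\<integral>x. f x \<partial>lebesgue) = integral {-L..L} f"
    if f: "continuous_on UNIV f" "\<And>x. x \<notin> {-L..L} \<Longrightarrow> f x = 0" for f :: "real \<Rightarrow> real"
  proof -
    have i: "integrable lborel f" by (rule int[OF f])
    then show l: "integrable lebesgue f"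
      using integrable_completion by (metis borel_measurable_integrable)
    have "(\<integral>x. f x \<partial>lebesgue) = integral UNIV f"
      by (rule integral_lebesgue[OF l, symmetric])
    also have "\<dots> = integral {-L..L} f"
      by (rule integral_interval_eq_UNIV[symmetric]) (rule f(2))
    finally show "(\<integral>x. f x \<partial>lebesgue) = integral {-L..L} f" .
  qed
  have wg: "has_weak_gradient UNIV h h'"
    by (rule has_weak_gradient_C1) (use h in \<open>auto simp: has_field_derivative_def\<close>)
  have L2: "L2 UNIV f" if "continuous_on UNIV f" "\<And>x. x \<notin> {-L..L} \<Longrightarrow> f x = 0" for f :: "real \<Rightarrow> real"
    unfolding L2_def set_borel_measurable_def set_integrable_def
    using that int'(1)[of "\<lambda>x. (norm (f x))\<^sup>2"]
    by (auto intro!: continuous_borel_measurable_lebesgue continuous_intros)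
  have hH1: "h \<in> H1 UNIV"
    unfolding H1_def using wg L2[OF ch] L2[OF h(2)] L by blast
  have hV: "has_bochner_integral lborel h V" "has_bochner_integral lebesgue h V"
    using int[OF ch] int'[OF ch] L V integral_completion[of h lborel]
    by (auto simp: has_bochner_integral_iff)
  have \<Omega>: "open (subgraph h)" by (rule open_subgraph[OF ch])
  have "bounded (h ` {-L..L})"
    by (intro compact_imp_bounded compact_continuous_image ch) auto
  then obtain C where "\<forall>y\<in>h ` {-L..L}. norm y \<le> C" unfolding bounded_iff by blast
  then have C: "h x \<le> C" if "x \<in> {-L..L}" for x
    using that by force
  have "subgraph h \<subseteq> {-L..L} \<times> {0..C}"
  proof
    fix z assume z: "z \<in> subgraph h"
    then have "h (fst z) \<noteq> 0" by (auto simp: subgraph_def)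
    then have "fst z \<in> {-L..L}" using L by blast
    with z C[of "fst z"] show "z \<in> {-L..L} \<times> {0..C}" by (auto simp: subgraph_def)
  qed
  then have bounded: "bounded (subgraph h)"
    by (rule bounded_subset[rotated]) (intro bounded_Times bounded_closed_interval)
  have u: "fst \<in> H1 (subgraph h)"
    using \<Omega> by (intro fst_in_H1 bounded) simp
  show "(fst, h) \<in> admissible V"
    unfolding admissible_def bottom_trace_def using hH1 ch h(3) u hV(2) rectangle_trace_fst
    by (auto intro!: exI[of _ "\<lambda>x. x"])
  have "AE z in lebesgue. z \<in> subgraph h \<longrightarrow> weak_gradient (subgraph h) fst z = (1, 0)"
    by (rule weak_gradient_AE_eq[OF \<Omega> has_weak_gradient_fst])
  then have ae: "AE z in lebesgue. indicat_real (subgraph h) z = indicator (subgraph h) z *\<^sub>R (norm (weak_gradient (subgraph h) fst z))\<^sup>2"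
    by eventually_elim (auto simp: indicator_def norm_Pair)
  have m: "indicat_real (subgraph h) \<in> borel_measurable lebesgue"
    using \<Omega> by (intro borel_measurable_indicator) simp
  have "elastic_energy fst h = (\<integral>z. indicat_real (subgraph h) z \<partial>lebesgue)"
    unfolding elastic_energy_def set_lebesgue_integral_def
    by (rule integral_cong_AE[OF borel_measurable_AE[OF m ae] m]) (rule eventually_mono[OF ae], rule sym)
  also have "\<dots> = V"
    using measure_subgraph[OF ch h(3) hV(1)] by simp
  finally show "elastic_energy fst h = V" .
  have "AE x in lebesgue. weak_gradient UNIV h x = h' x"
    using weak_gradient_AE_eq[OF open_UNIV wg] by simp
  then have ae: "AE x in lebesgue. (h' x)\<^sup>2 = (weak_gradient UNIV h x)\<^sup>2"
    by eventually_elim simp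
  have m: "(\<lambda>x. (h' x)\<^sup>2) \<in> borel_measurable lebesgue"
    by (intro continuous_borel_measurable_lebesgue continuous_intros h(2))
  have "surface_energy h = (\<integral>x. (h' x)\<^sup>2 \<partial>lebesgue)"
    unfolding surface_energy_def
    using ae borel_measurable_AE[OF m ae] m by (intro integral_cong_AE) (auto elim: eventually_mono)
  also have "\<dots> = integral {-L..L} (\<lambda>x. (h' x)\<^sup>2)"
    using L by (intro int'(2) continuous_intros h(2)) auto
  finally show "surface_energy h = integral {-L..L} (\<lambda>x. (h' x)\<^sup>2)" .
qed

text \<open>Spread the volume over \<open>[-L, L]\<close> with a fixed shape: the slope is of order \<open>V / L\<^sup>2\<close>, so the
  surface energy is of order \<open>V\<^sup>2 / L\<^sup>3\<close>.\<close>

lemma energy_near_volume: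
  assumes V: "V > 0" and e: "e > 0"
  shows "\<exists>u h. (u, h) \<in> admissible V \<and> elastic_energy u h + surface_energy h \<le> V + e"
proof -
  \<comment> \<open>The slope is at most \<open>2 V / L\<^sup>2\<close> on an interval of length \<open>2 L\<close>, which gives a surface energy of at
    most \<open>8 V\<^sup>2 / L\<^sup>3\<close>.\<close>
  define L where "L = max 1 (8 * V\<^sup>2 / e)"
  have L: "1 \<le> L" "8 * V\<^sup>2 \<le> e * L"
  proof -
    show "1 \<le> L" by (simp add: L_def)
    have "8 * V\<^sup>2 = e * (8 * V\<^sup>2 / e)" using e by simp
    also have "\<dots> \<le> e * L" using e by (intro mult_left_mono) (auto simp: L_def)
    finally show "8 * V\<^sup>2 \<le> e * L" .
  qed
  define h where "h x = V / L * partition_piece L 1 0 x" for x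
  define h' where "h' x = V / L * partition_piece_deriv L 1 0 x" for x
  have h: "(h has_real_derivative h' x) (at x)" for x
    unfolding h_def[abs_def] h'_def using L by (intro DERIV_cmult partition_piece_DERIV) simp
  have ch': "continuous_on S h'" for S
    unfolding h'_def[abs_def] by (intro continuous_intros continuous_partition_piece_deriv)
  have h0: "0 \<le> h x" for x
  proof -
    have "spline_step s \<le> spline_step t" if "s \<le> t" for s t
      using that by (rule DERIV_nonneg_imp_nondecreasing) (use spline_step_DERIV spline_bump_bounds in blast)
    then show ?thesis
      unfolding h_def partition_piece_def using V L by (intro mult_nonneg_nonneg) auto
  qed
  have hL: "h x = 0 \<and> h' x = 0" if "x \<notin> {-L..L}" for x
    using partition_piece_eq_0[of L x 0 1] that L by (auto simp: h_def h'_def)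
  have int_h: "integral {-L..L} h = V"
  proof -
    have D: "((\<lambda>x. L * spline_ramp (x / L + 1) - L * spline_ramp (x / L)) has_real_derivative partition_piece L 1 0 x) (at x)" for x
    proof -
      have "((\<lambda>x. L * spline_ramp (x / L + c)) has_real_derivative spline_step (x / L + c)) (at x)" for c
      proof -
        have "((\<lambda>x. x / L + c) has_real_derivative 1 / L) (at x)"
          using DERIV_add[OF DERIV_cdivide[OF DERIV_ident] DERIV_const] by simp
        from DERIV_cmult[OF DERIV_chain2[OF spline_ramp_DERIV this], of L] L(1) show ?thesis by simp
      qed
      from DERIV_diff[OF this[of 1] this[of 0]] show ?thesis
        by (simp add: partition_piece_def[abs_def])
    qed
    have "integral {-L..L} (partition_piece L 1 0) = L"
      using has_integral_DERIV[OF D, of "- L" L] L(1) by (simp add: integral_unique spline_nonpos spline_ge_1 algebra_simps)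
    then show ?thesis
      unfolding h_def using L(1) by simp
  qed
  note adm = admissible_compact_profile[OF h ch' h0 hL int_h]
  have "integral {-L..L} (\<lambda>x. (h' x)\<^sup>2) \<le> integral {-L..L} (\<lambda>x. (2 * V / L\<^sup>2)\<^sup>2)"
  proof (rule integral_le)
    show "(\<lambda>x. (h' x)\<^sup>2) integrable_on {-L..L}"
      by (intro integrable_continuous_interval continuous_intros ch')
    fix x
    have "\<bar>partition_piece_deriv L 1 0 x\<bar> \<le> 2 / L"
    proof -
      have "\<bar>spline_bump s - spline_bump t\<bar> \<le> 2" for s t
        using spline_bump_bounds[of s] spline_bump_bounds[of t] by linarith
      then show ?thesis
        using L(1) by (simp add: partition_piece_deriv_def diff_divide_distrib[symmetric] divide_right_mono)
    qed
    then have "V / L * \<bar>partition_piece_deriv L 1 0 x\<bar> \<le> V / L * (2 / L)"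
      using V L(1) by (intro mult_left_mono) auto
    then have "\<bar>h' x\<bar> \<le> 2 * V / L\<^sup>2"
      using V L(1) by (simp add: h'_def abs_mult power2_eq_square mult.commute)
    then have "\<bar>h' x\<bar>\<^sup>2 \<le> (2 * V / L\<^sup>2)\<^sup>2" by (intro power_mono) auto
    then show "(h' x)\<^sup>2 \<le> (2 * V / L\<^sup>2)\<^sup>2" by simp
  qed auto
  also have "\<dots> = 8 * V\<^sup>2 / L ^ 3"
    using L(1) by (simp add: power2_eq_square power3_eq_cube field_simps)
  also have "\<dots> \<le> 8 * V\<^sup>2 / L"
    using L(1) by (intro divide_left_mono) (auto simp: power3_eq_cube intro: mult_ge1_I)
  also have "\<dots> \<le> e"
    using L by (simp add: divide_le_eq)
  finally show ?thesis
    using adm by (intro exI[of _ fst] exI[of _ h]) simp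
qed

section \<open>The infimum and its non-attainment\<close>

theorem proposition3p13:
  shows "\<exists>Vbar::real. Vbar > 0 \<and>
    (\<forall>V. 0 < V \<and> V \<le> Vbar \<longrightarrow> min_energy V = V) \<and>
    (\<forall>V. 0 < V \<and> V < Vbar \<longrightarrow>
      \<not> (\<exists>u h. (u, h) \<in> admissible V \<and> elastic_energy u h + surface_energy h = min_energy V))"
proof -
  have min: "min_energy V = V" if V: "0 < V" "V \<le> 1 / 10" for V
    unfolding min_energy_def
  proof (rule cInf_eq_non_empty)
    let ?X = "{elastic_energy u h + surface_energy h | u h. (u, h) \<in> admissible V}"
    show "?X \<noteq> {}"
      using energy_near_volume[OF V(1), of 1] by auto
    show "V \<le> x" if "x \<in> ?X" for x
      using that energy_gt_volume[OF _ V] by force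
    show "y \<le> V" if y: "\<And>x. x \<in> ?X \<Longrightarrow> y \<le> x" for y
    proof (rule field_le_epsilon)
      fix e :: real assume "e > 0"
      then obtain u h where "(u, h) \<in> admissible V" "elastic_energy u h + surface_energy h \<le> V + e"
        using energy_near_volume[OF V(1)] by blast
      then show "y \<le> V + e" using y by force
    qed
  qed
  show ?thesis
  proof (intro exI[of _ "1 / 10"] conjI allI impI)
    fix V :: real assume V: "0 < V \<and> V < 1 / 10"
    show "\<not> (\<exists>u h. (u, h) \<in> admissible V \<and> elastic_energy u h + surface_energy h = min_energy V)"
      using energy_gt_volume[of _ _ V] min[of V] V by force
  qed (use min in auto)
qed

end
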